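(* Let $0<\gamma\le1$, $c\in[0,1]$ and let $\mathcal K\subseteq[0,1]^d$ be a convex compact set. Suppose the objective functions $f_{t,i}:[0,1]^d\to\mathbb R$ ($t\in[T]$, $i\in[N]$) are non-negative, monotone, $\gamma$-weakly up-concave with curvature bounded by $c$, continuous, differentiable, Lipschitz continuous and smooth (with common constants), that the zeroth-order query oracle is bounded, and that the weight matrix $A$ is symmetric and doubly stochastic with second largest eigenvalue $\lambda_2<1$. Let $\alpha=\frac{\gamma^2}{1+c\gamma^2}$. Run the bandit-feedback algorithm described in the context with block size $K$, step size $\eta$, smoothing parameter $\delta$ and error tolerance $\epsilon=K^2\eta^2\delta^{-2}$. Then for every agent $i$ $$\mathbb E[\mathcal R_\alpha^i]=O\left(\frac1\eta+\eta TK\delta^{-2}+\delta T\right),$$ with at most $O\left(\frac{T}{\epsilon K}\right)$ linear optimization oracle (LOO) calls and $O(T/K)$ communication complexity. In particular, for $0\le\theta\le1$, if $K=T^{1-\theta}$, $\delta=T^{-\theta/4}$ and $\eta=\frac{\delta}{\sqrt{KT}}$, then $\mathbb E[\mathcal R_\alpha^i]=O(T^{1-\theta/4})$ with at most $O(T^{2\theta})$ LOO calls and $O(T^\theta)$ communication complexity.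
   Context: **Functions.** Inequalities between vectors are coordinatewise. A differentiable $f$ is $\gamma$-weakly up-concave if for all $\mathbf x\le\mathbf y$: $\gamma\langle\nabla f(\mathbf y),\mathbf y-\mathbf x\rangle\le f(\mathbf y)-f(\mathbf x)\le\frac1\gamma\langle\nabla f(\mathbf x),\mathbf y-\mathbf x\rangle$. It is monotone if $\mathbf x\le\mathbf y$ implies $f(\mathbf x)\le f(\mathbf y)$. A monotone $f$ has curvature bounded by $c\in[0,1]$ if $f(\mathbf y+\mathbf z)-f(\mathbf y)\ge(1-c)(f(\mathbf x+\mathbf z)-f(\mathbf x))$ for all $\mathbf x,\mathbf y$ and $\mathbf z\ge0$ with all four points in the domain ($c=1$ is no restriction, giving $\alpha=\gamma^2/(1+\gamma^2)$). **Network.** $N$ agents are the nodes of an undirected graph $([N],E)$; $\mathcal N_i=\{j:(i,j)\in E\}\cup\{i\}$. $A=[a_{ij}]\in\mathbb R_+^{N\times N}$ has $a_{ij}>0$ only if $(i,j)\in E$ or $i=j$; its largest eigenvalue is $1$ and $\lambda_2$ is its second largest eigenvalue ($\lambda_2=1$ corresponds to a disconnected network). In one communication, agent $i$ receives $\sum_{j\in\mathcal N_i}a_{ij}\mathbf s^j$ from its neighbors' state vectors $\mathbf s^j$. Communication complexity is the total number of communications over the horizon. **Problem.** An adversary chooses the sequence $f_{t,i}$. At round $t$ agent $i$ plays $\hat{\mathbf x}_t^i\in\mathcal K$ and observes only (bandit feedback) the response of a zeroth-order oracle $\mathcal Q$ at $\hat{\mathbf x}_t^i$: a random number with mean $f_{t,i}(\hat{\mathbf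 x}_t^i)$, bounded in absolute value by a constant $B_0$. The $\alpha$-regret is $$\mathcal R_\alpha^i=\alpha\max_{\mathbf u\in\mathcal K}\frac1N\sum_{t=1}^T\sum_{j=1}^Nf_{t,j}(\mathbf u)-\frac1N\sum_{t=1}^T\sum_{j=1}^Nf_{t,j}(\hat{\mathbf x}_t^i).$$ **LOO and infeasible projection oracle.** Let $R=\max_{\mathbf x\in\mathcal K}\|\mathbf x\|$. For a convex compact $\mathcal K'\subseteq\mathcal K$, an LOO returns $\arg\max_{\mathbf u\in\mathcal K'}\langle\mathbf x,\mathbf u\rangle$. The infeasible projection oracle $\mathcal O_{IP}(\mathcal K',\mathbf x_0,\mathbf y_0,\epsilon)$ takes $\mathbf x_0\in\mathcal K'$, $\mathbf y_0\in\mathbb R^d$ and returns $(\mathbf x,\tilde{\mathbf y})$ with $\mathbf x\in\mathcal K'$, $\|\tilde{\mathbf y}\|\le R$, $\|\mathbf x-\tilde{\mathbf y}\|^2\le3\epsilon$ and $\|\tilde{\mathbf y}-\mathbf z\|^2\le\|\mathbf y_0-\mathbf z\|^2$ for all $\mathbf z\in\mathcal K'$. It is a known fact (used as given) that it can be implemented with at most $\lceil27R^2/\epsilon-2\rceil\max\big(1,\frac{\|\mathbf x_0-\mathbf y_0\|^2(\|\mathbf x_0-\mathbf y_0\|^2-\epsilon)}{4\epsilon^2}+1\big)$ LOO calls; this implementation is used. **Shrunk set.** Fix $\mathbf c\in\mathrm{relint}(\mathcal K)$ and $r>0$ such that $\mathrm{aff}(\mathcal K)\cap\mathbb B_r(\mathbf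 c)\subseteq\mathcal K$, where $\mathbb B_r(\mathbf c)$ is the ball of radius $r$ around $\mathbf c$. For $0<\delta<r$ let $\hat{\mathcal K}_\delta=(1-\frac\delta r)\mathcal K+\frac\delta r\mathbf c$. Let $\mathcal L_0=\mathrm{aff}(\mathcal K)-\mathbf x$ (any $\mathbf x\in\mathcal K$), $k=\dim\mathcal L_0$, and $\mathbb S^1$ the unit sphere centered at the origin of $\mathbb R^d$. **Algorithm.** Set $\mathbf x_1^i=\tilde{\mathbf y}_1^i=\mathbf c$ for all $i$. For $m=1,\dots,T/K$, with $\mathcal T_m=\{(m-1)K+1,\dots,mK\}$, each agent $i$ in parallel: for $t\in\mathcal T_m$, samples $\mathbf v_t^i$ uniformly from $\mathbb S^1\cap\mathcal L_0$, plays $\hat{\mathbf x}_t^i=\mathbf x_m^i+\delta\mathbf v_t^i$, queries $\mathcal Q$ at $\hat{\mathbf x}_t^i$ receiving $o_t^i$, and sets $\mathbf o_t^i=\frac k\delta o_t^i\mathbf v_t^i$; then communicates $(\mathbf x_m^i,\tilde{\mathbf y}_m^i)$ with its neighbors (once per block); then sets $$\mathbf y_{m+1}^i=\sum_{j\in\mathcal N_i}a_{ij}\tilde{\mathbf y}_m^j+\eta\sum_{t\in\mathcal T_m}\mathbf o_t^i,\qquad(\mathbf x_{m+1}^i,\tilde{\mathbf y}_{m+1}^i)=\mathcal O_{IP}\Big(\hat{\mathcal K}_\delta,\sum_{j\in\mathcal N_i}a_{ij}\mathbf x_m^j,\mathbf y_{m+1}^i,\epsilon\Big).$$ **Conventions.**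 $K$ is a positive integer dividing $T$ and $0<\delta<r$. Constants implied by $O(\cdot)$ may depend on the fixed problem parameters ($\gamma,c,d,k,R,r,N,\lambda_2$, the Lipschitz and smoothness constants, $B_0$) but not on $T,K,\eta,\epsilon,\delta$. LOO calls are counted per agent over the whole horizon.
   Formalization: The second largest eigenvalue λ₂ is taken in absolute value (0 if N=1), which excludes eigenvalue −1; with signed order the claim fails, e.g. for two agents whose weight matrix swaps their states. *)

theory Defs
  imports "HOL-Probability.Probability" "HOL-Library.Multiset"
begin

section \<open>Objective functions on the unit box\<close>

(* The derivative is taken within the box, so that it also makes sense on the boundary;
   it is unique there because the box has nonempty interior. *)
definition box_grad :: "(real ^ 'd \<Rightarrow> real) \<Rightarrow> real ^ 'd \<Rightarrow> real ^ 'd" where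
  "box_grad f x = (\<chi> j. frechet_derivative f (at x within cbox 0 1) (axis j 1))"

definition weakly_up_concave :: "real \<Rightarrow> (real ^ 'd \<Rightarrow> real) \<Rightarrow> bool" where
  "weakly_up_concave \<gamma> f \<longleftrightarrow>
     (\<forall>x\<in>cbox 0 1. \<forall>y\<in>cbox 0 1. x \<le> y \<longrightarrow>
        \<gamma> * (box_grad f y \<bullet> (y - x)) \<le> f y - f x \<and>
        f y - f x \<le> (1 / \<gamma>) * (box_grad f x \<bullet> (y - x)))"

definition curvature_bounded :: "real \<Rightarrow> (real ^ 'd \<Rightarrow> real) \<Rightarrow> bool" where
  "curvature_bounded c f \<longleftrightarrow>
     (\<forall>x y z. 0 \<le> z \<and> x \<in> cbox 0 1 \<and> y \<in> cbox 0 1 \<and> x + z \<in> cbox 0 1 \<and> y + z \<in> cbox 0 1 \<longrightarrow>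
        f (y + z) - f y \<ge> (1 - c) * (f (x + z) - f x))"

definition admissible_objective ::
  "real \<Rightarrow> real \<Rightarrow> real \<Rightarrow> real \<Rightarrow> (real ^ 'd \<Rightarrow> real) \<Rightarrow> bool" where
  "admissible_objective \<gamma> c L\<^sub>1 L\<^sub>2 f \<longleftrightarrow>
     (\<forall>x\<in>cbox 0 1. 0 \<le> f x) \<and>
     mono_on (cbox 0 1) f \<and>
     continuous_on (cbox 0 1) f \<and>
     f differentiable_on cbox 0 1 \<and>
     weakly_up_concave \<gamma> f \<and>
     curvature_bounded c f \<and>
     L\<^sub>1-lipschitz_on (cbox 0 1) f \<and>
     L\<^sub>2-lipschitz_on (cbox 0 1) (box_grad f)"


section \<open>Network\<close>

definition neighbourhood :: "('n \<times> 'n) set \<Rightarrow> 'n \<Rightarrow> 'n set" where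
  "neighbourhood E i = {j. (i, j) \<in> E} \<union> {i}"

(* For such a matrix the largest eigenvalue is automatically 1. *)
definition network :: "('n::finite \<times> 'n) set \<Rightarrow> real ^ 'n ^ 'n \<Rightarrow> bool" where
  "network E A \<longleftrightarrow>
     sym E \<and>
     (\<forall>i j. 0 \<le> A $ i $ j) \<and>
     (\<forall>i j. 0 < A $ i $ j \<longrightarrow> (i, j) \<in> E \<or> i = j) \<and>
     transpose A = A \<and>
     (\<forall>i. (\<Sum>j\<in>UNIV. A $ i $ j) = 1) \<and>
     (\<forall>j. (\<Sum>i\<in>UNIV. A $ i $ j) = 1)"

definition eigenspace :: "real ^ 'n ^ 'n \<Rightarrow> real \<Rightarrow> (real ^ 'n) set" where
  "eigenspace A \<mu> = {w. A *v w = \<mu> *\<^sub>R w}"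

(* Eigenvalues with multiplicity; only used for symmetric matrices, where all eigenvalues are
   real and geometric and algebraic multiplicities agree. *)
definition eigenvalue_mset :: "real ^ 'n ^ 'n \<Rightarrow> real multiset" where
  "eigenvalue_mset A =
     (\<Sum>\<mu> | eigenspace A \<mu> \<noteq> {0}. replicate_mset (dim (eigenspace A \<mu>)) \<mu>)"

(* Second largest in modulus, as is usual for gossip matrices.  The second largest signed
   eigenvalue would not do: the 2 x 2 matrix exchanging two agents has eigenvalues 1 and -1 and
   its iterates do not reach consensus.  A 1 x 1 matrix has no second eigenvalue; it gets 0. *)
definition second_eigenvalue :: "real ^ 'n ^ 'n \<Rightarrow> real" where
  "second_eigenvalue A =
     (let ls = rev (sorted_list_of_multiset (image_mset abs (eigenvalue_mset A)))
      in if 2 \<le> length ls then ls ! 1 else 0)"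


section \<open>Feasible set\<close>

definition direction_space :: "(real ^ 'd) set \<Rightarrow> real ^ 'd \<Rightarrow> (real ^ 'd) set" where
  "direction_space \<K> x = (\<lambda>y. y - x) ` (affine hull \<K>)"

definition feasible_set ::
  "(real ^ 'd) set \<Rightarrow> real ^ 'd \<Rightarrow> real \<Rightarrow> real \<Rightarrow> nat \<Rightarrow> bool" where
  "feasible_set \<K> ctr r R k \<longleftrightarrow>
     convex \<K> \<and> compact \<K> \<and> \<K> \<subseteq> cbox 0 1 \<and>
     ctr \<in> rel_interior \<K> \<and> 0 < r \<and> affine hull \<K> \<inter> cball ctr r \<subseteq> \<K> \<and>
     R = (SUP x\<in>\<K>. norm x) \<and>
     k = dim (direction_space \<K> ctr)"

definition shrunk_set :: "(real ^ 'd) set \<Rightarrow> real ^ 'd \<Rightarrow> real \<Rightarrow> real \<Rightarrow> (real ^ 'd) set" where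
  "shrunk_set \<K> ctr r \<delta> = (\<lambda>x. (1 - \<delta> / r) *\<^sub>R x + (\<delta> / r) *\<^sub>R ctr) ` \<K>"


section \<open>Linear optimization and infeasible projection\<close>

definition is_LOO :: "(real ^ 'd) set \<Rightarrow> (real ^ 'd \<Rightarrow> real ^ 'd) \<Rightarrow> bool" where
  "is_LOO \<K>' loo \<longleftrightarrow> (\<forall>x. loo x \<in> \<K>' \<and> (\<forall>u\<in>\<K>'. x \<bullet> u \<le> x \<bullet> loo x))"

(* A computation with access to a linear optimization oracle: it either returns, or queries the
   oracle at a point and continues depending on the answer. *)
datatype ('a, 'r) loo_program =
    Return 'r
  | Call_LOO 'a "'a \<Rightarrow> ('a, 'r) loo_program"

primrec program_result :: "('a \<Rightarrow> 'a) \<Rightarrow> ('a, 'r) loo_program \<Rightarrow> 'r" where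
  "program_result loo (Return r) = r"
| "program_result loo (Call_LOO q g) = program_result loo (g (loo q))"

primrec program_calls :: "('a \<Rightarrow> 'a) \<Rightarrow> ('a, 'r) loo_program \<Rightarrow> nat" where
  "program_calls loo (Return r) = 0"
| "program_calls loo (Call_LOO q g) = Suc (program_calls loo (g (loo q)))"

type_synonym 'd infeasible_projection =
  "(real ^ 'd) set \<Rightarrow> real ^ 'd \<Rightarrow> real ^ 'd \<Rightarrow> real
     \<Rightarrow> (real ^ 'd, (real ^ 'd) \<times> (real ^ 'd)) loo_program"

(* The ceiling is negative for large tolerances; no oracle call is needed there, whence the
   truncation by nat.  Measurability makes the iterates random variables. *)
definition implements_infeasible_projection ::
  "real \<Rightarrow> (real ^ 'd) set \<Rightarrow> real \<Rightarrow> (real ^ 'd \<Rightarrow> real ^ 'd) \<Rightarrow> 'd infeasible_projection \<Rightarrow> bool"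
  where
  "implements_infeasible_projection R \<K>' \<epsilon> loo ip \<longleftrightarrow>
     (\<forall>x\<^sub>0\<in>\<K>'. \<forall>y\<^sub>0.
        (let (x, y) = program_result loo (ip \<K>' x\<^sub>0 y\<^sub>0 \<epsilon>) in
           x \<in> \<K>' \<and> norm y \<le> R \<and> (norm (x - y))\<^sup>2 \<le> 3 * \<epsilon> \<and>
           (\<forall>z\<in>\<K>'. (norm (y - z))\<^sup>2 \<le> (norm (y\<^sub>0 - z))\<^sup>2)) \<and>
        real (program_calls loo (ip \<K>' x\<^sub>0 y\<^sub>0 \<epsilon>)) \<le>
          real (nat \<lceil>27 * R\<^sup>2 / \<epsilon> - 2\<rceil>) *
          max 1 ((norm (x\<^sub>0 - y\<^sub>0))\<^sup>2 * ((norm (x\<^sub>0 - y\<^sub>0))\<^sup>2 - \<epsilon>) / (4 * \<epsilon>\<^sup>2) + 1)) \<and>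
     (\<lambda>(x\<^sub>0, y\<^sub>0). program_result loo (ip \<K>' x\<^sub>0 y\<^sub>0 \<epsilon>))
       \<in> borel_measurable (restrict_space borel (\<K>' \<times> UNIV))"


section \<open>The algorithm\<close>

(* Per-agent state, instrumented with the numbers of LOO calls and of communications so far. *)
record 'a agent_state =
  feas_pt :: 'a
  infeas_pt :: 'a
  loo_calls :: nat
  comms :: nat

(* agent_states ... m i is the state of agent i after m blocks, so its points are the ones used
   in block m + 1, i.e. in rounds m * K + 1, ..., (m + 1) * K.  The arguments v and ob give the
   sampled directions and the oracle responses, indexed by round and agent. *)
primrec agent_states ::
  "(real ^ 'd) set \<Rightarrow> real ^ 'd \<Rightarrow> real \<Rightarrow> ('n::finite \<times> 'n) set \<Rightarrow> real ^ 'n ^ 'n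
     \<Rightarrow> nat \<Rightarrow> real \<Rightarrow> real \<Rightarrow> real \<Rightarrow> (real ^ 'd \<Rightarrow> real ^ 'd) \<Rightarrow> 'd infeasible_projection
     \<Rightarrow> (nat \<Rightarrow> 'n \<Rightarrow> real ^ 'd) \<Rightarrow> (nat \<Rightarrow> 'n \<Rightarrow> real) \<Rightarrow> nat \<Rightarrow> 'n \<Rightarrow> (real ^ 'd) agent_state"
  where
  "agent_states \<K> ctr r E A K \<eta> \<delta> \<epsilon> loo ip v ob 0 =
     (\<lambda>i. \<lparr>feas_pt = ctr, infeas_pt = ctr, loo_calls = 0, comms = 0\<rparr>)"
| "agent_states \<K> ctr r E A K \<eta> \<delta> \<epsilon> loo ip v ob (Suc m) =
     (\<lambda>i. let
        S = agent_states \<K> ctr r E A K \<eta> \<delta> \<epsilon> loo ip v ob m;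
        (x\<^sub>0, y) = (\<Sum>j\<in>neighbourhood E i. (A $ i $ j) *\<^sub>R (feas_pt (S j), infeas_pt (S j)));
        k = dim (direction_space \<K> ctr);
        y\<^sub>0 = y + \<eta> *\<^sub>R (\<Sum>t = m * K + 1..(m + 1) * K. (real k / \<delta> * ob t i) *\<^sub>R v t i);
        prog = ip (shrunk_set \<K> ctr r \<delta>) x\<^sub>0 y\<^sub>0 \<epsilon>;
        (x', y') = program_result loo prog
      in \<lparr>feas_pt = x', infeas_pt = y',
          loo_calls = loo_calls (S i) + program_calls loo prog,
          comms = comms (S i) + 1\<rparr>)"

definition played_point ::
  "(real ^ 'd) set \<Rightarrow> real ^ 'd \<Rightarrow> real \<Rightarrow> ('n::finite \<times> 'n) set \<Rightarrow> real ^ 'n ^ 'n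
     \<Rightarrow> nat \<Rightarrow> real \<Rightarrow> real \<Rightarrow> real \<Rightarrow> (real ^ 'd \<Rightarrow> real ^ 'd) \<Rightarrow> 'd infeasible_projection
     \<Rightarrow> (nat \<Rightarrow> 'n \<Rightarrow> real ^ 'd) \<Rightarrow> (nat \<Rightarrow> 'n \<Rightarrow> real) \<Rightarrow> nat \<Rightarrow> 'n \<Rightarrow> real ^ 'd"
  where
  "played_point \<K> ctr r E A K \<eta> \<delta> \<epsilon> loo ip v ob t i =
     feas_pt (agent_states \<K> ctr r E A K \<eta> \<delta> \<epsilon> loo ip v ob ((t - 1) div K) i) + \<delta> *\<^sub>R v t i"

definition regret ::
  "real \<Rightarrow> (real ^ 'd) set \<Rightarrow> nat \<Rightarrow> (nat \<Rightarrow> 'n::finite \<Rightarrow> real ^ 'd \<Rightarrow> real)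
     \<Rightarrow> (nat \<Rightarrow> real ^ 'd) \<Rightarrow> real"
  where
  "regret \<alpha> \<K> T f p =
     \<alpha> * (SUP u\<in>\<K>. 1 / real CARD('n) * (\<Sum>t = 1..T. \<Sum>j\<in>UNIV. f t j u))
     - 1 / real CARD('n) * (\<Sum>t = 1..T. \<Sum>j\<in>UNIV. f t j (p t))"


section \<open>Randomness\<close>

(* The uniform distribution on the unit sphere of a linear subspace L is the rotation-invariant
   probability measure on it. *)
definition uniform_on_unit_sphere :: "(real ^ 'd) set \<Rightarrow> (real ^ 'd) measure \<Rightarrow> bool" where
  "uniform_on_unit_sphere L \<mu> \<longleftrightarrow>
     prob_space \<mu> \<and> sets \<mu> = sets borel \<and>
     (AE w in \<mu>. w \<in> sphere 0 1 \<inter> L) \<and>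
     (\<forall>U. orthogonal_transformation U \<and> U ` L = L \<longrightarrow> distr \<mu> borel U = \<mu>)"

(* The sigma-algebra generated by the directions v s j with (s, j) in I and the oracle responses
   ob s j with (s, j) in J. *)
definition info ::
  "'w measure \<Rightarrow> (nat \<Rightarrow> 'n \<Rightarrow> 'w \<Rightarrow> real ^ 'd) \<Rightarrow> (nat \<Rightarrow> 'n \<Rightarrow> 'w \<Rightarrow> real)
     \<Rightarrow> (nat \<times> 'n) set \<Rightarrow> (nat \<times> 'n) set \<Rightarrow> 'w measure"
  where
  "info M v ob I J = sigma (space M)
     ({v s j -` B \<inter> space M | s j B. (s, j) \<in> I \<and> B \<in> sets borel} \<union>
      {ob s j -` B \<inter> space M | s j B. (s, j) \<in> J \<and> B \<in> sets borel})"

definition uniform_sampling ::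
  "'w measure \<Rightarrow> (real ^ 'd) set \<Rightarrow> nat \<Rightarrow> (nat \<Rightarrow> 'n \<Rightarrow> 'w \<Rightarrow> real ^ 'd)
     \<Rightarrow> (nat \<Rightarrow> 'n \<Rightarrow> 'w \<Rightarrow> real) \<Rightarrow> bool"
  where
  "uniform_sampling M L T v ob \<longleftrightarrow>
     (\<forall>t\<in>{1..T}. \<forall>i.
        v t i \<in> borel_measurable M \<and>
        (\<forall>\<omega>\<in>space M. v t i \<omega> \<in> sphere 0 1 \<inter> L) \<and>
        uniform_on_unit_sphere L (distr M borel (v t i)) \<and>
        prob_space.indep_set M
          (sets (vimage_algebra (space M) (v t i) borel))
          (sets (info M v ob ({1..<t} \<times> UNIV \<union> {t} \<times> (- {i})) ({1..<t} \<times> UNIV))))"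

(* p t i is the point played by agent i in round t.  The mean of a response is conditional on
   everything that precedes the query. *)
definition bounded_zeroth_order_oracle ::
  "'w measure \<Rightarrow> real \<Rightarrow> nat \<Rightarrow> (nat \<Rightarrow> 'n \<Rightarrow> real ^ 'd \<Rightarrow> real)
     \<Rightarrow> (nat \<Rightarrow> 'n \<Rightarrow> 'w \<Rightarrow> real ^ 'd) \<Rightarrow> (nat \<Rightarrow> 'n \<Rightarrow> 'w \<Rightarrow> real ^ 'd)
     \<Rightarrow> (nat \<Rightarrow> 'n \<Rightarrow> 'w \<Rightarrow> real) \<Rightarrow> bool"
  where
  "bounded_zeroth_order_oracle M B\<^sub>0 T f p v ob \<longleftrightarrow>
     (\<forall>t\<in>{1..T}. \<forall>i.
        ob t i \<in> borel_measurable M \<and>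
        (\<forall>\<omega>\<in>space M. \<bar>ob t i \<omega>\<bar> \<le> B\<^sub>0) \<and>
        (AE \<omega> in M. real_cond_exp M (info M v ob ({1..t} \<times> UNIV) ({1..<t} \<times> UNIV)) (ob t i) \<omega>
                     = f t i (p t i \<omega>)))"

end

theory Submission
  imports Defs
begin

text \<open>
  The regret is controlled through linear functions.  Splitting \<open>y - x\<close> into the move from \<open>x\<close> up to
  the join \<open>x \<squnion> y\<close> and the move from \<open>x\<close> down to the meet \<open>x \<sqinter> y\<close>, up-concavity along these two
  monotone segments together with the curvature bound yields
  \<open>\<alpha> f(y) - f(x) \<le> \<beta> \<langle>\<nabla>f(x), y - x\<rangle>\<close> with \<open>0 \<le> \<beta> \<le> 1\<close> (\<open>up_concave_linearization\<close>).  So it is enough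
  to bound the regret of the iterates \<open>x\<^sub>t\<^sup>j\<close> against the linear functions with gradients
  \<open>\<nabla>f\<^sub>t\<^sub>,\<^sub>j(x\<^sub>t\<^sup>j)\<close>.

  These gradients are replaced by the one-point estimates \<open>(k/\<delta>) o v\<close>.  By smoothness
  \<open>f(x + \<delta>v) = f(x) + \<delta>\<langle>\<nabla>f(x), v\<rangle> + O(\<delta>\<^sup>2)\<close>, and for a uniform direction \<open>v\<close> in the unit sphere of a
  \<open>k\<close>-dimensional space \<open>L\<close> rotation invariance gives \<open>E v = 0\<close> and \<open>E v v\<^sup>T = P/k\<close>, where \<open>P\<close> is the
  orthogonal projection to \<open>L\<close>.  Hence, conditionally on the past, the estimate has mean
  \<open>P \<nabla>f(x) + O(\<delta>)\<close>, and since the differences of feasible points lie in \<open>L\<close>, they have the same inner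
  product with \<open>P \<nabla>f(x)\<close> as with \<open>\<nabla>f(x)\<close> (\<open>gradient_estimate\<close>).

  What remains is a deterministic statement about each sample path (locale \<open>gossip_run\<close>): online
  gradient ascent with steps \<open>\<eta>\<close>, with gossip averaging and with infeasible projections.  All its errors
  are multiples of the one length \<open>h = K\<eta>/\<delta>\<close>, whose square is the tolerance \<open>\<epsilon>\<close>.  In a block every
  agent moves by \<open>O(h)\<close> from the average that it receives, a gossip step contracts the disagreement of the agents by the factor \<open>\<lambda>\<^sub>2\<close>
  (\<open>network_contraction\<close>), and therefore the disagreement stays of order \<open>h/(1 - \<lambda>\<^sub>2)\<close>.  The potential
  \<open>\<Sum>\<^sub>i |y\<^sup>i - z|\<^sup>2\<close> decreases under averaging by convexity and under infeasible projection by definition,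
  so the usual telescoping bounds the linear regret by \<open>O(1/\<eta> + \<eta>TK/\<delta>\<^sup>2)\<close>.  The remaining error terms,
  from comparing agents with each other, from shrinking the feasible set and from the exploration
  radius, are \<open>O(hT + \<delta>T)\<close>, and \<open>hT = \<delta> \<cdot> \<eta>TK/\<delta>\<^sup>2\<close> is dominated because \<open>\<delta> < r\<close>.

  The point to be projected is at distance \<open>O(h)\<close> from the feasible point that starts the projection, and
  \<open>\<epsilon> = h\<^sup>2\<close>; so a projection takes \<open>O(1/\<epsilon>)\<close> linear optimizations, and there is one projection per
  block.
\<close>

section \<open>Up-concave functions on the box\<close>

lemma mem_unit_box_cart:
  fixes x :: "real ^ 'd"
  shows "x \<in> cbox 0 1 \<longleftrightarrow> (\<forall>i. 0 \<le> x $ i \<and> x $ i \<le> 1)"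
  by (simp add: mem_box_cart)

text \<open>The gradient at \<open>x\<close> need not control \<open>f\<close> in the direction \<open>y - x\<close>, which is not monotone.  It does so
along the monotone segments from \<open>x\<close> to the join \<open>u\<close> and from the meet \<open>l\<close> to \<open>x\<close>, and
\<open>y - x = (u - x) - (x - l)\<close>.  The curvature bound compares the increments over the translated segments
from \<open>l\<close> to \<open>x\<close> and from \<open>y\<close> to \<open>u\<close>.\<close>

lemma up_concave_linearization:
  fixes f :: "real ^ 'd \<Rightarrow> real"
  assumes "0 < \<gamma>" "\<gamma> \<le> 1" "0 \<le> c" "c \<le> 1"
    and adm: "admissible_objective \<gamma> c L\<^sub>1 L\<^sub>2 f"
    and x: "x \<in> cbox 0 1" and y: "y \<in> cbox 0 1"
  shows "\<gamma>\<^sup>2 / (1 + c * \<gamma>\<^sup>2) * f y - f x \<le> \<gamma> / (1 + c * \<gamma>\<^sup>2) * (box_grad f x \<bullet> (y - x))"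
proof -
  define u where "u = (\<chi> i. max (x $ i) (y $ i))"
  define l where "l = (\<chi> i. min (x $ i) (y $ i))"
  have u: "u \<in> cbox 0 1" and l: "l \<in> cbox 0 1"
    using x y by (auto simp: mem_unit_box_cart u_def l_def max_def min_def)
  have sum: "u - x = y - l" and xu: "x \<le> u" and lx: "l \<le> x"
    by (auto simp: vec_eq_iff u_def l_def less_eq_vec_def max_def min_def)
  have wuc: "weakly_up_concave \<gamma> f" and cur: "curvature_bounded c f" and nonneg: "0 \<le> f l"
    using adm l by (auto simp: admissible_objective_def)
  have up: "f u - f x \<le> (1 / \<gamma>) * (box_grad f x \<bullet> (u - x))"
    and down: "\<gamma> * (box_grad f x \<bullet> (x - l)) \<le> f x - f l"
    using wuc x u l xu lx by (auto simp: weakly_up_concave_def)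
  have split: "box_grad f x \<bullet> (y - x) = box_grad f x \<bullet> (u - x) - box_grad f x \<bullet> (x - l)"
    using sum by (simp add: inner_diff_right)
  have up': "\<gamma> * (f u - f x) \<le> box_grad f x \<bullet> (u - x)"
    using up \<open>0 < \<gamma>\<close> by (simp add: field_simps)
  have down': "box_grad f x \<bullet> (x - l) \<le> (f x - f l) / \<gamma>"
    using down \<open>0 < \<gamma>\<close> by (simp add: field_simps)
  \<comment> \<open>curvature for the increment \<open>x - l\<close>, starting from \<open>l\<close> and from \<open>y\<close>\<close>
  have curv: "\<gamma> * ((1 - c) * (f x - f l) + f y) \<le> \<gamma> * f u"
  proof -
    have "y + (x - l) = u" "l + (x - l) = x"
      using sum by (simp_all add: algebra_simps)
    then have "(1 - c) * (f x - f l) \<le> f u - f y"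
      using cur[unfolded curvature_bounded_def, rule_format, of "x - l" l y] lx l x y u by simp
    then show ?thesis
      using \<open>0 < \<gamma>\<close> by (intro mult_left_mono) auto
  qed
  have "\<gamma>\<^sup>2 * f y - (1 + c * \<gamma>\<^sup>2) * f x \<le> \<gamma> * (box_grad f x \<bullet> (y - x))"
  proof -
    have "\<gamma> * (box_grad f x \<bullet> (y - x)) \<ge> \<gamma> * (\<gamma> * (f u - f x) - (f x - f l) / \<gamma>)"
      using split up' down' \<open>0 < \<gamma>\<close> by (intro mult_left_mono) auto
    moreover have "\<gamma> * (\<gamma> * (f u - f x) - (f x - f l) / \<gamma>) = \<gamma> * (\<gamma> * f u) - \<gamma>\<^sup>2 * f x - f x + f l"
      using \<open>0 < \<gamma>\<close> by (simp add: field_simps power2_eq_square)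
    moreover have "\<gamma> * (\<gamma> * ((1 - c) * (f x - f l) + f y)) \<le> \<gamma> * (\<gamma> * f u)"
      using curv \<open>0 < \<gamma>\<close> by (intro mult_left_mono) auto
    moreover have "\<gamma>\<^sup>2 * (1 - c) * f l \<le> 1 * f l"
      using assms(1-4) nonneg
      by (intro mult_right_mono mult_le_one) (auto simp: power_le_one)
    ultimately show ?thesis
      by (simp add: algebra_simps power2_eq_square)
  qed
  then have "(\<gamma>\<^sup>2 * f y - (1 + c * \<gamma>\<^sup>2) * f x) / (1 + c * \<gamma>\<^sup>2)
      \<le> (\<gamma> * (box_grad f x \<bullet> (y - x))) / (1 + c * \<gamma>\<^sup>2)"
    using assms(1-3) by (intro divide_right_mono) auto
  moreover have "1 + c * \<gamma>\<^sup>2 \<noteq> 0"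
    using assms(1-3) by (smt (verit) mult_nonneg_nonneg zero_le_power2)
  ultimately show ?thesis
    by (simp add: diff_divide_distrib)
qed

lemma box_grad_has_derivative:
  fixes f :: "real ^ 'd \<Rightarrow> real"
  assumes "f differentiable_on cbox 0 1" "x \<in> cbox 0 1"
  shows "(f has_derivative (\<lambda>h. box_grad f x \<bullet> h)) (at x within cbox 0 1)"
proof -
  define D where "D = frechet_derivative f (at x within cbox 0 1)"
  have D: "(f has_derivative D) (at x within cbox 0 1)"
    using assms unfolding differentiable_on_def D_def by (simp add: frechet_derivative_works)
  then have "linear D"
    by (rule has_derivative_linear)
  have "D h = box_grad f x \<bullet> h" for h
  proof -
    have "D h = D (\<Sum>j\<in>UNIV. h $ j *\<^sub>R axis j 1)"
      using basis_expansion[of h] by (simp add: scalar_mult_eq_scaleR)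
    also have "\<dots> = (\<Sum>j\<in>UNIV. h $ j * D (axis j 1))"
      using \<open>linear D\<close> by (simp add: linear_sum linear_cmul)
    finally show ?thesis
      by (simp add: box_grad_def D_def inner_vec_def mult.commute)
  qed
  then show ?thesis
    using D by (metis (no_types, lifting) ext)
qed

text \<open>The mean value theorem on the segment from \<open>x\<close> to \<open>x + h\<close>: the gradient there differs from the one at \<open>x\<close>
by at most \<open>L |h|\<close>.\<close>

lemma first_order_expansion:
  fixes f :: "real ^ 'd \<Rightarrow> real"
  assumes diff: "f differentiable_on cbox 0 1" and lip: "L-lipschitz_on (cbox 0 1) (box_grad f)"
    and x: "x \<in> cbox 0 1" and xh: "x + h \<in> cbox 0 1"
  shows "\<bar>f (x + h) - f x - box_grad f x \<bullet> h\<bar> \<le> L * (norm h)\<^sup>2"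
proof -
  define g where "g = (\<lambda>s::real. x + s *\<^sub>R h)"
  have g_box: "g s \<in> cbox 0 1" if "s \<in> {0..1}" for s
  proof -
    have "g s = (1 - s) *\<^sub>R x + s *\<^sub>R (x + h)"
      by (simp add: g_def algebra_simps)
    moreover have "(1 - s) *\<^sub>R x + s *\<^sub>R (x + h) \<in> cbox 0 1"
      using that x xh by (intro convexD convex_box) auto
    ultimately show ?thesis by simp
  qed
  have der: "((\<lambda>s. f (g s)) has_derivative (\<lambda>r. box_grad f (g s) \<bullet> (r *\<^sub>R h))) (at s within {0..1})"
    if "s \<in> {0..1}" for s
  proof (rule has_derivative_in_compose2[where t="cbox 0 1" and g=f and g'="\<lambda>y h. box_grad f y \<bullet> h"])
    show "(g has_derivative (\<lambda>r. r *\<^sub>R h)) (at s within {0..1})"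
      unfolding g_def by (auto intro!: derivative_eq_intros)
  qed (use g_box that diff in \<open>auto intro!: box_grad_has_derivative\<close>)
  have "\<exists>s\<in>{0<..<1}. f (g 1) - f (g 0) = box_grad f (g s) \<bullet> ((1 - 0) *\<^sub>R h)"
    by (rule mvt_simple[where f="\<lambda>s. f (g s)" and f'="\<lambda>s r. box_grad f (g s) \<bullet> (r *\<^sub>R h)"])
      (use der in auto)
  then obtain s where s: "0 < s" "s < 1" and eq: "f (x + h) - f x = box_grad f (g s) \<bullet> h"
    by (auto simp: g_def)
  have "f (x + h) - f x - box_grad f x \<bullet> h = (box_grad f (g s) - box_grad f x) \<bullet> h"
    using eq by (simp add: inner_diff_left)
  also have "\<bar>\<dots>\<bar> \<le> norm (box_grad f (g s) - box_grad f x) * norm h"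
    by (rule Cauchy_Schwarz_ineq2)
  also have "\<dots> \<le> (L * norm (g s - x)) * norm h"
    using lipschitz_onD[OF lip, of "g s" x] g_box[of s] x s
    by (intro mult_right_mono) (auto simp: dist_norm)
  also have "\<dots> \<le> (L * norm h) * norm h"
    using s lipschitz_on_nonneg[OF lip]
    by (intro mult_right_mono mult_left_mono) (auto simp: g_def mult_left_le_one_le)
  finally show ?thesis
    by (simp add: power2_eq_square mult.assoc)
qed

section \<open>Moments of the uniform distribution on a sphere\<close>

lemma integral_uniform_sphere_transform:
  fixes g :: "real ^ 'd \<Rightarrow> real"
  assumes unif: "uniform_on_unit_sphere L \<mu>"
    and U: "orthogonal_transformation U" "U ` L = L" and g: "g \<in> borel_measurable borel"
  shows "(\<integral>v. g (U v) \<partial>\<mu>) = (\<integral>v. g v \<partial>\<mu>)"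
proof -
  have "sets \<mu> = sets borel" and inv: "distr \<mu> borel U = \<mu>"
    using unif U by (auto simp: uniform_on_unit_sphere_def)
  moreover have "U \<in> borel_measurable borel"
    using U(1) by (intro borel_measurable_continuous_onI linear_continuous_on)
      (simp add: orthogonal_transformation_linear linear_linear)
  ultimately have "U \<in> measurable \<mu> borel"
    using measurable_cong_sets by blast
  then have "(\<integral>v. g v \<partial>distr \<mu> borel U) = (\<integral>v. g (U v) \<partial>\<mu>)"
    using g by (intro integral_distr)
  then show ?thesis
    by (simp add: inv)
qed

text \<open>The antipodal map is orthogonal and preserves \<open>L\<close>.\<close>

lemma uniform_sphere_mean_zero:
  fixes a :: "real ^ 'd"
  assumes unif: "uniform_on_unit_sphere L \<mu>" and "subspace L"
  shows "(\<integral>v. a \<bullet> v \<partial>\<mu>) = 0"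
proof -
  have "uminus ` L = L"
  proof -
    have "uminus ` L \<subseteq> L" using subspace_neg[OF \<open>subspace L\<close>] by auto
    moreover have "x \<in> uminus ` L" if "x \<in> L" for x
      using subspace_neg[OF \<open>subspace L\<close> that] by (intro image_eqI[of _ _ "- x"]) auto
    ultimately show ?thesis by auto
  qed
  moreover have "orthogonal_transformation (uminus :: real ^ 'd \<Rightarrow> _)"
    by (auto simp: orthogonal_transformation_def linear_iff)
  ultimately have "(\<integral>v. a \<bullet> (- v) \<partial>\<mu>) = (\<integral>v. a \<bullet> v \<partial>\<mu>)"
    by (intro integral_uniform_sphere_transform[OF unif]) auto
  then show ?thesis by simp
qed

lemma uniform_sphere_integrable_product:
  fixes a b :: "real ^ 'd"
  assumes "uniform_on_unit_sphere L \<mu>"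
  shows "integrable \<mu> (\<lambda>v. (a \<bullet> v) * (b \<bullet> v))"
proof -
  interpret prob_space \<mu> using assms by (simp add: uniform_on_unit_sphere_def)
  have sets: "sets \<mu> = sets borel" and ae: "AE v in \<mu>. v \<in> sphere 0 1 \<inter> L"
    using assms by (auto simp: uniform_on_unit_sphere_def)
  show ?thesis
  proof (rule integrable_const_bound[where B="norm a * norm b"])
    show "AE v in \<mu>. norm ((a \<bullet> v) * (b \<bullet> v)) \<le> norm a * norm b"
      using ae
    proof eventually_elim
      case (elim v)
      have "\<bar>a \<bullet> v\<bar> \<le> norm a" "\<bar>b \<bullet> v\<bar> \<le> norm b"
        using Cauchy_Schwarz_ineq2[of a v] Cauchy_Schwarz_ineq2[of b v] elim by auto
      then show ?case by (simp add: abs_mult mult_mono)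
    qed
    show "(\<lambda>v. (a \<bullet> v) * (b \<bullet> v)) \<in> borel_measurable \<mu>"
      using sets by (simp cong: measurable_cong_sets)
  qed
qed

text \<open>The reflection in the hyperplane orthogonal to \<open>a - b\<close> exchanges the unit vectors \<open>a\<close> and \<open>b\<close>, and it
preserves \<open>L\<close> because it moves every point by a multiple of \<open>a - b\<close>.\<close>

lemma uniform_sphere_second_moment_unit:
  fixes a b :: "real ^ 'd"
  assumes unif: "uniform_on_unit_sphere L \<mu>" and L: "subspace L"
    and "a \<in> L" "b \<in> L" "norm a = 1" "norm b = 1"
  shows "(\<integral>v. (a \<bullet> v)\<^sup>2 \<partial>\<mu>) = (\<integral>v. (b \<bullet> v)\<^sup>2 \<partial>\<mu>)"
proof (cases "a = b")
  case False
  define d where "d = a - b"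
  define U where "U = (\<lambda>x. x - (2 * (x \<bullet> d) / (d \<bullet> d)) *\<^sub>R d)"
  have d: "d \<bullet> d \<noteq> 0" "d \<in> L"
    using False assms by (auto simp: d_def subspace_diff)
  have lin: "linear U"
    by (auto simp: linear_iff U_def algebra_simps inner_add_left inner_diff_left add_divide_distrib)
  have inner: "U x \<bullet> U y = x \<bullet> y" for x y
    using d by (simp add: U_def inner_diff_left inner_diff_right inner_commute field_simps)
  have "orthogonal_transformation U"
    using lin inner by (simp add: orthogonal_transformation_def)
  moreover have UU: "U (U x) = x" for x
    using d by (simp add: U_def inner_diff_left algebra_simps field_simps)
  have "U ` L \<subseteq> L"
    using L d by (auto simp: U_def subspace_diff subspace_scale)
  then have "U ` L = L"
    using UU by (metis image_eqI subsetI subset_antisym image_subset_iff)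
  ultimately have "(\<integral>v. (a \<bullet> U v)\<^sup>2 \<partial>\<mu>) = (\<integral>v. (a \<bullet> v)\<^sup>2 \<partial>\<mu>)"
    by (intro integral_uniform_sphere_transform[OF unif]) auto
  moreover have "a \<bullet> U v = b \<bullet> v" for v
  proof -
    have "a \<bullet> a = 1" "b \<bullet> b = 1" using assms by (simp_all add: norm_eq_1)
    then have "2 * (a \<bullet> d) = d \<bullet> d"
      by (simp add: d_def inner_diff_left inner_diff_right inner_commute)
    then have "U a = b" using d by (simp add: U_def d_def)
    then show ?thesis using inner[of a "U v"] UU by simp
  qed
  ultimately show ?thesis by simp
qed simp

text \<open>The squares of the coordinates with respect to an orthonormal basis of \<open>L\<close> have equal means, and they
add up to 1.\<close>

lemma uniform_sphere_second_moment:
  fixes a :: "real ^ 'd"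
  assumes unif: "uniform_on_unit_sphere L \<mu>" and L: "subspace L" and "a \<in> L"
  shows "real (dim L) * (\<integral>v. (a \<bullet> v)\<^sup>2 \<partial>\<mu>) = (norm a)\<^sup>2"
proof (cases "a = 0")
  case False
  interpret prob_space \<mu> using assms by (simp add: uniform_on_unit_sphere_def)
  have ae: "AE v in \<mu>. v \<in> sphere 0 1 \<inter> L"
    using unif by (auto simp: uniform_on_unit_sphere_def)
  have sets: "sets \<mu> = sets borel" 
    using assms by (auto simp: uniform_on_unit_sphere_def)
  \<comment> \<open>the moment is homogeneous of degree 2 in \<open>a\<close>\<close>
  define e where "e = a /\<^sub>R norm a"
  have e: "e \<in> L" "norm e = 1" "a = norm a *\<^sub>R e"
    using False L \<open>a \<in> L\<close> by (auto simp: e_def subspace_scale)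
  obtain B where B: "B \<subseteq> L" "pairwise orthogonal B" "\<And>x. x \<in> B \<Longrightarrow> norm x = 1"
    "independent B" "card B = dim L" "span B = L"
    using orthonormal_basis_subspace[OF L] by metis
  have "finite B" using \<open>independent B\<close> independent_imp_finite by blast
  have parseval: "(\<Sum>b\<in>B. (b \<bullet> v)\<^sup>2) = (norm v)\<^sup>2" if "v \<in> L" for v
  proof -
    have "v = (\<Sum>b\<in>B. (b \<bullet> v) *\<^sub>R b)"
      using orthonormal_basis_expand[OF B(2,3), of v] that B(6) \<open>finite B\<close>
      by (simp add: inner_commute)
    then have "v \<bullet> v = (\<Sum>b\<in>B. (b \<bullet> v) *\<^sub>R b) \<bullet> v"
      by (rule arg_cong)
    also have "\<dots> = (\<Sum>b\<in>B. (b \<bullet> v)\<^sup>2)"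
      by (simp add: inner_sum_left power2_eq_square)
    finally show ?thesis
      by (simp add: power2_norm_eq_inner)
  qed
  have int: "integrable \<mu> (\<lambda>v. (b \<bullet> v)\<^sup>2)" for b
    using uniform_sphere_integrable_product[OF unif, of b b] by (simp add: power2_eq_square)
  have "(1::real) = (\<integral>v. 1 \<partial>\<mu>)" by (simp add: prob_space)
  also have "\<dots> = (\<integral>v. (\<Sum>b\<in>B. (b \<bullet> v)\<^sup>2) \<partial>\<mu>)"
    using ae sets by (intro integral_cong_AE) (auto simp: parseval cong: measurable_cong_sets)
  also have "\<dots> = (\<Sum>b\<in>B. \<integral>v. (b \<bullet> v)\<^sup>2 \<partial>\<mu>)"
    using int by (intro Bochner_Integration.integral_sum) auto
  also have "\<dots> = (\<Sum>b\<in>B. \<integral>v. (e \<bullet> v)\<^sup>2 \<partial>\<mu>)"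
    using B e by (intro sum.cong uniform_sphere_second_moment_unit[OF unif L]) auto
  finally have one: "real (dim L) * (\<integral>v. (e \<bullet> v)\<^sup>2 \<partial>\<mu>) = 1"
    using B by simp
  have "(\<integral>v. (a \<bullet> v)\<^sup>2 \<partial>\<mu>) = (norm a)\<^sup>2 * (\<integral>v. (e \<bullet> v)\<^sup>2 \<partial>\<mu>)"
    by (subst e(3)) (simp add: power_mult_distrib)
  then have "real (dim L) * (\<integral>v. (a \<bullet> v)\<^sup>2 \<partial>\<mu>)
      = (norm a)\<^sup>2 * (real (dim L) * (\<integral>v. (e \<bullet> v)\<^sup>2 \<partial>\<mu>))"
    by simp
  then show ?thesis by (simp only: one mult_1_right)
qed simp

text \<open>Polarization of the second moment; a component of \<open>a\<close> orthogonal to \<open>L\<close> is invisible to \<open>v\<close>.\<close>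

lemma uniform_sphere_covariance:
  fixes a b :: "real ^ 'd"
  assumes unif: "uniform_on_unit_sphere L \<mu>" and L: "subspace L" and b: "b \<in> L"
  shows "real (dim L) * (\<integral>v. (a \<bullet> v) * (b \<bullet> v) \<partial>\<mu>) = a \<bullet> b"
proof -
  have ae: "AE v in \<mu>. v \<in> sphere 0 1 \<inter> L" and sets: "sets \<mu> = sets borel" 
    using unif by (auto simp: uniform_on_unit_sphere_def)
  obtain p q where p: "p \<in> L" and q: "\<And>w. w \<in> L \<Longrightarrow> orthogonal q w" and a: "a = p + q"
    using orthogonal_subspace_decomp_exists[of L a] L by (metis span_eq_iff)
  have int: "integrable \<mu> (\<lambda>v. (c \<bullet> v)\<^sup>2)" for c
    using uniform_sphere_integrable_product[OF unif, of c c] by (simp add: power2_eq_square)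
  have "(\<integral>v. (a \<bullet> v) * (b \<bullet> v) \<partial>\<mu>) = (\<integral>v. (((p + b) \<bullet> v)\<^sup>2 - ((p - b) \<bullet> v)\<^sup>2) / 4 \<partial>\<mu>)"
  proof (rule integral_cong_AE)
    show "AE v in \<mu>. (a \<bullet> v) * (b \<bullet> v) = (((p + b) \<bullet> v)\<^sup>2 - ((p - b) \<bullet> v)\<^sup>2) / 4"
      using ae
    proof eventually_elim
      case (elim v)
      then have "a \<bullet> v = p \<bullet> v" using q[of v] by (simp add: a inner_add_left orthogonal_def)
      then show ?case
        by (simp add: inner_add_left inner_diff_left power2_eq_square algebra_simps)
    qed
  qed (use sets in \<open>auto cong: measurable_cong_sets\<close>)
  also have "\<dots> = ((\<integral>v. ((p + b) \<bullet> v)\<^sup>2 \<partial>\<mu>) - (\<integral>v. ((p - b) \<bullet> v)\<^sup>2 \<partial>\<mu>)) / 4"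
    by (simp only: integral_divide_zero Bochner_Integration.integral_diff[OF int int])
  finally have "real (dim L) * (\<integral>v. (a \<bullet> v) * (b \<bullet> v) \<partial>\<mu>)
      = (real (dim L) * (\<integral>v. ((p + b) \<bullet> v)\<^sup>2 \<partial>\<mu>) - real (dim L) * (\<integral>v. ((p - b) \<bullet> v)\<^sup>2 \<partial>\<mu>)) / 4"
    by (simp only: right_diff_distrib times_divide_eq_right)
  also have "\<dots> = ((norm (p + b))\<^sup>2 - (norm (p - b))\<^sup>2) / 4"
    using p b L by (simp add: uniform_sphere_second_moment[OF unif L] subspace_add subspace_diff)
  also have "\<dots> = p \<bullet> b"
    by (simp add: power2_norm_eq_inner inner_add_left inner_add_right inner_diff_left
        inner_diff_right inner_commute)
  also have "\<dots> = a \<bullet> b"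
    using q[OF b] by (simp add: a inner_add_left orthogonal_def)
  finally show ?thesis .
qed

section \<open>Spectral gap of the weight matrix\<close>

lemma symmetric_matrix_inner:
  fixes A :: "real ^ 'n ^ 'n"
  assumes "transpose A = A"
  shows "(A *v x) \<bullet> y = x \<bullet> (A *v y)"
  using assms by (metis dot_lmul_matrix vector_transpose_matrix)

text \<open>A form of the spectral theorem.  Let the unit vector \<open>w\<close> maximize \<open>|A w|\<close> on \<open>S\<close>, with maximum \<open>l\<close>.
Then \<open>A\<^sup>2 w = l\<^sup>2 w\<close>, for \<open>|A\<^sup>2 w| \<le> l\<^sup>2\<close> and \<open>\<langle>w, A\<^sup>2 w\<rangle> = l\<^sup>2\<close> are the equality case of the Cauchy-Schwarz
inequality.  From \<open>(A - l)(A + l) w = 0\<close> either \<open>w\<close> is an eigenvector for \<open>-l\<close> or \<open>(A + l) w\<close> is one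
for \<open>l\<close>.\<close>

lemma symmetric_invariant_subspace_norm_eigenvalue:
  fixes A :: "real ^ 'n ^ 'n"
  assumes sym: "transpose A = A" and S: "subspace S" "S \<noteq> {0}"
    and inv: "\<And>w. w \<in> S \<Longrightarrow> A *v w \<in> S"
  obtains \<mu> w where "w \<in> S" "w \<noteq> 0" "A *v w = \<mu> *\<^sub>R w"
    "\<And>z. z \<in> S \<Longrightarrow> norm (A *v z) \<le> \<bar>\<mu>\<bar> * norm z"
proof -
  have "0 \<in> S" using S(1) by (rule subspace_0)
  then obtain s where s: "s \<in> S" "s \<noteq> 0" using S(2) by auto
  have "compact (S \<inter> sphere 0 1)"
    using S(1) by (intro closed_Int_compact closed_subspace compact_sphere)
  moreover have "s /\<^sub>R norm s \<in> S \<inter> sphere 0 1"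
    using s S(1) by (auto simp: subspace_scale)
  then have "S \<inter> sphere 0 1 \<noteq> {}" by blast
  moreover have "continuous_on (S \<inter> sphere 0 1) (\<lambda>w. norm (A *v w))"
    by (intro continuous_intros linear_continuous_on) (simp add: linear_linear)
  ultimately obtain w where w': "w \<in> S \<inter> sphere 0 1"
    and max: "\<forall>z\<in>S \<inter> sphere 0 1. norm (A *v z) \<le> norm (A *v w)"
    using continuous_attains_sup by metis
  from w' have w: "w \<in> S" "norm w = 1" by auto
  define l where "l = norm (A *v w)"
  have bound: "norm (A *v z) \<le> l * norm z" if "z \<in> S" for z
  proof (cases "z = 0")
    case False
    have "norm (A *v (z /\<^sub>R norm z)) \<le> l"
      using False that S(1) bspec[OF max, of "z /\<^sub>R norm z"]
      by (simp add: l_def subspace_scale)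
    then show ?thesis
      using False by (simp add: matrix_vector_mult_scaleR field_simps)
  qed simp
  define u where "u = A *v (A *v w)"
  have wu: "w \<bullet> u = l\<^sup>2" and ww: "w \<bullet> w = 1"
    using symmetric_matrix_inner[OF sym, of w "A *v w"] w(2)
    by (simp_all add: u_def l_def power2_norm_eq_inner norm_eq_1)
  have "norm u \<le> l * l"
    using bound[of "A *v w"] inv w by (simp add: u_def l_def)
  then have "(norm u)\<^sup>2 \<le> (l * l)\<^sup>2"
    by (intro power_mono) auto
  moreover have "(norm (u - l\<^sup>2 *\<^sub>R w))\<^sup>2 = (norm u)\<^sup>2 - 2 * l\<^sup>2 * (w \<bullet> u) + l\<^sup>2 * l\<^sup>2 * (w \<bullet> w)"
    unfolding power2_norm_eq_inner
    by (simp add: inner_diff_left inner_diff_right inner_commute algebra_simps)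
  ultimately have "(norm (u - l\<^sup>2 *\<^sub>R w))\<^sup>2 \<le> 0"
    unfolding wu ww by (simp add: power2_eq_square algebra_simps)
  then have u: "A *v (A *v w) = l\<^sup>2 *\<^sub>R w"
    by (simp add: u_def)
  have "0 \<le> l" by (simp add: l_def)
  show thesis
  proof (cases "A *v w + l *\<^sub>R w = 0")
    case True
    then have "A *v w = (- l) *\<^sub>R w"
      by (simp add: add_eq_0_iff)
    then show thesis
      using w bound \<open>0 \<le> l\<close> by (intro that[of w "- l"]) auto
  next
    case False
    have "A *v (A *v w + l *\<^sub>R w) = l *\<^sub>R (A *v w + l *\<^sub>R w)"
      using u by (simp add: matrix_vector_right_distrib matrix_vector_mult_scaleR
          algebra_simps power2_eq_square)
    then show thesis
      using False w inv S(1) bound \<open>0 \<le> l\<close>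
      by (intro that[of "A *v w + l *\<^sub>R w" l]) (auto intro: subspace_add subspace_scale)
  qed
qed

lemma symmetric_eigenvectors_orthogonal:
  fixes A :: "real ^ 'n ^ 'n"
  assumes "transpose A = A" "A *v x = \<mu> *\<^sub>R x" "A *v y = \<nu> *\<^sub>R y" "\<mu> \<noteq> \<nu>"
  shows "x \<bullet> y = 0"
  using symmetric_matrix_inner[OF assms(1), of x y] assms(2-4) by simp

text \<open>Without finiteness the sum in the definition of \<open>eigenvalue_mset\<close> would have the default value \<open>{#}\<close>.\<close>

lemma finite_symmetric_eigenvalues:
  fixes A :: "real ^ 'n ^ 'n"
  assumes "transpose A = A"
  shows "finite {\<mu>. eigenspace A \<mu> \<noteq> {0}}"
proof -
  let ?E = "{\<mu>. eigenspace A \<mu> \<noteq> {0}}"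
  have "\<exists>w. w \<noteq> 0 \<and> A *v w = \<mu> *\<^sub>R w" if "\<mu> \<in> ?E" for \<mu>
  proof -
    have "0 \<in> eigenspace A \<mu>" by (simp add: eigenspace_def)
    then show ?thesis using that by (auto simp: eigenspace_def)
  qed
  then obtain w where w: "\<And>\<mu>. \<mu> \<in> ?E \<Longrightarrow> w \<mu> \<noteq> 0 \<and> A *v w \<mu> = \<mu> *\<^sub>R w \<mu>"
    by metis
  have orth: "w \<mu> \<bullet> w \<nu> = 0" if "\<mu> \<in> ?E" "\<nu> \<in> ?E" "\<mu> \<noteq> \<nu>" for \<mu> \<nu>
    using symmetric_eigenvectors_orthogonal[OF assms] w that by blast
  have "inj_on w ?E"
  proof (rule inj_onI)
    fix \<mu> \<nu> assume "\<mu> \<in> ?E" "\<nu> \<in> ?E" "w \<mu> = w \<nu>"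
    then show "\<mu> = \<nu>" using orth[of \<mu> \<nu>] w[of \<nu>] by (metis inner_eq_zero_iff)
  qed
  moreover have "pairwise orthogonal (w ` ?E)"
    using orth unfolding pairwise_def orthogonal_def by fast
  then have "independent (w ` ?E)"
    using w by (intro pairwise_orthogonal_independent) force+
  then have "finite (w ` ?E)"
    by (rule independent_imp_finite)
  ultimately show ?thesis
    using finite_imageD by blast
qed

lemma count_eigenvalue_mset:
  fixes A :: "real ^ 'n ^ 'n"
  assumes "transpose A = A"
  shows "count (eigenvalue_mset A) \<mu> = dim (eigenspace A \<mu>)"
proof (cases "eigenspace A \<mu> = {0}")
  case True
  then show ?thesis
    using finite_symmetric_eigenvalues[OF assms]
    by (simp add: eigenvalue_mset_def count_sum sum.neutral)
next
  case False
  have "count (eigenvalue_mset A) \<mu>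
      = (\<Sum>\<nu> | eigenspace A \<nu> \<noteq> {0}. if \<mu> = \<nu> then dim (eigenspace A \<nu>) else 0)"
    by (auto simp: eigenvalue_mset_def count_sum intro!: sum.cong)
  then show ?thesis
    using False finite_symmetric_eigenvalues[OF assms] by (simp add: sum.delta')
qed

lemma second_largest_ge:
  fixes X :: "'a :: linorder multiset"
  assumes sub: "{#a, b#} \<subseteq># X"
  defines "ls \<equiv> rev (sorted_list_of_multiset X)"
  shows "2 \<le> length ls" "min a b \<le> ls ! 1"
proof -
  have mset: "mset ls = X" by (simp add: ls_def)
  have "size {#a, b#} \<le> size X" using sub by (rule size_mset_mono)
  moreover have "size X = length ls" using mset by (metis size_mset)
  ultimately show len: "2 \<le> length ls" by simp
  obtain y z xs where ls: "ls = y # z # xs"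
    using len by (cases ls; cases "tl ls") auto
  have "sorted (rev ls)" by (simp add: ls_def)
  then have smaller: "x \<le> z" if "x \<in> set xs" for x
    using that by (auto simp: ls sorted_append)
  have "min a b \<le> z"
  proof (rule ccontr)
    assume "\<not> min a b \<le> z"
    then have "filter (\<lambda>x. min a b \<le> x) (z # xs) = []"
      using smaller unfolding filter_empty_conv by force
    then have "length (filter (\<lambda>x. min a b \<le> x) ls) \<le> 1"
      by (auto simp: ls)
    moreover have "length (filter (\<lambda>x. min a b \<le> x) ls) = size (filter_mset (\<lambda>x. min a b \<le> x) X)"
      by (metis mset mset_filter size_mset)
    moreover have "filter_mset (\<lambda>x. min a b \<le> x) {#a, b#} \<subseteq># filter_mset (\<lambda>x. min a b \<le> x) X"
      using sub by (rule multiset_filter_mono)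
    then have "size (filter_mset (\<lambda>x. min a b \<le> x) {#a, b#}) \<le> size (filter_mset (\<lambda>x. min a b \<le> x) X)"
      by (rule size_mset_mono)
    ultimately show False by simp
  qed
  then show "min a b \<le> ls ! 1" by (simp add: ls)
qed

text \<open>The norm of \<open>A\<close> on the orthogonal complement of the constant vectors is attained at an eigenvector \<open>u\<close>
with eigenvalue \<open>\<plusminus>\<close> that norm.  Since \<open>u\<close> is orthogonal to the constant eigenvector for the eigenvalue 1,
both 1 and the eigenvalue of \<open>u\<close> are counted in the multiset of eigenvalues, even if they coincide.\<close>

lemma network_contraction:
  fixes A :: "real ^ 'n ^ 'n"
  assumes net: "network E A" and lt1: "second_eigenvalue A < 1" and w: "(\<Sum>i\<in>UNIV. w $ i) = 0"
  shows "norm (A *v w) \<le> second_eigenvalue A * norm w"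
proof (cases "w = 0")
  case False
  have sym: "transpose A = A" and rows: "\<And>i. (\<Sum>j\<in>UNIV. A $ i $ j) = 1"
    and cols: "\<And>j. (\<Sum>i\<in>UNIV. A $ i $ j) = 1"
    using net by (auto simp: network_def)
  define S where "S = {w :: real ^ 'n. (\<Sum>i\<in>UNIV. w $ i) = 0}"
  have "subspace S"
    by (auto simp: subspace_def S_def sum.distrib sum_distrib_left[symmetric])
  moreover have "S \<noteq> {0}" using False w by (auto simp: S_def)
  moreover have "A *v z \<in> S" if "z \<in> S" for z
  proof -
    have "(\<Sum>i\<in>UNIV. (A *v z) $ i) = (\<Sum>j\<in>UNIV. (\<Sum>i\<in>UNIV. A $ i $ j) * z $ j)"
      by (simp add: matrix_vector_mult_def sum_distrib_right) (rule sum.swap)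
    then show ?thesis using that by (simp add: cols S_def)
  qed
  ultimately obtain \<mu> u where u: "u \<in> S" "u \<noteq> 0" "A *v u = \<mu> *\<^sub>R u"
    and bound: "\<And>z. z \<in> S \<Longrightarrow> norm (A *v z) \<le> \<bar>\<mu>\<bar> * norm z"
    using symmetric_invariant_subspace_norm_eigenvalue[OF sym] by metis
  have one: "A *v 1 = 1 *\<^sub>R 1"
    by (simp add: vec_eq_iff matrix_vector_mult_def rows)
  have orth: "1 \<bullet> u = 0"
    using u(1) by (simp add: S_def inner_vec_def)
  \<comment> \<open>if \<open>\<mu> = 1\<close>, then this eigenvalue has multiplicity at least 2\<close>
  have "{#1, \<mu>#} \<subseteq># eigenvalue_mset A"
  proof (cases "\<mu> = 1")
    case True
    have "(1 :: real ^ 'n) \<noteq> u" using orth u by (metis inner_eq_zero_iff)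
    have "independent {1, u}"
      using orth u(2) \<open>1 \<noteq> u\<close>
      by (intro pairwise_orthogonal_independent) (auto simp: pairwise_def orthogonal_def inner_commute)
    moreover have "{1, u} \<subseteq> eigenspace A 1" using one u True by (auto simp: eigenspace_def)
    ultimately have "card {1, u} \<le> dim (eigenspace A 1)"
      by (metis independent_card_le_dim)
    then have "2 \<le> dim (eigenspace A 1)" using \<open>1 \<noteq> u\<close> by simp
    then show ?thesis using True
      by (auto simp: subseteq_mset_def count_eigenvalue_mset[OF sym])
  next
    case False
    have pos: "0 < dim (eigenspace A \<nu>)" if "z \<noteq> 0" "A *v z = \<nu> *\<^sub>R z" for \<nu> z
    proof -
      have "independent {z}" using that by simp
      then show ?thesis using that independent_card_le_dim[of "{z}" "eigenspace A \<nu>"]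
        by (auto simp: eigenspace_def)
    qed
    have "0 < dim (eigenspace A 1)" "0 < dim (eigenspace A \<mu>)"
      using pos[OF _ one] pos[OF u(2,3)] by (simp_all add: zero_neq_one[symmetric] vec_eq_iff)
    then show ?thesis using False
      by (auto simp: subseteq_mset_def count_eigenvalue_mset[OF sym])
  qed
  then have "image_mset abs {#1, \<mu>#} \<subseteq># image_mset abs (eigenvalue_mset A)"
    by (rule image_mset_subseteq_mono)
  then have "{#\<bar>1\<bar>, \<bar>\<mu>\<bar>#} \<subseteq># image_mset abs (eigenvalue_mset A)"
    by (simp only: image_mset_add_mset image_mset_empty)
  from second_largest_ge[OF this]
  have "min 1 \<bar>\<mu>\<bar> \<le> second_eigenvalue A"
    by (simp add: second_eigenvalue_def Let_def)
  then have "\<bar>\<mu>\<bar> \<le> second_eigenvalue A" using lt1 by auto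
  moreover have "norm (A *v w) \<le> \<bar>\<mu>\<bar> * norm w"
    using bound w by (simp add: S_def)
  ultimately show ?thesis
    by (meson mult_right_mono norm_ge_zero order_trans)
qed simp

section \<open>Averaging over the network\<close>

text \<open>A family of vectors indexed by the agents is an element of \<open>'a ^ 'n\<close>, whose norm is the \<open>\<ell>\<^sup>2\<close> norm of the
family.\<close>

definition gossip :: "real ^ 'n ^ 'n \<Rightarrow> 'a::real_vector ^ 'n \<Rightarrow> 'a ^ 'n" where
  "gossip A Y = (\<chi> i. \<Sum>j\<in>UNIV. A $ i $ j *\<^sub>R Y $ j)"

definition disagreement :: "'a::real_vector ^ 'n \<Rightarrow> 'a ^ 'n" where
  "disagreement Y = (\<chi> i. Y $ i - (1 / real CARD('n)) *\<^sub>R (\<Sum>j\<in>UNIV. Y $ j))"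

lemma norm_sq_family:
  fixes Y :: "'a::real_normed_vector ^ 'n"
  shows "(norm Y)\<^sup>2 = (\<Sum>i\<in>UNIV. (norm (Y $ i))\<^sup>2)"
  by (simp add: norm_vec_def L2_set_def sum_nonneg)

lemma sum_disagreement: "(\<Sum>i\<in>UNIV. disagreement Y $ i) = 0"
  by (simp add: disagreement_def sum_subtractf sum_constant_scaleR del: sum_constant)

lemma norm_disagreement_le:
  fixes Y :: "'a::real_inner ^ 'n"
  shows "norm (disagreement Y) \<le> norm Y"
proof -
  define m where "m = (1 / real CARD('n)) *\<^sub>R (\<Sum>j\<in>UNIV. Y $ j)"
  have sum: "(\<Sum>j\<in>UNIV. Y $ j) = real CARD('n) *\<^sub>R m"
    by (simp add: m_def)
  have "(norm (disagreement Y))\<^sup>2 = (\<Sum>i\<in>UNIV. (norm (Y $ i))\<^sup>2 - 2 * (Y $ i \<bullet> m) + m \<bullet> m)"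
    unfolding norm_sq_family disagreement_def m_def[symmetric]
    by (intro sum.cong) (auto simp: power2_norm_eq_inner inner_diff_left inner_diff_right inner_commute)
  also have "\<dots> = (norm Y)\<^sup>2 - 2 * ((\<Sum>i\<in>UNIV. Y $ i) \<bullet> m) + real CARD('n) * (m \<bullet> m)"
    by (simp add: sum.distrib sum_subtractf inner_sum_left sum_distrib_left norm_sq_family)
  also have "\<dots> \<le> (norm Y)\<^sup>2"
    by (simp add: sum)
  finally show ?thesis
    by (rule power2_le_imp_le) simp
qed

lemma disagreement_add: "disagreement (Y + Z) = disagreement Y + disagreement Z"
  by (simp add: disagreement_def vec_eq_iff sum.distrib scaleR_add_right)

text \<open>The variance of the \<open>y j\<close> about their weighted mean is nonnegative.\<close>

lemma norm_sq_convex_combination_le: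
  fixes y :: "'n::finite \<Rightarrow> 'a::real_inner"
  assumes a: "\<And>j. 0 \<le> a j" "(\<Sum>j\<in>UNIV. a j) = 1"
  shows "(norm (\<Sum>j\<in>UNIV. a j *\<^sub>R y j))\<^sup>2 \<le> (\<Sum>j\<in>UNIV. a j * (norm (y j))\<^sup>2)"
proof -
  define m where "m = (\<Sum>j\<in>UNIV. a j *\<^sub>R y j)"
  have "0 \<le> (\<Sum>j\<in>UNIV. a j * (norm (y j - m))\<^sup>2)"
    using a by (intro sum_nonneg) auto
  also have "\<dots> = (\<Sum>j\<in>UNIV. a j * (norm (y j))\<^sup>2 - 2 * ((a j *\<^sub>R y j) \<bullet> m) + a j * (m \<bullet> m))"
    by (intro sum.cong)
      (auto simp: power2_norm_eq_inner inner_diff_left inner_diff_right inner_commute algebra_simps)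
  also have "\<dots> = (\<Sum>j\<in>UNIV. a j * (norm (y j))\<^sup>2) - 2 * (m \<bullet> m) + (\<Sum>j\<in>UNIV. a j) * (m \<bullet> m)"
    by (simp add: sum.distrib sum_subtractf sum_distrib_left[symmetric] sum_distrib_right[symmetric]
        inner_sum_left[symmetric] m_def[symmetric] del: inner_scaleR_left)
  finally show ?thesis
    using a by (simp add: m_def power2_norm_eq_inner)
qed

lemma second_eigenvalue_nonneg: "0 \<le> second_eigenvalue A"
proof -
  define ls where "ls = rev (sorted_list_of_multiset (image_mset abs (eigenvalue_mset A)))"
  have "set_mset (mset ls) \<subseteq> range abs" by (auto simp: ls_def)
  then have "0 \<le> x" if "x \<in> set ls" for x using that by auto
  then have "0 \<le> ls ! 1" if "2 \<le> length ls"
    using that by simp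
  then show ?thesis
    by (simp add: second_eigenvalue_def Let_def ls_def[symmetric])
qed

context
  fixes E and A :: "real ^ 'n::finite ^ 'n"
  assumes net: "network E A"
begin

lemma network_entries:
  "0 \<le> A $ i $ j" "(\<Sum>j\<in>UNIV. A $ i $ j) = 1" "(\<Sum>i\<in>UNIV. A $ i $ j) = 1"
  using net by (auto simp: network_def)

lemma network_neighbourhood_sum:
  fixes y :: "'n \<Rightarrow> 'a::real_vector"
  shows "(\<Sum>j\<in>neighbourhood E i. A $ i $ j *\<^sub>R y j) = (\<Sum>j\<in>UNIV. A $ i $ j *\<^sub>R y j)"
proof (rule sum.mono_neutral_left)
  have "A $ i $ j = 0" if "j \<notin> neighbourhood E i" for j
  proof -
    have "\<not> 0 < A $ i $ j"
      using that net by (auto simp: network_def neighbourhood_def)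
    then show ?thesis
      using network_entries(1)[of i j] by linarith
  qed
  then show "\<forall>j\<in>UNIV - neighbourhood E i. A $ i $ j *\<^sub>R y j = 0"
    by simp
qed auto

lemma sum_gossip: "(\<Sum>i\<in>UNIV. gossip A Y $ i) = (\<Sum>j\<in>UNIV. Y $ j)"
proof -
  have "(\<Sum>i\<in>UNIV. gossip A Y $ i) = (\<Sum>j\<in>UNIV. \<Sum>i\<in>UNIV. A $ i $ j *\<^sub>R Y $ j)"
    unfolding gossip_def by (simp, rule sum.swap)
  then show ?thesis
    by (simp add: scaleR_left.sum[symmetric] network_entries)
qed

lemma disagreement_gossip: "disagreement (gossip A Y) = gossip A (disagreement Y)"
proof -
  define m where "m = (1 / real CARD('n)) *\<^sub>R (\<Sum>j\<in>UNIV. Y $ j)"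
  have "gossip A (disagreement Y) $ i = gossip A Y $ i - m" for i
    by (simp add: gossip_def disagreement_def m_def[symmetric] scaleR_diff_right sum_subtractf
        scaleR_left.sum[symmetric] network_entries)
  moreover have "disagreement (gossip A Y) $ i = gossip A Y $ i - m" for i
    by (simp add: disagreement_def sum_gossip m_def)
  ultimately show ?thesis
    by (simp add: vec_eq_iff)
qed

text \<open>The rows of \<open>A\<close> give convex combinations; summing over the agents uses the column sums.\<close>

lemma gossip_nonexpansive:
  fixes Y :: "'a::real_inner ^ 'n"
  shows "(\<Sum>i\<in>UNIV. (norm (gossip A Y $ i))\<^sup>2) \<le> (\<Sum>i\<in>UNIV. (norm (Y $ i))\<^sup>2)"
proof -
  have "(\<Sum>i\<in>UNIV. (norm (gossip A Y $ i))\<^sup>2) \<le> (\<Sum>i\<in>UNIV. \<Sum>j\<in>UNIV. A $ i $ j * (norm (Y $ j))\<^sup>2)"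
    unfolding gossip_def
    by (intro sum_mono) (simp add: norm_sq_convex_combination_le network_entries)
  also have "\<dots> = (\<Sum>j\<in>UNIV. (\<Sum>i\<in>UNIV. A $ i $ j) * (norm (Y $ j))\<^sup>2)"
    by (subst sum.swap) (simp add: sum_distrib_right)
  finally show ?thesis by (simp add: network_entries)
qed

text \<open>Averaging acts on each coordinate of \<open>real ^ 'd\<close> separately.\<close>

lemma gossip_contraction:
  fixes W :: "(real ^ 'd) ^ 'n"
  assumes "second_eigenvalue A < 1" and "(\<Sum>i\<in>UNIV. W $ i) = 0"
  shows "norm (gossip A W) \<le> second_eigenvalue A * norm W"
proof -
  define col where "col b = (\<chi> i. W $ i $ b)" for b
  have split: "(norm Z)\<^sup>2 = (\<Sum>b\<in>UNIV. (norm (\<chi> i. Z $ i $ b))\<^sup>2)" for Z :: "(real ^ 'd) ^ 'n"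
    unfolding norm_sq_family by (simp, rule sum.swap)
  have "(norm (gossip A W))\<^sup>2 = (\<Sum>b\<in>UNIV. (norm (A *v col b))\<^sup>2)"
    unfolding split[of "gossip A W"]
    by (intro sum.cong arg_cong[where f="\<lambda>z. (norm z)\<^sup>2"])
      (auto simp: gossip_def matrix_vector_mult_def col_def vec_eq_iff)
  also have "\<dots> \<le> (\<Sum>b\<in>UNIV. (second_eigenvalue A * norm (col b))\<^sup>2)"
  proof (intro sum_mono power_mono network_contraction[OF net assms(1)])
    fix b
    have "(\<Sum>i\<in>UNIV. W $ i) $ b = 0" using assms(2) by simp
    then show "(\<Sum>i\<in>UNIV. col b $ i) = 0" by (simp add: col_def)
  qed auto
  also have "\<dots> = (second_eigenvalue A * norm W)\<^sup>2"
    unfolding power_mult_distrib split[of W] col_def by (simp add: sum_distrib_left)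
  finally show ?thesis
    by (rule power2_le_imp_le) (simp add: second_eigenvalue_nonneg)
qed

text \<open>The consensus recursion: averaging contracts the disagreement, and perturbing each agent by at most \<open>P\<close>
adds at most \<open>\<surd>N P\<close>.\<close>

lemma disagreement_after_gossip:
  fixes Y Z :: "(real ^ 'd) ^ 'n"
  assumes "second_eigenvalue A < 1" and "\<And>i. norm (Z $ i - gossip A Y $ i) \<le> P"
  shows "norm (disagreement Z)
    \<le> second_eigenvalue A * norm (disagreement Y) + sqrt (real CARD('n)) * P"
proof -
  have P: "0 \<le> P" using assms(2) norm_ge_zero order_trans by blast
  have "disagreement Z = gossip A (disagreement Y) + disagreement (Z - gossip A Y)"
    using disagreement_add[of "gossip A Y" "Z - gossip A Y"] by (simp add: disagreement_gossip)
  then have "norm (disagreement Z)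
      \<le> norm (gossip A (disagreement Y)) + norm (disagreement (Z - gossip A Y))"
    by (simp add: norm_triangle_ineq)
  moreover have "(norm (Z - gossip A Y))\<^sup>2 \<le> (sqrt (real CARD('n)) * P)\<^sup>2"
  proof -
    have "(norm (Z - gossip A Y))\<^sup>2 \<le> (\<Sum>i\<in>(UNIV :: 'n set). P\<^sup>2)"
      unfolding norm_sq_family[of "Z - gossip A Y"]
      using assms(2) by (intro sum_mono power_mono) (simp_all add: vector_minus_component)
    then show ?thesis by (simp add: power_mult_distrib)
  qed
  then have "norm (Z - gossip A Y) \<le> sqrt (real CARD('n)) * P"
    by (rule power2_le_imp_le) (use P in simp)
  ultimately show ?thesis
    using gossip_contraction[OF assms(1) sum_disagreement[of Y]] norm_disagreement_le[of "Z - gossip A Y"]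
    by linarith
qed

end

section \<open>Geometry of the shrunk set\<close>

lemma norm_convex_combination_le:
  fixes y :: "'n::finite \<Rightarrow> 'a::real_normed_vector"
  assumes "\<And>j. 0 \<le> a j" "(\<Sum>j\<in>UNIV. a j) = 1" "\<And>j. norm (y j) \<le> B"
  shows "norm (\<Sum>j\<in>UNIV. a j *\<^sub>R y j) \<le> B"
proof -
  have "norm (\<Sum>j\<in>UNIV. a j *\<^sub>R y j) \<le> (\<Sum>j\<in>UNIV. norm (a j *\<^sub>R y j))"
    by (rule norm_sum)
  also have "\<dots> \<le> (\<Sum>j\<in>UNIV. a j * B)"
    using assms(1,3) by (intro sum_mono) (simp add: mult_left_mono)
  also have "\<dots> = B" by (simp add: sum_distrib_right[symmetric] assms(2))
  finally show ?thesis .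
qed

context
  fixes \<K> :: "(real ^ 'd) set" and ctr r R k
  assumes feas: "feasible_set \<K> ctr r R k"
begin

lemma feasible_facts:
  "convex \<K>" "compact \<K>" "\<K> \<subseteq> cbox 0 1" "ctr \<in> \<K>" "0 < r"
  "k = dim (direction_space \<K> ctr)"
  using feas rel_interior_subset by (auto simp: feasible_set_def)

lemma feasible_norm_le: "x \<in> \<K> \<Longrightarrow> norm x \<le> R"
proof -
  assume "x \<in> \<K>"
  moreover have "bdd_above (norm ` \<K>)"
    using compact_imp_bounded[OF feasible_facts(2)] unfolding bounded_iff bdd_above_def by auto
  ultimately have "norm x \<le> (SUP x\<in>\<K>. norm x)" by (rule cSUP_upper)
  then show ?thesis using feas by (simp add: feasible_set_def)
qed

lemma feasible_radius_nonneg: "0 \<le> R"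
  using feasible_norm_le[OF feasible_facts(4)] norm_ge_zero order_trans by blast

lemma subspace_direction_space: "subspace (direction_space \<K> ctr)"
  unfolding direction_space_def
  by (intro affine_diffs_subspace_subtract affine_affine_hull hull_inc feasible_facts(4))

lemma diff_in_direction_space:
  assumes "x \<in> \<K>" "y \<in> \<K>"
  shows "x - y \<in> direction_space \<K> ctr"
proof -
  have "x - ctr \<in> direction_space \<K> ctr" "y - ctr \<in> direction_space \<K> ctr"
    using assms by (auto simp: direction_space_def intro: hull_inc)
  from subspace_diff[OF subspace_direction_space this] show ?thesis by simp
qed

context
  fixes \<delta>
  assumes \<delta>: "0 < \<delta>" "\<delta> < r"
begin

lemma shrunk_ratio: "0 \<le> \<delta> / r" "\<delta> / r \<le> 1"
  using \<delta> by auto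

lemma convex_shrunk_set: "convex (shrunk_set \<K> ctr r \<delta>)"
proof -
  have "shrunk_set \<K> ctr r \<delta> = (\<lambda>x. (\<delta> / r) *\<^sub>R ctr + x) ` ((\<lambda>x. (1 - \<delta> / r) *\<^sub>R x) ` \<K>)"
    by (auto simp: shrunk_set_def image_image add.commute)
  then show ?thesis
    using feasible_facts(1) by (simp add: convex_translation convex_scaling)
qed

lemma shrunk_set_subset: "shrunk_set \<K> ctr r \<delta> \<subseteq> \<K>"
  unfolding shrunk_set_def using feasible_facts(1,4) shrunk_ratio by (auto intro!: convexD)

lemma centre_in_shrunk_set: "ctr \<in> shrunk_set \<K> ctr r \<delta>"
  unfolding shrunk_set_def using feasible_facts(4)
  by (intro image_eqI[of _ _ ctr]) (simp_all add: scaleR_add_left[symmetric])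

lemma shrunk_set_near:
  assumes "u \<in> \<K>"
  obtains z where "z \<in> shrunk_set \<K> ctr r \<delta>" "norm (u - z) \<le> 2 * R * \<delta> / r"
proof
  let ?z = "(1 - \<delta> / r) *\<^sub>R u + (\<delta> / r) *\<^sub>R ctr"
  show "?z \<in> shrunk_set \<K> ctr r \<delta>" using assms unfolding shrunk_set_def by blast
  have "u - ?z = (\<delta> / r) *\<^sub>R (u - ctr)" by (simp add: algebra_simps)
  then have "norm (u - ?z) = (\<delta> / r) * norm (u - ctr)"
    using \<delta> by simp
  also have "\<dots> \<le> (\<delta> / r) * (R + R)"
    using feasible_norm_le[OF assms] feasible_norm_le[OF feasible_facts(4)] shrunk_ratio
    by (intro mult_left_mono) (auto intro: norm_triangle_le_diff)
  also have "\<dots> = 2 * R * \<delta> / r" by simp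
  finally show "norm (u - ?z) \<le> 2 * R * \<delta> / r" .
qed

text \<open>A point of the shrunk set is \<open>(1 - \<delta>/r) u + (\<delta>/r) ctr\<close> with \<open>u\<close> feasible; moving it by \<open>\<delta> v\<close> amounts to
replacing \<open>ctr\<close> by \<open>ctr + r v\<close>, which is feasible as well.\<close>

lemma shrunk_set_perturbation:
  assumes x: "x \<in> shrunk_set \<K> ctr r \<delta>" and v: "v \<in> sphere 0 1 \<inter> direction_space \<K> ctr"
  shows "x + \<delta> *\<^sub>R v \<in> \<K>"
proof -
  obtain u where u: "u \<in> \<K>" "x = (1 - \<delta> / r) *\<^sub>R u + (\<delta> / r) *\<^sub>R ctr"
    using x by (auto simp: shrunk_set_def)
  obtain y where y: "y \<in> affine hull \<K>" "v = y - ctr"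
    using v by (auto simp: direction_space_def)
  have "(1 - r) *\<^sub>R ctr + r *\<^sub>R y \<in> affine hull \<K>"
    using y feasible_facts(4) by (intro mem_affine affine_affine_hull) (auto intro: hull_inc)
  then have "ctr + r *\<^sub>R v \<in> affine hull \<K> \<inter> cball ctr r"
    using v feasible_facts(5) y(2) by (auto simp: dist_norm algebra_simps)
  then have "ctr + r *\<^sub>R v \<in> \<K>" using feas by (auto simp: feasible_set_def)
  then have "(1 - \<delta> / r) *\<^sub>R u + (\<delta> / r) *\<^sub>R (ctr + r *\<^sub>R v) \<in> \<K>"
    using u(1) feasible_facts(1) shrunk_ratio by (intro convexD) auto
  moreover have "(1 - \<delta> / r) *\<^sub>R u + (\<delta> / r) *\<^sub>R (ctr + r *\<^sub>R v) = x + \<delta> *\<^sub>R v"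
    using u(2) \<delta> by (simp add: scaleR_add_right)
  ultimately show ?thesis by simp
qed

end
end

section \<open>Analysis of a single sample path\<close>

text \<open>One sample path of the algorithm over \<open>n\<close> blocks.  The assumptions on directions and responses are
limited to these blocks, so that with \<open>n = 0\<close> the feasibility of the iterates becomes available for
arbitrary arguments, as is required in the proof of measurability.\<close>

locale gossip_run =
  fixes \<K> :: "(real ^ 'd) set" and ctr :: "real ^ 'd" and r R :: real and k :: nat
    and E :: "('n::finite \<times> 'n) set" and A :: "real ^ 'n ^ 'n" and K :: nat and \<eta> \<delta> \<epsilon> :: real
    and loo :: "real ^ 'd \<Rightarrow> real ^ 'd" and ip :: "'d infeasible_projection"
    and v :: "nat \<Rightarrow> 'n \<Rightarrow> real ^ 'd" and ob :: "nat \<Rightarrow> 'n \<Rightarrow> real" and B\<^sub>0 :: real and n :: nat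
  assumes feas: "feasible_set \<K> ctr r R k"
    and net: "network E A" and gap: "second_eigenvalue A < 1"
    and pos: "0 < K" "0 < \<eta>" "0 < \<delta>" "\<delta> < r" "0 \<le> B\<^sub>0"
    and tolerance: "\<epsilon> = (real K)\<^sup>2 * \<eta>\<^sup>2 / \<delta>\<^sup>2"
    and projection: "implements_infeasible_projection R (shrunk_set \<K> ctr r \<delta>) \<epsilon> loo ip"
    and directions: "\<And>t i. t \<in> {1..n * K} \<Longrightarrow> v t i \<in> sphere 0 1 \<inter> direction_space \<K> ctr"
    and responses: "\<And>t i. t \<in> {1..n * K} \<Longrightarrow> \<bar>ob t i\<bar> \<le> B\<^sub>0"
begin

abbreviation "states \<equiv> agent_states \<K> ctr r E A K \<eta> \<delta> \<epsilon> loo ip v ob"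
abbreviation "\<K>\<^sub>\<delta> \<equiv> shrunk_set \<K> ctr r \<delta>"

text \<open>\<open>X m\<close> and \<open>Y m\<close> collect the feasible and infeasible points of all agents after \<open>m\<close> blocks, \<open>G m i\<close> is
the gradient estimate that agent \<open>i\<close> accumulates over the next block, and \<open>target m i\<close> is the point that
it then projects.\<close>

definition "X m = (\<chi> i. feas_pt (states m i))"
definition "Y m = (\<chi> i. infeas_pt (states m i))"
definition "G m i = (\<Sum>t = m * K + 1..(m + 1) * K. (real k / \<delta> * ob t i) *\<^sub>R v t i)"
definition "target m i = gossip A (Y m) $ i + \<eta> *\<^sub>R G m i"
definition "prog m i = ip \<K>\<^sub>\<delta> (gossip A (X m) $ i) (target m i) \<epsilon>"

text \<open>The length \<open>h\<close> is the scale of all errors: the tolerance \<open>\<epsilon>\<close> is \<open>h\<^sup>2\<close>, in one block an agent moves by at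
most \<open>2 q h\<close> relative to the average it receives, and the disagreement never exceeds \<open>\<Delta> h\<close>, where \<open>\<Delta> h\<close>
is the fixed point of \<open>D \<mapsto> \<lambda>\<^sub>2 D + \<surd>N (2 q h)\<close>.\<close>

definition "h = real K * \<eta> / \<delta>"
definition "q = sqrt 3 + real k * B\<^sub>0"
definition "\<Delta> = 2 * sqrt (real CARD('n)) * q / (1 - second_eigenvalue A)"

lemma h_pos: "0 < h" and \<epsilon>_eq: "\<epsilon> = h\<^sup>2" and \<epsilon>_pos: "0 < \<epsilon>"
  using pos by (auto simp: h_def tolerance power_mult_distrib power_divide)

lemma \<Delta>_nonneg: "0 \<le> \<Delta>"
  using pos gap by (auto simp: q_def \<Delta>_def)

lemma states_Suc:
  "states (Suc m) i = \<lparr>feas_pt = fst (program_result loo (prog m i)),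
     infeas_pt = snd (program_result loo (prog m i)),
     loo_calls = loo_calls (states m i) + program_calls loo (prog m i),
     comms = comms (states m i) + 1\<rparr>"
proof -
  have "dim (direction_space \<K> ctr) = k" using feasible_facts(6)[OF feas] by simp
  then show ?thesis
    by (simp add: Let_def case_prod_beta fst_sum snd_sum prog_def target_def G_def X_def Y_def
        gossip_def network_neighbourhood_sum[OF net])
qed

lemma X_Suc: "X (Suc m) $ i = fst (program_result loo (prog m i))"
  and Y_Suc: "Y (Suc m) $ i = snd (program_result loo (prog m i))"
  by (simp_all add: X_def Y_def states_Suc del: agent_states.simps)

lemma X_0: "X 0 $ i = ctr" and Y_0: "Y 0 $ i = ctr"
  by (simp_all add: X_def Y_def)

lemma projection_step:
  assumes "gossip A (X m) $ i \<in> \<K>\<^sub>\<delta>"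
  shows "X (Suc m) $ i \<in> \<K>\<^sub>\<delta>" "norm (Y (Suc m) $ i) \<le> R"
    "(norm (X (Suc m) $ i - Y (Suc m) $ i))\<^sup>2 \<le> 3 * \<epsilon>"
    "z \<in> \<K>\<^sub>\<delta> \<Longrightarrow> (norm (Y (Suc m) $ i - z))\<^sup>2 \<le> (norm (target m i - z))\<^sup>2"
    "real (program_calls loo (prog m i)) \<le> real (nat \<lceil>27 * R\<^sup>2 / \<epsilon> - 2\<rceil>) *
       max 1 ((norm (gossip A (X m) $ i - target m i))\<^sup>2 *
         ((norm (gossip A (X m) $ i - target m i))\<^sup>2 - \<epsilon>) / (4 * \<epsilon>\<^sup>2) + 1)"
  using projection assms unfolding implements_infeasible_projection_def X_Suc Y_Suc prog_def
  by (auto simp: Let_def case_prod_beta)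

lemma X_feasible: "X m $ i \<in> \<K>\<^sub>\<delta>"
proof (induction m arbitrary: i)
  case 0
  then show ?case by (simp add: X_0 centre_in_shrunk_set[OF feas pos(3,4)])
next
  case (Suc m)
  have "gossip A (X m) $ i \<in> \<K>\<^sub>\<delta>"
    unfolding gossip_def using Suc network_entries[OF net]
    by (simp, intro convex_sum convex_shrunk_set[OF feas pos(3,4)]) auto
  then show ?case by (rule projection_step(1))
qed

lemma gossip_X_feasible: "gossip A (X m) $ i \<in> \<K>\<^sub>\<delta>"
  unfolding gossip_def using X_feasible network_entries[OF net]
  by (simp, intro convex_sum convex_shrunk_set[OF feas pos(3,4)]) auto

lemmas projection_bounds = projection_step[OF gossip_X_feasible]

lemma X_Y_close: "norm (X m $ i - Y m $ i) \<le> sqrt 3 * h"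
proof (cases m)
  case 0
  then show ?thesis using h_pos by (simp add: X_0 Y_0)
next
  case (Suc l)
  have "(norm (X m $ i - Y m $ i))\<^sup>2 \<le> (sqrt 3 * h)\<^sup>2"
    using projection_bounds(3)[of l i] by (simp add: Suc \<epsilon>_eq power_mult_distrib)
  then show ?thesis
    by (rule power2_le_imp_le) (use h_pos in simp)
qed

lemma gossip_X_Y_close: "norm (gossip A (X m) $ i - gossip A (Y m) $ i) \<le> sqrt 3 * h"
proof -
  have "gossip A (X m) $ i - gossip A (Y m) $ i = (\<Sum>j\<in>UNIV. A $ i $ j *\<^sub>R (X m $ j - Y m $ j))"
    by (simp add: gossip_def sum_subtractf scaleR_diff_right)
  also have "norm \<dots> \<le> sqrt 3 * h"
    by (intro norm_convex_combination_le network_entries[OF net] X_Y_close)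
  finally show ?thesis .
qed

definition "g = real K * (real k * B\<^sub>0 / \<delta>)"

lemma step_g: "\<eta> * g = real k * B\<^sub>0 * h"
  by (simp add: g_def h_def)

lemma g_nonneg: "0 \<le> g" using pos by (simp add: g_def)

lemma norm_G_le: assumes "m < n" shows "norm (G m i) \<le> g"
proof -
  have "(m + 1) * K \<le> n * K" using assms by (intro mult_right_mono) auto
  then have t: "t \<in> {1..n * K}" if "t \<in> {m * K + 1..(m + 1) * K}" for t
    using that by (meson atLeastAtMost_iff le_add2 order_trans)
  have "norm (G m i) \<le> (\<Sum>t = m * K + 1..(m + 1) * K. real k * B\<^sub>0 / \<delta>)"
    unfolding G_def
  proof (intro order_trans[OF norm_sum] sum_mono)
    fix s assume "s \<in> {m * K + 1..(m + 1) * K}"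
    from directions[OF t[OF this]] responses[OF t[OF this]]
    have "norm (v s i) = 1" "\<bar>ob s i\<bar> \<le> B\<^sub>0" by auto
    then show "norm ((real k / \<delta> * ob s i) *\<^sub>R v s i) \<le> real k * B\<^sub>0 / \<delta>"
      using pos by (simp add: abs_mult divide_right_mono mult_left_mono)
  qed
  then show ?thesis by (simp add: g_def)
qed

lemma target_close: assumes "m < n" shows "norm (gossip A (X m) $ i - target m i) \<le> q * h"
proof -
  have "norm (\<eta> *\<^sub>R G m i) \<le> real k * B\<^sub>0 * h"
    using norm_G_le[OF assms] pos by (simp add: step_g[symmetric] mult_left_mono)
  moreover have "gossip A (X m) $ i - target m i
      = (gossip A (X m) $ i - gossip A (Y m) $ i) - \<eta> *\<^sub>R G m i"
    by (simp add: target_def)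
  then have "norm (gossip A (X m) $ i - target m i)
      \<le> norm (gossip A (X m) $ i - gossip A (Y m) $ i) + norm (\<eta> *\<^sub>R G m i)"
    by (metis norm_triangle_ineq4)
  ultimately show ?thesis
    using gossip_X_Y_close[of m i] by (simp add: q_def algebra_simps)
qed

text \<open>Projecting does not increase the distance to the feasible point \<open>gossip A (X m) $ i\<close>, which is within
\<open>\<surd>3 h\<close> of \<open>gossip A (Y m) $ i\<close>.\<close>

lemma Y_Suc_close: assumes "m < n" shows "norm (Y (Suc m) $ i - gossip A (Y m) $ i) \<le> 2 * q * h"
proof -
  have "norm (Y (Suc m) $ i - gossip A (X m) $ i) \<le> norm (target m i - gossip A (X m) $ i)"
    by (rule power2_le_imp_le[OF projection_bounds(4)[OF gossip_X_feasible]]) simp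
  then have "norm (Y (Suc m) $ i - gossip A (X m) $ i) \<le> q * h"
    using target_close[OF assms, of i] by (simp add: norm_minus_commute)
  moreover have "norm (gossip A (X m) $ i - gossip A (Y m) $ i) \<le> q * h"
    using gossip_X_Y_close[of m i] h_pos pos
    by (smt (verit, ccfv_SIG) mult_right_mono of_nat_0_le_iff q_def split_mult_pos_le)
  ultimately show ?thesis
    using norm_triangle_ineq[of "Y (Suc m) $ i - gossip A (X m) $ i"
        "gossip A (X m) $ i - gossip A (Y m) $ i"] by simp
qed

lemma disagreement_bound: "m \<le> n \<Longrightarrow> norm (disagreement (Y m)) \<le> \<Delta> * h"
proof (induction m)
  case 0
  have "disagreement (Y 0) = 0"
    by (simp add: disagreement_def vec_eq_iff[of _ "0 :: (real ^ 'd) ^ 'n"] Y_0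
        sum_constant_scaleR del: sum_constant)
  then show ?case using \<Delta>_nonneg h_pos by simp
next
  case (Suc m)
  let ?l = "second_eigenvalue A"
  have "norm (disagreement (Y (Suc m)))
      \<le> ?l * norm (disagreement (Y m)) + sqrt (real CARD('n)) * (2 * q * h)"
    using Suc.prems Y_Suc_close by (intro disagreement_after_gossip[OF net gap]) auto
  also have "\<dots> \<le> ?l * (\<Delta> * h) + sqrt (real CARD('n)) * (2 * q * h)"
    using Suc by (intro add_right_mono mult_left_mono second_eigenvalue_nonneg) auto
  also have "sqrt (real CARD('n)) * (2 * q * h) = (1 - ?l) * (\<Delta> * h)"
    using gap by (simp add: \<Delta>_def)
  finally show ?case by (simp add: algebra_simps)
qed

lemma Y_Y_close: assumes "m \<le> n" shows "norm (Y m $ j - Y m $ i) \<le> 2 * \<Delta> * h"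
proof -
  have "Y m $ j - Y m $ i = disagreement (Y m) $ j - disagreement (Y m) $ i"
    by (simp add: disagreement_def)
  then have "norm (Y m $ j - Y m $ i) \<le> norm (disagreement (Y m) $ j) + norm (disagreement (Y m) $ i)"
    by (metis norm_triangle_ineq4)
  then show ?thesis
    using disagreement_bound[OF assms] Finite_Cartesian_Product.norm_nth_le[of "disagreement (Y m)" i]
      Finite_Cartesian_Product.norm_nth_le[of "disagreement (Y m)" j] by linarith
qed

lemma X_X_close: assumes "m \<le> n" shows "norm (X m $ j - X m $ i) \<le> (2 * sqrt 3 + 2 * \<Delta>) * h"
proof -
  have eq: "X m $ j - X m $ i = (X m $ j - Y m $ j) + (Y m $ j - Y m $ i) - (X m $ i - Y m $ i)"
    by simp
  have "norm (X m $ j - X m $ i)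
      \<le> norm (X m $ j - Y m $ j) + norm (Y m $ j - Y m $ i) + norm (X m $ i - Y m $ i)"
    unfolding eq using norm_triangle_ineq4[of "(X m $ j - Y m $ j) + (Y m $ j - Y m $ i)" "X m $ i - Y m $ i"]
      norm_triangle_ineq[of "X m $ j - Y m $ j" "Y m $ j - Y m $ i"] by linarith
  then show ?thesis
    using X_Y_close[of m j] X_Y_close[of m i] Y_Y_close[OF assms, of j i] by (simp add: algebra_simps)
qed

lemma gossip_Y_close: assumes "m \<le> n" shows "norm (gossip A (Y m) $ i - Y m $ i) \<le> 2 * \<Delta> * h"
proof -
  have "gossip A (Y m) $ i - Y m $ i = (\<Sum>j\<in>UNIV. A $ i $ j *\<^sub>R (Y m $ j - Y m $ i))"
    by (simp add: gossip_def sum_subtractf scaleR_diff_right scaleR_left.sum[symmetric]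
        network_entries[OF net])
  also have "norm \<dots> \<le> 2 * \<Delta> * h"
    by (intro norm_convex_combination_le network_entries[OF net] Y_Y_close[OF assms])
  finally show ?thesis .
qed

definition "potential z m = (\<Sum>i\<in>UNIV. (norm (Y m $ i - z))\<^sup>2)"

text \<open>The projection inequality bounds the new distance to \<open>z\<close> by that of the target.  After expanding the
square, the averaged distances sum to at most the old potential since \<open>A\<close> is doubly stochastic.\<close>

lemma potential_step:
  assumes "m < n" and z: "z \<in> \<K>\<^sub>\<delta>"
  shows "potential z (Suc m) \<le> potential z m
    + (\<Sum>i\<in>UNIV. 2 * \<eta> * (G m i \<bullet> (gossip A (Y m) $ i - z))) + real CARD('n) * (\<eta> * g)\<^sup>2"
proof -
  have "potential z (Suc m) \<le> (\<Sum>i\<in>UNIV. (norm (gossip A (Y m) $ i - z))\<^sup>2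
      + 2 * \<eta> * (G m i \<bullet> (gossip A (Y m) $ i - z)) + (\<eta> * g)\<^sup>2)"
    unfolding potential_def
  proof (rule sum_mono)
    fix i
    let ?a = "gossip A (Y m) $ i - z"
    have "target m i - z = ?a + \<eta> *\<^sub>R G m i" by (simp add: target_def)
    then have "(norm (target m i - z))\<^sup>2 = (norm ?a)\<^sup>2 + 2 * \<eta> * (G m i \<bullet> ?a) + (\<eta> * norm (G m i))\<^sup>2"
      by (simp only: power2_norm_eq_inner power_mult_distrib)
        (simp add: inner_add_left inner_add_right inner_commute power2_eq_square)
    moreover have "(\<eta> * norm (G m i))\<^sup>2 \<le> (\<eta> * g)\<^sup>2"
      using norm_G_le[OF assms(1)] pos by (intro power_mono mult_left_mono) auto
    ultimately show "(norm (Y (Suc m) $ i - z))\<^sup>2 \<le> (norm ?a)\<^sup>2 + 2 * \<eta> * (G m i \<bullet> ?a) + (\<eta> * g)\<^sup>2"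
      using projection_bounds(4)[OF z, of m i] by linarith
  qed
  also have "\<dots> = (\<Sum>i\<in>UNIV. (norm (gossip A (Y m) $ i - z))\<^sup>2)
    + (\<Sum>i\<in>UNIV. 2 * \<eta> * (G m i \<bullet> (gossip A (Y m) $ i - z))) + real CARD('n) * (\<eta> * g)\<^sup>2"
    by (simp only: sum.distrib) simp
  also have "(\<Sum>i\<in>UNIV. (norm (gossip A (Y m) $ i - z))\<^sup>2) \<le> potential z m"
  proof -
    have "gossip A (\<chi> j. Y m $ j - z) $ i = gossip A (Y m) $ i - z" for i
      by (simp add: gossip_def sum_subtractf scaleR_diff_right scaleR_left.sum[symmetric]
          network_entries[OF net])
    then show ?thesis
      using gossip_nonexpansive[OF net, of "\<chi> j. Y m $ j - z"] by (simp add: potential_def)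
  qed
  finally show ?thesis by simp
qed

text \<open>In the inequality for the potential the estimate is paired with \<open>z\<close> minus the averaged infeasible point.
Passing from there to the feasible iterate costs one consensus error and one projection error, both of
order \<open>h\<close>.\<close>

lemma inner_step:
  assumes "m < n" and z: "z \<in> \<K>\<^sub>\<delta>"
  shows "(\<Sum>i\<in>UNIV. G m i \<bullet> (z - X m $ i)) \<le> (potential z m - potential z (Suc m)) / (2 * \<eta>)
    + real CARD('n) * (g * h * (2 * \<Delta> + sqrt 3 + real k * B\<^sub>0 / 2))"
proof -
  have "G m i \<bullet> (z - X m $ i) \<le> g * h * (2 * \<Delta> + sqrt 3) - G m i \<bullet> (gossip A (Y m) $ i - z)" for i
  proof -
    have "norm (gossip A (Y m) $ i - X m $ i) \<le> 2 * \<Delta> * h + sqrt 3 * h"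
      using norm_triangle_ineq[of "gossip A (Y m) $ i - Y m $ i" "Y m $ i - X m $ i"]
        gossip_Y_close[of m i] X_Y_close[of m i] assms(1) by (simp add: norm_minus_commute)
    then have "G m i \<bullet> (gossip A (Y m) $ i - X m $ i) \<le> g * (2 * \<Delta> * h + sqrt 3 * h)"
      using norm_G_le[OF assms(1), of i]
      by (intro order_trans[OF norm_cauchy_schwarz] mult_mono) (auto simp: g_nonneg)
    then show ?thesis by (simp add: inner_diff_right algebra_simps)
  qed
  then have "(\<Sum>i\<in>UNIV. G m i \<bullet> (z - X m $ i))
      \<le> (\<Sum>i\<in>(UNIV :: 'n set). g * h * (2 * \<Delta> + sqrt 3) - G m i \<bullet> (gossip A (Y m) $ i - z))"
    by (intro sum_mono)
  also have "\<dots> = real CARD('n) * (g * h * (2 * \<Delta> + sqrt 3))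
      - (\<Sum>i\<in>UNIV. G m i \<bullet> (gossip A (Y m) $ i - z))"
    by (simp add: sum_subtractf)
  finally have split: "(\<Sum>i\<in>UNIV. G m i \<bullet> (z - X m $ i))
      + (\<Sum>i\<in>UNIV. G m i \<bullet> (gossip A (Y m) $ i - z)) \<le> real CARD('n) * (g * h * (2 * \<Delta> + sqrt 3))"
    by simp
  have "- (\<Sum>i\<in>UNIV. G m i \<bullet> (gossip A (Y m) $ i - z))
      \<le> (potential z m - potential z (Suc m) + real CARD('n) * (\<eta> * g)\<^sup>2) / (2 * \<eta>)"
    using potential_step[OF assms] pos by (simp add: sum_distrib_left[symmetric] field_simps)
  also have "(potential z m - potential z (Suc m) + real CARD('n) * (\<eta> * g)\<^sup>2) / (2 * \<eta>)
      = (potential z m - potential z (Suc m)) / (2 * \<eta>) + real CARD('n) * (g * (\<eta> * g) / 2)"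
    using pos by (simp add: field_simps power2_eq_square)
  finally have upper: "- (\<Sum>i\<in>UNIV. G m i \<bullet> (gossip A (Y m) $ i - z))
      \<le> (potential z m - potential z (Suc m)) / (2 * \<eta>) + real CARD('n) * (g * (\<eta> * g) / 2)" .
  show ?thesis
    using add_mono[OF split upper] unfolding step_g by (simp add: algebra_simps)
qed

lemma inner_sum_bound:
  assumes z: "z \<in> \<K>\<^sub>\<delta>"
  shows "(\<Sum>m<n. \<Sum>i\<in>UNIV. G m i \<bullet> (z - X m $ i)) \<le> real CARD('n) * (2 * R\<^sup>2 / \<eta>
    + real n * (g * h * (2 * \<Delta> + sqrt 3 + real k * B\<^sub>0 / 2)))"
proof -
  let ?c = "g * h * (2 * \<Delta> + sqrt 3 + real k * B\<^sub>0 / 2)"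
  have "(\<Sum>m<n. \<Sum>i\<in>UNIV. G m i \<bullet> (z - X m $ i))
      \<le> (\<Sum>m<n. (potential z m - potential z (Suc m)) / (2 * \<eta>) + real CARD('n) * ?c)"
    using inner_step[OF _ z] by (intro sum_mono) auto
  also have "\<dots> = (potential z 0 - potential z n) / (2 * \<eta>) + real n * (real CARD('n) * ?c)"
    by (simp add: sum.distrib sum_divide_distrib[symmetric] sum_lessThan_telescope')
  also have "potential z 0 - potential z n \<le> real CARD('n) * (4 * R\<^sup>2)"
  proof -
    have "norm (ctr - z) \<le> R + R"
      using z shrunk_set_subset[OF feas pos(3,4)] feasible_norm_le[OF feas]
        feasible_facts(4)[OF feas] by (intro norm_triangle_le_diff add_mono) auto
    then have "(norm (ctr - z))\<^sup>2 \<le> (R + R)\<^sup>2" by (intro power_mono) auto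
    then have "real CARD('n) * (norm (ctr - z))\<^sup>2 \<le> real CARD('n) * (4 * R\<^sup>2)"
      by (intro mult_left_mono) (auto simp: power2_eq_square)
    moreover have "0 \<le> potential z n" by (simp add: potential_def sum_nonneg)
    moreover have "potential z 0 = real CARD('n) * (norm (ctr - z))\<^sup>2"
      by (simp add: potential_def Y_0)
    ultimately show ?thesis by linarith
  qed
  finally show ?thesis
    using pos by (simp add: divide_right_mono field_simps)
qed

lemma sum_rounds_by_blocks:
  fixes F :: "nat \<Rightarrow> 'n \<Rightarrow> nat \<Rightarrow> real"
  shows "(\<Sum>t = 1..l * K. \<Sum>i\<in>UNIV. F t i ((t - 1) div K))
    = (\<Sum>m<l. \<Sum>i\<in>UNIV. \<Sum>t = m * K + 1..(m + 1) * K. F t i m)"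
proof (induction l)
  case (Suc l)
  have "{1..Suc l * K} = {1..l * K} \<union> {l * K + 1..(l + 1) * K}" by auto
  then have "(\<Sum>t = 1..Suc l * K. \<Sum>i\<in>UNIV. F t i ((t - 1) div K))
     = (\<Sum>t = 1..l * K. \<Sum>i\<in>UNIV. F t i ((t - 1) div K))
     + (\<Sum>t = l * K + 1..(l + 1) * K. \<Sum>i\<in>UNIV. F t i ((t - 1) div K))"
    by (simp only:) (rule sum.union_disjoint, auto)
  also have "(\<Sum>t = l * K + 1..(l + 1) * K. \<Sum>i\<in>UNIV. F t i ((t - 1) div K))
     = (\<Sum>t = l * K + 1..(l + 1) * K. \<Sum>i\<in>UNIV. F t i l)"
  proof (intro sum.cong refl)
    fix t i assume "t \<in> {l * K + 1..(l + 1) * K}"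
    then have "(t - 1) div K = l"
      by (intro div_nat_eqI) (auto simp: algebra_simps)
    then show "F t i ((t - 1) div K) = F t i l" by simp
  qed
  also have "\<dots> = (\<Sum>i\<in>UNIV. \<Sum>t = l * K + 1..(l + 1) * K. F t i l)"
    by (rule sum.swap)
  finally show ?case by (simp only: Suc sum.lessThan_Suc)
qed simp

lemma linear_regret_bound:
  assumes z: "z \<in> \<K>\<^sub>\<delta>"
  shows "(\<Sum>t = 1..n * K. \<Sum>i\<in>UNIV.
      real k / \<delta> * (ob t i * (v t i \<bullet> (z - feas_pt (states ((t - 1) div K) i)))))
    \<le> real CARD('n) * (2 * R\<^sup>2 / \<eta> + \<eta> * real (n * K) * real K / \<delta>\<^sup>2
      * (real k * B\<^sub>0 * (2 * \<Delta> + sqrt 3 + real k * B\<^sub>0 / 2)))"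
proof -
  have "(\<Sum>m<n. \<Sum>i\<in>UNIV. G m i \<bullet> (z - X m $ i)) = (\<Sum>m<n. \<Sum>i\<in>UNIV. \<Sum>t = m * K + 1..(m + 1) * K.
      real k / \<delta> * (ob t i * (v t i \<bullet> (z - feas_pt (states m i)))))"
    by (simp add: G_def X_def inner_sum_left mult.assoc)
  moreover have "real n * (g * h * (2 * \<Delta> + sqrt 3 + real k * B\<^sub>0 / 2))
      = \<eta> * real (n * K) * real K / \<delta>\<^sup>2 * (real k * B\<^sub>0 * (2 * \<Delta> + sqrt 3 + real k * B\<^sub>0 / 2))"
    by (simp add: g_def h_def power2_eq_square)
  ultimately show ?thesis
    using inner_sum_bound[OF z]
      sum_rounds_by_blocks[of "\<lambda>t i m. real k / \<delta> * (ob t i * (v t i \<bullet> (z - feas_pt (states m i))))" n]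
    by simp
qed

text \<open>The squared distance \<open>D\<close> of the point to be projected from the starting point is at most
\<open>q\<^sup>2 h\<^sup>2 = q\<^sup>2 \<epsilon>\<close>, so the factor \<open>D (D - \<epsilon>) / (4 \<epsilon>\<^sup>2)\<close> of the cost is bounded independently of \<open>\<epsilon>\<close>.\<close>

lemma program_calls_le:
  assumes "m < n"
  shows "real (program_calls loo (prog m i)) \<le> 27 * R\<^sup>2 / \<epsilon> * (1 + q ^ 4 / 4)"
proof -
  define D where "D = (norm (gossip A (X m) $ i - target m i))\<^sup>2"
  have D: "0 \<le> D" "D \<le> q\<^sup>2 * \<epsilon>"
    using power_mono[OF target_close[OF assms, of i], of 2]
    by (auto simp: D_def \<epsilon>_eq power_mult_distrib)
  have "D * (D - \<epsilon>) \<le> D * D"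
    using D \<epsilon>_pos by (intro mult_left_mono) auto
  also have "\<dots> \<le> (q\<^sup>2 * \<epsilon>) * (q\<^sup>2 * \<epsilon>)"
    using D by (intro mult_mono) auto
  finally have "D * (D - \<epsilon>) / (4 * \<epsilon>\<^sup>2) \<le> (q\<^sup>2 * \<epsilon>) * (q\<^sup>2 * \<epsilon>) / (4 * \<epsilon>\<^sup>2)"
    using \<epsilon>_pos by (intro divide_right_mono) auto
  also have "\<dots> = q ^ 4 / 4"
    using \<epsilon>_pos by (simp add: field_simps power2_eq_square power4_eq_xxxx)
  finally have max: "max 1 (D * (D - \<epsilon>) / (4 * \<epsilon>\<^sup>2) + 1) \<le> 1 + q ^ 4 / 4"
    by (auto simp: max_def)
  have "real (nat \<lceil>27 * R\<^sup>2 / \<epsilon> - 2\<rceil>) \<le> 27 * R\<^sup>2 / \<epsilon>"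
  proof -
    have "real_of_int \<lceil>27 * R\<^sup>2 / \<epsilon> - 2\<rceil> \<le> 27 * R\<^sup>2 / \<epsilon>"
      using of_int_ceiling_le_add_one[of "27 * R\<^sup>2 / \<epsilon> - 2"] by linarith
    moreover have "0 \<le> 27 * R\<^sup>2 / \<epsilon>" using \<epsilon>_pos by simp
    ultimately show ?thesis by (cases "0 \<le> \<lceil>27 * R\<^sup>2 / \<epsilon> - 2\<rceil>") auto
  qed
  then have "real (nat \<lceil>27 * R\<^sup>2 / \<epsilon> - 2\<rceil>) * max 1 (D * (D - \<epsilon>) / (4 * \<epsilon>\<^sup>2) + 1)
      \<le> 27 * R\<^sup>2 / \<epsilon> * (1 + q ^ 4 / 4)"
    using max \<epsilon>_pos by (intro mult_mono) auto
  then show ?thesis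
    using projection_bounds(5)[of m i] unfolding D_def[symmetric] by linarith
qed

lemma loo_calls_le:
  "m \<le> n \<Longrightarrow> real (loo_calls (states m i)) \<le> real m * (27 * R\<^sup>2 / \<epsilon> * (1 + q ^ 4 / 4))"
proof (induction m)
  case (Suc m)
  then have "real (loo_calls (states m i)) \<le> real m * (27 * R\<^sup>2 / \<epsilon> * (1 + q ^ 4 / 4))"
    by simp
  moreover have "real (program_calls loo (prog m i)) \<le> 27 * R\<^sup>2 / \<epsilon> * (1 + q ^ 4 / 4)"
    using Suc.prems by (intro program_calls_le) simp
  ultimately show ?case
    unfolding states_Suc agent_state.simps of_nat_add of_nat_Suc distrib_right mult_1
    by linarith
qed simp

lemma comms_eq: "comms (states m i) = m"
  by (induction m) (simp_all add: states_Suc del: agent_states.simps(2))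

end

section \<open>Information and independence\<close>

lemma borel_measurable_continuous_on_compose:
  fixes X :: "'w \<Rightarrow> 'a::topological_space" and g :: "'a \<Rightarrow> 'b::topological_space"
  assumes "continuous_on S g" "X \<in> borel_measurable N" "\<And>\<omega>. \<omega> \<in> space N \<Longrightarrow> X \<omega> \<in> S"
  shows "(\<lambda>\<omega>. g (X \<omega>)) \<in> borel_measurable N"
proof -
  have "X \<in> measurable N (restrict_space borel S)"
    using assms(2,3) by (intro measurable_restrict_space2) auto
  from measurable_compose[OF this borel_measurable_continuous_on_restrict[OF assms(1)]]
  show ?thesis .
qed

lemma borel_measurable_vec_component [measurable (raw)]:
  fixes X :: "'w \<Rightarrow> real ^ 'd"
  assumes "X \<in> borel_measurable N"
  shows "(\<lambda>\<omega>. X \<omega> $ a) \<in> borel_measurable N"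
  using assms by (rule borel_measurable_continuous_on_compose[where S=UNIV, rotated])
    (auto intro!: continuous_intros)

lemma sets_info:
  "sets (info M v ob I J) = sigma_sets (space M)
     ({v s j -` B \<inter> space M | s j B. (s, j) \<in> I \<and> B \<in> sets borel} \<union>
      {ob s j -` B \<inter> space M | s j B. (s, j) \<in> J \<and> B \<in> sets borel})"
  unfolding info_def by (rule sets_measure_of) auto

lemma space_info [simp]: "space (info M v ob I J) = space M"
  unfolding info_def by (rule space_measure_of) auto

lemma measurable_info_direction:
  fixes v :: "nat \<Rightarrow> 'n \<Rightarrow> 'w \<Rightarrow> real ^ 'd"
  assumes "(s, j) \<in> I"
  shows "v s j \<in> borel_measurable (info M v ob I J)"
proof (rule measurableI)
  fix B :: "(real ^ 'd) set" assume "B \<in> sets borel"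
  then show "v s j -` B \<inter> space (info M v ob I J) \<in> sets (info M v ob I J)"
    unfolding sets_info space_info using assms by (intro sigma_sets.Basic) blast
qed simp

lemma measurable_info_response:
  assumes "(s, j) \<in> J"
  shows "ob s j \<in> borel_measurable (info M v ob I J)"
proof (rule measurableI)
  fix B :: "real set" assume "B \<in> sets borel"
  then show "ob s j -` B \<inter> space (info M v ob I J) \<in> sets (info M v ob I J)"
    unfolding sets_info space_info using assms by (intro sigma_sets.Basic) blast
qed simp

lemma info_mono:
  assumes "I \<subseteq> I'" "J \<subseteq> J'"
  shows "sets (info M v ob I J) \<subseteq> sets (info M v ob I' J')"
proof -
  have "{v s j -` B \<inter> space M | s j B. (s, j) \<in> I \<and> B \<in> sets borel}
      \<subseteq> {v s j -` B \<inter> space M | s j B. (s, j) \<in> I' \<and> B \<in> sets borel}"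
    by (intro Collect_mono impI; elim exE conjE; intro exI conjI;
        (assumption | erule subsetD[OF assms(1)]))
  moreover have "{ob s j -` B \<inter> space M | s j B. (s, j) \<in> J \<and> B \<in> sets borel}
      \<subseteq> {ob s j -` B \<inter> space M | s j B. (s, j) \<in> J' \<and> B \<in> sets borel}"
    by (intro Collect_mono impI; elim exE conjE; intro exI conjI;
        (assumption | erule subsetD[OF assms(2)]))
  ultimately show ?thesis
    unfolding sets_info by (intro sigma_sets_mono' Un_mono)
qed

lemma info_subalgebra:
  assumes "\<And>s j. (s, j) \<in> I \<Longrightarrow> v s j \<in> borel_measurable M"
    and "\<And>s j. (s, j) \<in> J \<Longrightarrow> ob s j \<in> borel_measurable M"
  shows "subalgebra M (info M v ob I J)"
  unfolding subalgebra_def sets_info using assms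
  by (auto intro!: sets.sigma_sets_subset measurable_sets)

context prob_space
begin

text \<open>The form of independence in which the sampling scheme provides it: the direction is independent of a
sub-\<open>\<sigma>\<close>-algebra, not just of a given random variable.\<close>

lemma indep_set_expectation_product:
  fixes X :: "'a \<Rightarrow> real" and V :: "'a \<Rightarrow> 'b::topological_space" and \<phi> :: "'b \<Rightarrow> real"
  assumes indep: "indep_set (sets (vimage_algebra (space M) V borel)) (sets F)"
    and F: "subalgebra M F" and X: "X \<in> borel_measurable F" "integrable M X"
    and V: "V \<in> borel_measurable M" and \<phi>: "\<phi> \<in> borel_measurable borel" "integrable M (\<lambda>\<omega>. \<phi> (V \<omega>))"
  shows "integrable M (\<lambda>\<omega>. X \<omega> * \<phi> (V \<omega>))"
    and "expectation (\<lambda>\<omega>. X \<omega> * \<phi> (V \<omega>)) = expectation X * (\<integral>v. \<phi> v \<partial>distr M borel V)"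
proof -
  have [measurable]: "X \<in> borel_measurable M" "V \<in> borel_measurable M" "\<phi> \<in> borel_measurable borel"
    using measurable_from_subalg[OF F X(1)] V \<phi> by auto
  let ?P = "{(\<lambda>\<omega>. \<phi> (V \<omega>)) -` A \<inter> space M | A. A \<in> sets borel}"
  let ?Q = "{X -` A \<inter> space M | A. A \<in> sets borel}"
  have "(\<lambda>\<omega>. \<phi> (V \<omega>)) -` A \<inter> space M \<in> sets (vimage_algebra (space M) V borel)"
    if "A \<in> sets borel" for A
  proof -
    have "\<phi> -` A \<in> sets borel" using \<phi>(1) that by (metis measurable_sets_borel)
    from in_vimage_algebra[OF this, of V "space M"] show ?thesis by (simp add: vimage_comp comp_def)
  qed
  then have P: "sigma_sets (space M) ?P \<subseteq> sets (vimage_algebra (space M) V borel)"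
    using sets.sigma_sets_subset[of ?P "vimage_algebra (space M) V borel"] by auto
  have "X -` A \<inter> space M \<in> sets F" if "A \<in> sets borel" for A
    using measurable_sets[OF X(1) that] F by (simp add: subalgebra_def)
  then have Q: "sigma_sets (space M) ?Q \<subseteq> sets F"
    using sets.sigma_sets_subset[of ?Q F] F by (auto simp: subalgebra_def)
  have "indep_set (sigma_sets (space M) ?P) (sigma_sets (space M) ?Q)"
    using indep unfolding indep_set_def
    by (rule indep_sets_mono_sets) (use P Q in \<open>auto split: bool.splits\<close>)
  then have iv: "indep_var borel (\<lambda>\<omega>. \<phi> (V \<omega>)) borel X"
    by (simp add: indep_var_eq)
  show "integrable M (\<lambda>\<omega>. X \<omega> * \<phi> (V \<omega>))"
    using indep_var_integrable[OF iv \<phi>(2) X(2)] by (simp add: mult.commute)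
  show "expectation (\<lambda>\<omega>. X \<omega> * \<phi> (V \<omega>)) = expectation X * (\<integral>v. \<phi> v \<partial>distr M borel V)"
    using indep_var_lebesgue_integral[OF iv \<phi>(2) X(2)] by (simp add: mult.commute integral_distr)
qed

lemma integrable_bounded:
  fixes X :: "'a \<Rightarrow> 'b::{banach, second_countable_topology}"
  assumes "X \<in> borel_measurable M" "\<And>\<omega>. \<omega> \<in> space M \<Longrightarrow> norm (X \<omega>) \<le> B"
  shows "integrable M X"
  using assms by (intro integrable_const_bound[of _ B]) auto

context
  fixes F :: "'a measure" and V :: "'a \<Rightarrow> real ^ 'd" and L :: "(real ^ 'd) set"
  assumes indep: "indep_set (sets (vimage_algebra (space M) V borel)) (sets F)"
    and F: "subalgebra M F" and L: "subspace L"
    and V: "V \<in> borel_measurable M" "\<And>\<omega>. \<omega> \<in> space M \<Longrightarrow> norm (V \<omega>) = 1"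
    and unif: "uniform_on_unit_sphere L (distr M borel V)"
begin

lemma uniform_direction_component_le: "\<omega> \<in> space M \<Longrightarrow> \<bar>V \<omega> $ a\<bar> \<le> 1"
  using component_le_norm_cart[of "V \<omega>" a] V(2)[of \<omega>] by simp

lemma bounded_component_integrable:
  fixes U :: "'a \<Rightarrow> real ^ 'd"
  assumes "U \<in> borel_measurable M" "\<And>\<omega>. \<omega> \<in> space M \<Longrightarrow> norm (U \<omega>) \<le> B"
  shows "integrable M (\<lambda>\<omega>. U \<omega> $ a)"
proof (rule integrable_bounded)
  show "norm (U \<omega> $ a) \<le> B" if "\<omega> \<in> space M" for \<omega>
    using component_le_norm_cart[of "U \<omega>" a] assms(2)[OF that] by simp
qed (use assms in measurable)

text \<open>Coordinatewise, the mean of a product of independent variables is the product of their means.\<close>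

lemma expectation_past_inner_direction:
  fixes U :: "'a \<Rightarrow> real ^ 'd"
  assumes U: "U \<in> borel_measurable F" "\<And>\<omega>. \<omega> \<in> space M \<Longrightarrow> norm (U \<omega>) \<le> B"
  shows "expectation (\<lambda>\<omega>. U \<omega> \<bullet> V \<omega>) = 0"
proof -
  have UM: "U \<in> borel_measurable M" using measurable_from_subalg[OF F U(1)] .
  have int: "integrable M (\<lambda>\<omega>. U \<omega> $ a * V \<omega> $ a)"
    and zero: "expectation (\<lambda>\<omega>. U \<omega> $ a * V \<omega> $ a) = 0" for a
  proof -
    have iU: "integrable M (\<lambda>\<omega>. U \<omega> $ a)"
      using bounded_component_integrable[OF UM U(2)] .
    have iV: "integrable M (\<lambda>\<omega>. V \<omega> $ a)"
      using bounded_component_integrable[OF V(1), of 1] V(2) by simp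
    have mF: "(\<lambda>\<omega>. U \<omega> $ a) \<in> borel_measurable F" using U(1) by measurable
    note prod = indep_set_expectation_product[OF indep F mF iU V(1), of "\<lambda>v. v $ a"]
    show "integrable M (\<lambda>\<omega>. U \<omega> $ a * V \<omega> $ a)"
      using prod(1) iV by simp
    have "(\<integral>v. axis a 1 \<bullet> v \<partial>distr M borel V) = 0"
      using uniform_sphere_mean_zero[OF unif L] .
    then show "expectation (\<lambda>\<omega>. U \<omega> $ a * V \<omega> $ a) = 0"
      using prod(2) iV by (simp add: inner_axis')
  qed
  have "expectation (\<lambda>\<omega>. U \<omega> \<bullet> V \<omega>) = (\<Sum>a\<in>UNIV. expectation (\<lambda>\<omega>. U \<omega> $ a * V \<omega> $ a))"
    unfolding inner_vec_def using int by (simp add: Bochner_Integration.integral_sum)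
  then show ?thesis by (simp add: zero)
qed

text \<open>The expectation factors for each pair of coordinates.  Reassembling the factors under the expectation
gives, for every \<open>\<omega>\<close>, the covariance of the uniform distribution applied to the fixed vectors \<open>G \<omega>\<close> and
\<open>W \<omega>\<close>.\<close>

lemma expectation_past_quadratic_direction:
  fixes G W :: "'a \<Rightarrow> real ^ 'd"
  assumes G: "G \<in> borel_measurable F" "\<And>\<omega>. \<omega> \<in> space M \<Longrightarrow> norm (G \<omega>) \<le> B"
    and W: "W \<in> borel_measurable F" "\<And>\<omega>. \<omega> \<in> space M \<Longrightarrow> norm (W \<omega>) \<le> B'"
    and WL: "\<And>\<omega>. \<omega> \<in> space M \<Longrightarrow> W \<omega> \<in> L"
  shows "real (dim L) * expectation (\<lambda>\<omega>. (G \<omega> \<bullet> V \<omega>) * (W \<omega> \<bullet> V \<omega>)) = expectation (\<lambda>\<omega>. G \<omega> \<bullet> W \<omega>)"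
proof -
  let ?\<mu> = "distr M borel V"
  define \<sigma> where "\<sigma> a b = (\<integral>v. v $ a * v $ b \<partial>?\<mu>)" for a b
  have [measurable]: "G \<in> borel_measurable M" "W \<in> borel_measurable M" "V \<in> borel_measurable M"
    using measurable_from_subalg[OF F G(1)] measurable_from_subalg[OF F W(1)] V by auto
  have int0: "integrable M (\<lambda>\<omega>. G \<omega> $ a * W \<omega> $ b)" for a b
  proof (rule integrable_bounded)
    fix \<omega> assume \<omega>: "\<omega> \<in> space M"
    have "\<bar>G \<omega> $ a\<bar> \<le> B" "\<bar>W \<omega> $ b\<bar> \<le> B'"
      using component_le_norm_cart[of "G \<omega>" a] G(2)[OF \<omega>]
        component_le_norm_cart[of "W \<omega>" b] W(2)[OF \<omega>] by auto
    then show "norm (G \<omega> $ a * W \<omega> $ b) \<le> B * B'"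
      by (simp add: abs_mult) (intro mult_mono, auto)
  qed measurable
  have prod: "integrable M (\<lambda>\<omega>. (G \<omega> $ a * W \<omega> $ b) * (V \<omega> $ a * V \<omega> $ b))"
    "expectation (\<lambda>\<omega>. (G \<omega> $ a * W \<omega> $ b) * (V \<omega> $ a * V \<omega> $ b))
       = expectation (\<lambda>\<omega>. G \<omega> $ a * W \<omega> $ b) * \<sigma> a b" for a b
  proof -
    have iV: "integrable M (\<lambda>\<omega>. V \<omega> $ a * V \<omega> $ b)"
    proof (rule integrable_bounded)
      fix \<omega> assume "\<omega> \<in> space M"
      then show "norm (V \<omega> $ a * V \<omega> $ b) \<le> 1"
        using uniform_direction_component_le by (simp add: abs_mult mult_le_one)
    qed measurable
    have mF: "(\<lambda>\<omega>. G \<omega> $ a * W \<omega> $ b) \<in> borel_measurable F" using G(1) W(1) by measurable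
    note prod = indep_set_expectation_product[OF indep F mF int0 V(1), of "\<lambda>v. v $ a * v $ b"]
    show "integrable M (\<lambda>\<omega>. (G \<omega> $ a * W \<omega> $ b) * (V \<omega> $ a * V \<omega> $ b))"
      using prod(1) iV by simp
    show "expectation (\<lambda>\<omega>. (G \<omega> $ a * W \<omega> $ b) * (V \<omega> $ a * V \<omega> $ b))
       = expectation (\<lambda>\<omega>. G \<omega> $ a * W \<omega> $ b) * \<sigma> a b"
      using prod(2) iV by (simp add: \<sigma>_def)
  qed
  have expand: "(x \<bullet> w) * (y \<bullet> w) = (\<Sum>a\<in>UNIV. \<Sum>b\<in>UNIV. (x $ a * y $ b) * (w $ a * w $ b))"
    for x y w :: "real ^ 'd"
    unfolding inner_vec_def sum_product by (simp add: algebra_simps)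
  have "expectation (\<lambda>\<omega>. (G \<omega> \<bullet> V \<omega>) * (W \<omega> \<bullet> V \<omega>))
      = (\<Sum>a\<in>UNIV. \<Sum>b\<in>UNIV. expectation (\<lambda>\<omega>. G \<omega> $ a * W \<omega> $ b) * \<sigma> a b)"
    unfolding expand using prod by (simp add: Bochner_Integration.integral_sum)
  also have "\<dots> = expectation (\<lambda>\<omega>. \<Sum>a\<in>UNIV. \<Sum>b\<in>UNIV. (G \<omega> $ a * W \<omega> $ b) * \<sigma> a b)"
    using int0 by (simp add: Bochner_Integration.integral_sum)
  finally have "real (dim L) * expectation (\<lambda>\<omega>. (G \<omega> \<bullet> V \<omega>) * (W \<omega> \<bullet> V \<omega>))
      = expectation (\<lambda>\<omega>. real (dim L) * (\<Sum>a\<in>UNIV. \<Sum>b\<in>UNIV. (G \<omega> $ a * W \<omega> $ b) * \<sigma> a b))"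
    by simp
  also have "\<dots> = expectation (\<lambda>\<omega>. G \<omega> \<bullet> W \<omega>)"
  proof (rule Bochner_Integration.integral_cong[OF refl])
    fix \<omega> assume \<omega>: "\<omega> \<in> space M"
    have "integrable ?\<mu> (\<lambda>v. v $ a * v $ b)" for a b
      using uniform_sphere_integrable_product[OF unif, of "axis a 1" "axis b 1"]
      by (simp add: inner_axis')
    then have "(\<integral>v. (G \<omega> \<bullet> v) * (W \<omega> \<bullet> v) \<partial>?\<mu>)
        = (\<Sum>a\<in>UNIV. \<Sum>b\<in>UNIV. (G \<omega> $ a * W \<omega> $ b) * \<sigma> a b)"
      unfolding expand \<sigma>_def by (simp add: Bochner_Integration.integral_sum)
    then show "real (dim L) * (\<Sum>a\<in>UNIV. \<Sum>b\<in>UNIV. (G \<omega> $ a * W \<omega> $ b) * \<sigma> a b) = G \<omega> \<bullet> W \<omega>"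
      using uniform_sphere_covariance[OF unif L WL[OF \<omega>], of "G \<omega>"] by simp
  qed
  finally show ?thesis .
qed

end
end

text \<open>The measure \<open>N\<close> is arbitrary in order to cover the \<open>\<sigma>\<close>-algebra of the past: the state after \<open>m\<close> blocks is
a function of the directions and responses of these blocks only.\<close>

lemma agent_states_measurable:
  fixes v :: "nat \<Rightarrow> 'n::finite \<Rightarrow> 'w \<Rightarrow> real ^ 'd"
  assumes S_def: "\<And>\<omega>. S \<omega> = agent_states \<K> ctr r E A K \<eta> \<delta> \<epsilon> loo ip (\<lambda>t j. v t j \<omega>) (\<lambda>t j. ob t j \<omega>)"
    and feas: "feasible_set \<K> ctr r R k" and net: "network E A" "second_eigenvalue A < 1"
    and pos: "0 < K" "0 < \<eta>" "0 < \<delta>" "\<delta> < r" "\<epsilon> = (real K)\<^sup>2 * \<eta>\<^sup>2 / \<delta>\<^sup>2"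
    and proj: "implements_infeasible_projection R (shrunk_set \<K> ctr r \<delta>) \<epsilon> loo ip"
    and meas: "\<And>s j. s \<in> {1..m * K} \<Longrightarrow> v s j \<in> borel_measurable N"
      "\<And>s j. s \<in> {1..m * K} \<Longrightarrow> ob s j \<in> borel_measurable N"
  shows "(\<lambda>\<omega>. (feas_pt (S \<omega> m i), infeas_pt (S \<omega> m i))) \<in> borel_measurable N"
  using meas
proof (induction m arbitrary: i)
  case 0
  then show ?case by (simp add: S_def)
next
  case (Suc m)
  interpret run: gossip_run \<K> ctr r R k E A K \<eta> \<delta> \<epsilon> loo ip "\<lambda>t j. v t j \<omega>" "\<lambda>t j. ob t j \<omega>" 0 0 for \<omega>
    by unfold_locales (use feas net pos proj in auto)
  have "{1..m * K} \<subseteq> {1..Suc m * K}" by auto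
  then have IH: "(\<lambda>\<omega>. (feas_pt (S \<omega> m j), infeas_pt (S \<omega> m j))) \<in> borel_measurable N" for j
    using Suc.prems by (intro Suc.IH) auto
  have "(\<lambda>\<omega>. fst (feas_pt (S \<omega> m j), infeas_pt (S \<omega> m j))) \<in> borel_measurable N"
    "(\<lambda>\<omega>. snd (feas_pt (S \<omega> m j), infeas_pt (S \<omega> m j))) \<in> borel_measurable N" for j
    by (rule measurable_compose[OF IH[of j] borel_measurable_continuous_onI];
        intro continuous_intros)+
  then have [measurable]: "(\<lambda>\<omega>. feas_pt (S \<omega> m j)) \<in> borel_measurable N"
    "(\<lambda>\<omega>. infeas_pt (S \<omega> m j)) \<in> borel_measurable N" for j
    by simp_all
  have [measurable]: "v t i \<in> borel_measurable N" "ob t i \<in> borel_measurable N"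
    if "t \<in> {m * K + 1..(m + 1) * K}" for t
    using that Suc.prems by auto
  have "(\<lambda>\<omega>. (gossip A (run.X \<omega> m) $ i, run.target \<omega> m i))
      \<in> measurable N (restrict_space borel (shrunk_set \<K> ctr r \<delta> \<times> UNIV))"
  proof (rule measurable_restrict_space2)
    show "(\<lambda>\<omega>. (gossip A (run.X \<omega> m) $ i, run.target \<omega> m i)) \<in> space N \<rightarrow> shrunk_set \<K> ctr r \<delta> \<times> UNIV"
      using run.gossip_X_feasible by auto
    have "(\<lambda>\<omega>. gossip A (run.X \<omega> m) $ i) \<in> borel_measurable N"
      unfolding gossip_def run.X_def S_def[symmetric] vec_lambda_beta by measurable
    moreover have "(\<lambda>\<omega>. run.target \<omega> m i) \<in> borel_measurable N"
      unfolding run.target_def run.G_def gossip_def run.Y_def S_def[symmetric] vec_lambda_beta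
      by measurable
    ultimately show "(\<lambda>\<omega>. (gossip A (run.X \<omega> m) $ i, run.target \<omega> m i)) \<in> borel_measurable N"
      by (simp add: borel_prod[symmetric])
  qed
  moreover have "(\<lambda>(x\<^sub>0, y\<^sub>0). program_result loo (ip (shrunk_set \<K> ctr r \<delta>) x\<^sub>0 y\<^sub>0 \<epsilon>))
      \<in> borel_measurable (restrict_space borel (shrunk_set \<K> ctr r \<delta> \<times> UNIV))"
    using proj by (simp add: implements_infeasible_projection_def)
  ultimately have "(\<lambda>\<omega>. (\<lambda>(x\<^sub>0, y\<^sub>0). program_result loo (ip (shrunk_set \<K> ctr r \<delta>) x\<^sub>0 y\<^sub>0 \<epsilon>))
      (gossip A (run.X \<omega> m) $ i, run.target \<omega> m i)) \<in> borel_measurable N"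
    by (rule measurable_compose)
  then show ?case
    unfolding S_def run.states_Suc run.prog_def by simp
qed

section \<open>Expected regret\<close>

text \<open>Every outcome gives a sample path of the kind considered above; randomness enters through the
directions and the responses only.\<close>

locale bandit_run = prob_space M for M :: "'w measure" +
  fixes \<gamma> c r R L\<^sub>1 L\<^sub>2 B\<^sub>0 :: real and k :: nat
    and \<K> :: "(real ^ 'd) set" and ctr :: "real ^ 'd"
    and E :: "('n::finite \<times> 'n) set" and A :: "real ^ 'n ^ 'n"
    and f :: "nat \<Rightarrow> 'n \<Rightarrow> real ^ 'd \<Rightarrow> real"
    and T K :: nat and \<eta> \<delta> \<epsilon> :: real
    and loo :: "real ^ 'd \<Rightarrow> real ^ 'd" and ip :: "'d infeasible_projection"
    and v :: "nat \<Rightarrow> 'n \<Rightarrow> 'w \<Rightarrow> real ^ 'd" and ob :: "nat \<Rightarrow> 'n \<Rightarrow> 'w \<Rightarrow> real"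
    and st :: "'w \<Rightarrow> nat \<Rightarrow> 'n \<Rightarrow> (real ^ 'd) agent_state"
    and p :: "nat \<Rightarrow> 'n \<Rightarrow> 'w \<Rightarrow> real ^ 'd"
  assumes \<gamma>c: "0 < \<gamma>" "\<gamma> \<le> 1" "0 \<le> c" "c \<le> 1"
    and feas: "feasible_set \<K> ctr r R k"
    and net: "network E A" and gap: "second_eigenvalue A < 1"
    and adm: "\<forall>t\<in>{1..T}. \<forall>i. admissible_objective \<gamma> c L\<^sub>1 L\<^sub>2 (f t i)"
    and pos: "0 < T" "0 < K" "K dvd T" "0 < \<eta>" "0 < \<delta>" "\<delta> < r"
    and tolerance: "\<epsilon> = (real K)\<^sup>2 * \<eta>\<^sup>2 / \<delta>\<^sup>2"
    and projection: "implements_infeasible_projection R (shrunk_set \<K> ctr r \<delta>) \<epsilon> loo ip"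
    and st_def: "st = (\<lambda>\<omega>. agent_states \<K> ctr r E A K \<eta> \<delta> \<epsilon> loo ip
                  (\<lambda>t j. v t j \<omega>) (\<lambda>t j. ob t j \<omega>))"
    and p_def: "p = (\<lambda>t j \<omega>. played_point \<K> ctr r E A K \<eta> \<delta> \<epsilon> loo ip
                  (\<lambda>t j. v t j \<omega>) (\<lambda>t j. ob t j \<omega>) t j)"
    and sampling: "uniform_sampling M (direction_space \<K> ctr) T v ob"
    and queries: "bounded_zeroth_order_oracle M B\<^sub>0 T f p v ob"
begin

abbreviation "\<K>\<^sub>\<delta> \<equiv> shrunk_set \<K> ctr r \<delta>"
abbreviation "L \<equiv> direction_space \<K> ctr"

text \<open>The iterate of agent \<open>i\<close> that is current in round \<open>t\<close>; rounds are counted from 1, blocks from 0.\<close>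

definition "x t i \<omega> = feas_pt (st \<omega> ((t - 1) div K) i)"

lemma T_eq: "T div K * K = T"
  using pos(3) by simp

lemma p_eq: "p t i \<omega> = x t i \<omega> + \<delta> *\<^sub>R v t i \<omega>"
  unfolding x_def by (simp add: p_def st_def played_point_def)

lemma directions:
  assumes "t \<in> {1..T}"
  shows "v t i \<in> borel_measurable M" "\<omega> \<in> space M \<Longrightarrow> v t i \<omega> \<in> sphere 0 1 \<inter> L"
    "\<omega> \<in> space M \<Longrightarrow> norm (v t i \<omega>) = 1"
    "uniform_on_unit_sphere L (distr M borel (v t i))"
    "indep_set (sets (vimage_algebra (space M) (v t i) borel))
       (sets (info M v ob ({1..<t} \<times> UNIV \<union> {t} \<times> (- {i})) ({1..<t} \<times> UNIV)))"
proof -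
  have *: "v t i \<in> borel_measurable M \<and> (\<forall>\<omega>\<in>space M. v t i \<omega> \<in> sphere 0 1 \<inter> L) \<and>
        uniform_on_unit_sphere L (distr M borel (v t i)) \<and>
        indep_set (sets (vimage_algebra (space M) (v t i) borel))
          (sets (info M v ob ({1..<t} \<times> UNIV \<union> {t} \<times> (- {i})) ({1..<t} \<times> UNIV)))"
    using sampling assms by (simp add: uniform_sampling_def)
  then show "v t i \<in> borel_measurable M" "\<omega> \<in> space M \<Longrightarrow> v t i \<omega> \<in> sphere 0 1 \<inter> L"
    "\<omega> \<in> space M \<Longrightarrow> norm (v t i \<omega>) = 1"
    "uniform_on_unit_sphere L (distr M borel (v t i))"
    "indep_set (sets (vimage_algebra (space M) (v t i) borel))
       (sets (info M v ob ({1..<t} \<times> UNIV \<union> {t} \<times> (- {i})) ({1..<t} \<times> UNIV)))"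
    by auto
qed

lemma responses:
  assumes "t \<in> {1..T}"
  shows "ob t i \<in> borel_measurable M" "\<omega> \<in> space M \<Longrightarrow> \<bar>ob t i \<omega>\<bar> \<le> B\<^sub>0"
    "AE \<omega> in M. real_cond_exp M (info M v ob ({1..t} \<times> UNIV) ({1..<t} \<times> UNIV)) (ob t i) \<omega>
       = f t i (p t i \<omega>)"
  using queries assms by (auto simp: bounded_zeroth_order_oracle_def)

lemma B\<^sub>0_nonneg: "0 \<le> B\<^sub>0"
proof -
  obtain \<omega> where "\<omega> \<in> space M" using not_empty by auto
  then show ?thesis
    using responses(2)[of 1 \<omega> undefined] pos(1) by (simp add: order_trans[OF abs_ge_zero])
qed

lemma run:
  assumes "\<omega> \<in> space M"
  shows "gossip_run \<K> ctr r R k E A K \<eta> \<delta> \<epsilon> loo ip (\<lambda>t j. v t j \<omega>) (\<lambda>t j. ob t j \<omega>) B\<^sub>0 (T div K)"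
  by unfold_locales
    (use feas net gap pos tolerance projection B\<^sub>0_nonneg directions(2) responses(2) assms
      in \<open>simp_all only: T_eq\<close>)

lemma x_shrunk: "\<omega> \<in> space M \<Longrightarrow> x t i \<omega> \<in> \<K>\<^sub>\<delta>"
  using gossip_run.X_feasible[OF run, of \<omega> "(t - 1) div K" i] unfolding x_def
  by (simp add: gossip_run.X_def[OF run] st_def)

lemma x_feasible: "\<omega> \<in> space M \<Longrightarrow> x t i \<omega> \<in> \<K>"
  using x_shrunk shrunk_set_subset[OF feas pos(5,6)] by blast

lemma p_feasible: "t \<in> {1..T} \<Longrightarrow> \<omega> \<in> space M \<Longrightarrow> p t i \<omega> \<in> \<K>"
  unfolding p_eq using shrunk_set_perturbation[OF feas pos(5,6) x_shrunk] directions(2) by blast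

lemma feasible_in_box: "y \<in> \<K> \<Longrightarrow> y \<in> cbox 0 1"
  using feasible_facts(3)[OF feas] by blast

lemma objective:
  assumes "t \<in> {1..T}"
  shows "continuous_on \<K> (f t j)" "f t j differentiable_on cbox 0 1"
    "L\<^sub>1-lipschitz_on (cbox 0 1) (f t j)" "L\<^sub>2-lipschitz_on (cbox 0 1) (box_grad (f t j))"
    "continuous_on \<K> (box_grad (f t j))"
proof -
  have "admissible_objective \<gamma> c L\<^sub>1 L\<^sub>2 (f t j)" using adm assms by blast
  then show "continuous_on \<K> (f t j)" "f t j differentiable_on cbox 0 1"
    "L\<^sub>1-lipschitz_on (cbox 0 1) (f t j)" "L\<^sub>2-lipschitz_on (cbox 0 1) (box_grad (f t j))"
    "continuous_on \<K> (box_grad (f t j))"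
    using continuous_on_subset[OF _ feasible_facts(3)[OF feas]]
    by (auto simp: admissible_objective_def dest: lipschitz_on_continuous_on)
qed

lemma L_nonneg: "0 \<le> L\<^sub>1" "0 \<le> L\<^sub>2"
  using objective(3,4)[of 1] pos(1) lipschitz_on_nonneg by (force simp: Suc_le_eq)+

lemma bounded_on_feasible:
  fixes g :: "real ^ 'd \<Rightarrow> 'b::real_normed_vector"
  assumes "continuous_on \<K> g"
  obtains B where "\<And>y. y \<in> \<K> \<Longrightarrow> norm (g y) \<le> B"
proof -
  have "bounded (g ` \<K>)"
    using compact_continuous_image[OF assms feasible_facts(2)[OF feas]] by (rule compact_imp_bounded)
  then show thesis using that by (auto simp: bounded_iff)
qed

lemma x_measurable_past:
  assumes "t \<in> {1..T}"
  shows "x t i \<in> borel_measurable (info M v ob ({1..<t} \<times> UNIV) ({1..<t} \<times> UNIV))"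
proof -
  let ?N = "info M v ob ({1..<t} \<times> UNIV) ({1..<t} \<times> UNIV)"
  have "(t - 1) div K * K \<le> t - 1" by simp
  moreover have "t - 1 < t" using assms by simp
  ultimately have "(t - 1) div K * K < t" by (rule le_less_trans)
  then have sub: "s \<in> {1..<t}" if "s \<in> {1..(t - 1) div K * K}" for s
    using that by auto
  have "(\<lambda>\<omega>. (feas_pt (st \<omega> ((t - 1) div K) i), infeas_pt (st \<omega> ((t - 1) div K) i))) \<in> borel_measurable ?N"
  proof (rule agent_states_measurable[OF _ feas net gap pos(2,4,5,6) tolerance projection])
    show "st \<omega> = agent_states \<K> ctr r E A K \<eta> \<delta> \<epsilon> loo ip (\<lambda>t j. v t j \<omega>) (\<lambda>t j. ob t j \<omega>)" for \<omega>
      by (simp add: st_def)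
  qed (use sub in \<open>auto intro!: measurable_info_direction measurable_info_response\<close>)
  from measurable_compose[OF this borel_measurable_continuous_onI[of fst]]
  show ?thesis
    unfolding x_def[abs_def] by (simp add: continuous_on_fst)
qed

lemma past_subalgebra:
  assumes "t \<in> {1..T}" "J \<subseteq> {1..t} \<times> UNIV" "I \<subseteq> {1..t} \<times> UNIV"
  shows "subalgebra M (info M v ob I J)"
  using assms directions(1) responses(1) by (intro info_subalgebra) auto

lemma measurable_info_mono:
  fixes Z :: "'w \<Rightarrow> 'b::topological_space"
  assumes "Z \<in> borel_measurable (info M v ob I J)" "I \<subseteq> I'" "J \<subseteq> J'"
  shows "Z \<in> borel_measurable (info M v ob I' J')"
  using assms info_mono[OF assms(2,3), of M v ob]
  by (auto simp: measurable_def)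

lemma x_measurable: "t \<in> {1..T} \<Longrightarrow> x t i \<in> borel_measurable M"
  by (rule measurable_from_subalg[OF past_subalgebra x_measurable_past]) auto

lemma p_measurable: "t \<in> {1..T} \<Longrightarrow> p t i \<in> borel_measurable M"
  using x_measurable directions(1) by (simp add: p_eq[abs_def] cong: measurable_cong)

lemma objective_at_play_integrable:
  assumes "t \<in> {1..T}"
  shows "integrable M (\<lambda>\<omega>. f t j (p t i \<omega>))"
proof -
  obtain B where "\<And>y. y \<in> \<K> \<Longrightarrow> norm (f t j y) \<le> B"
    using bounded_on_feasible[OF objective(1)[OF assms]] by blast
  then show ?thesis
    using p_feasible[OF assms] p_measurable[OF assms]
    by (intro integrable_bounded[where B=B] borel_measurable_continuous_on_compose[OF objective(1)[OF assms]])
      auto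
qed

text \<open>Given the past and the direction, the response has mean \<open>f (x + \<delta> v)\<close>.  In its expansion at \<open>x\<close> the constant
term has zero mean against \<open>v\<close>, the linear term gives the gradient, and the quadratic remainder is
multiplied by \<open>k/\<delta>\<close>, which leaves an error of order \<open>\<delta>\<close>.\<close>

lemma gradient_estimate:
  assumes t: "t \<in> {1..T}" and z: "z \<in> \<K>\<^sub>\<delta>"
  shows "integrable M (\<lambda>\<omega>. real k / \<delta> * (ob t j \<omega> * (v t j \<omega> \<bullet> (z - x t j \<omega>))))"
    and "integrable M (\<lambda>\<omega>. box_grad (f t j) (x t j \<omega>) \<bullet> (z - x t j \<omega>))"
    and "expectation (\<lambda>\<omega>. box_grad (f t j) (x t j \<omega>) \<bullet> (z - x t j \<omega>))
      \<le> expectation (\<lambda>\<omega>. real k / \<delta> * (ob t j \<omega> * (v t j \<omega> \<bullet> (z - x t j \<omega>))))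
        + 2 * real k * L\<^sub>2 * R * \<delta>"
proof -
  \<comment> \<open>known before round \<open>t\<close>; also the directions of the other agents in it; just before the responses\<close>
  let ?past = "info M v ob ({1..<t} \<times> UNIV) ({1..<t} \<times> UNIV)"
  let ?others = "info M v ob ({1..<t} \<times> UNIV \<union> {t} \<times> (- {j})) ({1..<t} \<times> UNIV)"
  let ?now = "info M v ob ({1..t} \<times> UNIV) ({1..<t} \<times> UNIV)"
  define W where "W \<omega> = z - x t j \<omega>" for \<omega>
  define G where "G \<omega> = box_grad (f t j) (x t j \<omega>)" for \<omega>
  define F where "F \<omega> = f t j (x t j \<omega>)" for \<omega>
  have z': "z \<in> \<K>" using z shrunk_set_subset[OF feas pos(5,6)] by blast
  have W_bound: "norm (W \<omega>) \<le> 2 * R" if "\<omega> \<in> space M" for \<omega>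
    using norm_triangle_ineq4[of z "x t j \<omega>"] feasible_norm_le[OF feas z']
      feasible_norm_le[OF feas x_feasible[OF that, of t j]] by (simp add: W_def)
  have W_L: "W \<omega> \<in> L" if "\<omega> \<in> space M" for \<omega>
    unfolding W_def by (rule diff_in_direction_space[OF feas z' x_feasible[OF that]])
  obtain BG where G_bound: "\<And>\<omega>. \<omega> \<in> space M \<Longrightarrow> norm (G \<omega>) \<le> BG"
    using bounded_on_feasible[OF objective(5)[OF t, of j]] x_feasible unfolding G_def by metis
  obtain BF where F_bound: "\<And>\<omega>. \<omega> \<in> space M \<Longrightarrow> norm (F \<omega>) \<le> BF"
    using bounded_on_feasible[OF objective(1)[OF t, of j]] x_feasible unfolding F_def by metis
  have x_past: "x t j \<in> borel_measurable ?past"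
    using x_measurable_past[OF t] .
  have W_past: "W \<in> borel_measurable ?past" and G_past: "G \<in> borel_measurable ?past"
    and F_past: "F \<in> borel_measurable ?past"
    unfolding W_def[abs_def] G_def[abs_def] F_def[abs_def]
    using x_past x_feasible
    by (auto intro!: borel_measurable_continuous_on_compose[OF objective(5)[OF t]]
        borel_measurable_continuous_on_compose[OF objective(1)[OF t]])
  have others: "Z \<in> borel_measurable ?others" if "Z \<in> borel_measurable ?past"
    for Z :: "'w \<Rightarrow> 'b::topological_space"
    using that by (rule measurable_info_mono) auto
  have now: "Z \<in> borel_measurable ?now" if "Z \<in> borel_measurable ?past"
    for Z :: "'w \<Rightarrow> 'b::topological_space"
    using that by (rule measurable_info_mono) auto
  have past_M: "Z \<in> borel_measurable M" if "Z \<in> borel_measurable ?past"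
    for Z :: "'w \<Rightarrow> 'b::topological_space"
    by (rule measurable_from_subalg[OF past_subalgebra[OF t] that]) auto
  have sub_others: "subalgebra M ?others" using t by (intro past_subalgebra[of t]) auto
  have sub_now: "subalgebra M ?now" using t by (intro past_subalgebra[of t]) auto
  interpret now: finite_measure_subalgebra M ?now
    by unfold_locales (rule sub_now)
  have [measurable]: "W \<in> borel_measurable M" "G \<in> borel_measurable M" "F \<in> borel_measurable M"
    "v t j \<in> borel_measurable M" "ob t j \<in> borel_measurable M" "p t j \<in> borel_measurable M"
    using past_M[OF W_past] past_M[OF G_past] past_M[OF F_past] directions(1)[OF t]
      responses(1)[OF t] p_measurable[OF t] by auto
  have [measurable]: "(\<lambda>\<omega>. f t j (p t j \<omega>)) \<in> borel_measurable M"
    using objective_at_play_integrable[OF t] by blast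
  have vW: "\<bar>v t j \<omega> \<bullet> W \<omega>\<bar> \<le> 2 * R" if "\<omega> \<in> space M" for \<omega>
    using Cauchy_Schwarz_ineq2[of "v t j \<omega>" "W \<omega>"] directions(3)[OF t that, of j] W_bound[OF that] by simp
  have vG: "\<bar>G \<omega> \<bullet> v t j \<omega>\<bar> \<le> BG" if "\<omega> \<in> space M" for \<omega>
    using Cauchy_Schwarz_ineq2[of "G \<omega>" "v t j \<omega>"] directions(3)[OF t that, of j] G_bound[OF that] by simp
  have R: "0 \<le> R" using feasible_radius_nonneg[OF feas] .
  have prod_integrable: "integrable M (\<lambda>\<omega>. Z \<omega> * (v t j \<omega> \<bullet> W \<omega>))"
    if "Z \<in> borel_measurable M" "\<And>\<omega>. \<omega> \<in> space M \<Longrightarrow> \<bar>Z \<omega>\<bar> \<le> B" for Z :: "'w \<Rightarrow> real" and B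
  proof (rule integrable_bounded)
    show "norm (Z \<omega> * (v t j \<omega> \<bullet> W \<omega>)) \<le> B * (2 * R)" if "\<omega> \<in> space M" for \<omega>
      using vW[OF that] \<open>\<And>\<omega>. \<omega> \<in> space M \<Longrightarrow> \<bar>Z \<omega>\<bar> \<le> B\<close>[OF that] R
      by (simp only: real_norm_def abs_mult) (intro mult_mono, auto)
  qed (use that(1) in measurable)
  have int_ob: "integrable M (\<lambda>\<omega>. ob t j \<omega> * (v t j \<omega> \<bullet> W \<omega>))"
    using responses(2)[OF t] by (intro prod_integrable) auto
  have int_f: "integrable M (\<lambda>\<omega>. f t j (p t j \<omega>) * (v t j \<omega> \<bullet> W \<omega>))"
  proof -
    obtain B where "\<And>y. y \<in> \<K> \<Longrightarrow> norm (f t j y) \<le> B"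
      using bounded_on_feasible[OF objective(1)[OF t]] by blast
    then show ?thesis using p_feasible[OF t] by (intro prod_integrable) auto
  qed
  have int_F: "integrable M (\<lambda>\<omega>. F \<omega> * (v t j \<omega> \<bullet> W \<omega>))"
    using F_bound by (intro prod_integrable) auto
  have int_G: "integrable M (\<lambda>\<omega>. (G \<omega> \<bullet> v t j \<omega>) * (v t j \<omega> \<bullet> W \<omega>))"
    using vG by (intro prod_integrable) auto
  show "integrable M (\<lambda>\<omega>. real k / \<delta> * (ob t j \<omega> * (v t j \<omega> \<bullet> (z - x t j \<omega>))))"
    using int_ob unfolding W_def by simp
  show "integrable M (\<lambda>\<omega>. box_grad (f t j) (x t j \<omega>) \<bullet> (z - x t j \<omega>))"
    unfolding G_def[symmetric] W_def[symmetric]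
  proof (rule integrable_bounded)
    show "norm (G \<omega> \<bullet> W \<omega>) \<le> BG * (2 * R)" if "\<omega> \<in> space M" for \<omega>
      using Cauchy_Schwarz_ineq2[of "G \<omega>" "W \<omega>"] G_bound[OF that] W_bound[OF that]
        mult_mono[OF G_bound[OF that] W_bound[OF that]] norm_ge_zero[of "G \<omega>"]
      by (smt (verit) norm_ge_zero real_norm_def)
  qed measurable
  have response_mean: "expectation (\<lambda>\<omega>. ob t j \<omega> * (v t j \<omega> \<bullet> W \<omega>))
      = expectation (\<lambda>\<omega>. f t j (p t j \<omega>) * (v t j \<omega> \<bullet> W \<omega>))"
  proof -
    have "v t j \<in> borel_measurable ?now"
      using t by (intro measurable_info_direction) auto
    then have vW_now: "(\<lambda>\<omega>. v t j \<omega> \<bullet> W \<omega>) \<in> borel_measurable ?now"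
      using now[OF W_past] by measurable
    have "expectation (\<lambda>\<omega>. ob t j \<omega> * (v t j \<omega> \<bullet> W \<omega>))
        = expectation (\<lambda>\<omega>. (v t j \<omega> \<bullet> W \<omega>) * real_cond_exp M ?now (ob t j) \<omega>)"
      using now.real_cond_exp_intg(2)[OF _ vW_now, of "ob t j"] int_ob
      by (simp add: mult.commute)
    also have "\<dots> = expectation (\<lambda>\<omega>. f t j (p t j \<omega>) * (v t j \<omega> \<bullet> W \<omega>))"
      using responses(3)[OF t, of j] by (intro integral_cong_AE) auto
    finally show ?thesis .
  qed
  \<comment> \<open>the terms of order 0 and 1 in the expansion of \<open>f (x + \<delta> v)\<close>, tested against \<open>v \<bullet> W\<close>\<close>
  have zero_order: "expectation (\<lambda>\<omega>. F \<omega> * (v t j \<omega> \<bullet> W \<omega>)) = 0"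
  proof -
    have "(\<lambda>\<omega>. F \<omega> *\<^sub>R W \<omega>) \<in> borel_measurable ?others"
      using others[OF F_past] others[OF W_past] by measurable
    moreover have "norm (F \<omega> *\<^sub>R W \<omega>) \<le> BF * (2 * R)" if "\<omega> \<in> space M" for \<omega>
      using mult_mono[OF F_bound[OF that] W_bound[OF that]] F_bound[OF that]
      by (smt (verit) norm_ge_zero norm_scaleR real_norm_def)
    ultimately have "expectation (\<lambda>\<omega>. (F \<omega> *\<^sub>R W \<omega>) \<bullet> v t j \<omega>) = 0"
      using expectation_past_inner_direction[OF directions(5)[OF t] sub_others
          subspace_direction_space[OF feas] directions(1)[OF t] directions(3)[OF t] directions(4)[OF t]]
      by blast
    then show ?thesis by (simp add: inner_commute)
  qed
  have first_order: "real k * expectation (\<lambda>\<omega>. (G \<omega> \<bullet> v t j \<omega>) * (v t j \<omega> \<bullet> W \<omega>))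
      = expectation (\<lambda>\<omega>. G \<omega> \<bullet> W \<omega>)"
    using expectation_past_quadratic_direction[OF directions(5)[OF t] sub_others
          subspace_direction_space[OF feas] directions(1)[OF t] directions(3)[OF t] directions(4)[OF t]
          others[OF G_past] G_bound others[OF W_past] W_bound W_L]
      feasible_facts(6)[OF feas] by (simp add: inner_commute)
  have "expectation (\<lambda>\<omega>. F \<omega> * (v t j \<omega> \<bullet> W \<omega>)
        + \<delta> * ((G \<omega> \<bullet> v t j \<omega>) * (v t j \<omega> \<bullet> W \<omega>)) - L\<^sub>2 * \<delta>\<^sup>2 * (2 * R))
      \<le> expectation (\<lambda>\<omega>. f t j (p t j \<omega>) * (v t j \<omega> \<bullet> W \<omega>))"
  proof (rule integral_mono)
    fix \<omega> assume \<omega>: "\<omega> \<in> space M"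
    have "\<bar>f t j (x t j \<omega> + \<delta> *\<^sub>R v t j \<omega>) - f t j (x t j \<omega>) - G \<omega> \<bullet> (\<delta> *\<^sub>R v t j \<omega>)\<bar>
        \<le> L\<^sub>2 * (norm (\<delta> *\<^sub>R v t j \<omega>))\<^sup>2"
      unfolding G_def using x_feasible[OF \<omega>] p_feasible[OF t \<omega>, of j]
      by (intro first_order_expansion objective(2,4)[OF t] feasible_in_box) (auto simp: p_eq)
    then have "\<bar>f t j (p t j \<omega>) - F \<omega> - \<delta> * (G \<omega> \<bullet> v t j \<omega>)\<bar> \<le> L\<^sub>2 * \<delta>\<^sup>2"
      using directions(3)[OF t \<omega>, of j] by (simp add: p_eq F_def)
    then have "\<bar>f t j (p t j \<omega>) - F \<omega> - \<delta> * (G \<omega> \<bullet> v t j \<omega>)\<bar> * \<bar>v t j \<omega> \<bullet> W \<omega>\<bar> \<le> L\<^sub>2 * \<delta>\<^sup>2 * (2 * R)"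
      using vW[OF \<omega>] L_nonneg by (intro mult_mono) auto
    then have "- (L\<^sub>2 * \<delta>\<^sup>2 * (2 * R)) \<le> (f t j (p t j \<omega>) - F \<omega> - \<delta> * (G \<omega> \<bullet> v t j \<omega>)) * (v t j \<omega> \<bullet> W \<omega>)"
      unfolding abs_mult[symmetric] by linarith
    then show "F \<omega> * (v t j \<omega> \<bullet> W \<omega>) + \<delta> * ((G \<omega> \<bullet> v t j \<omega>) * (v t j \<omega> \<bullet> W \<omega>)) - L\<^sub>2 * \<delta>\<^sup>2 * (2 * R)
        \<le> f t j (p t j \<omega>) * (v t j \<omega> \<bullet> W \<omega>)"
      by (simp add: left_diff_distrib mult.assoc)
  qed (use int_f int_F int_G in auto)
  also have "expectation (\<lambda>\<omega>. F \<omega> * (v t j \<omega> \<bullet> W \<omega>)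
        + \<delta> * ((G \<omega> \<bullet> v t j \<omega>) * (v t j \<omega> \<bullet> W \<omega>)) - L\<^sub>2 * \<delta>\<^sup>2 * (2 * R))
      = \<delta> * expectation (\<lambda>\<omega>. (G \<omega> \<bullet> v t j \<omega>) * (v t j \<omega> \<bullet> W \<omega>)) - L\<^sub>2 * \<delta>\<^sup>2 * (2 * R)"
    using int_F int_G zero_order by (simp add: prob_space)
  finally have "real k / \<delta> * (\<delta> * expectation (\<lambda>\<omega>. (G \<omega> \<bullet> v t j \<omega>) * (v t j \<omega> \<bullet> W \<omega>)) - L\<^sub>2 * \<delta>\<^sup>2 * (2 * R))
      \<le> real k / \<delta> * expectation (\<lambda>\<omega>. ob t j \<omega> * (v t j \<omega> \<bullet> W \<omega>))"
    unfolding response_mean using pos by (intro mult_left_mono) auto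
  moreover have "real k / \<delta> * (\<delta> * expectation (\<lambda>\<omega>. (G \<omega> \<bullet> v t j \<omega>) * (v t j \<omega> \<bullet> W \<omega>)) - L\<^sub>2 * \<delta>\<^sup>2 * (2 * R))
      = expectation (\<lambda>\<omega>. G \<omega> \<bullet> W \<omega>) - 2 * real k * L\<^sub>2 * R * \<delta>"
    unfolding first_order[symmetric] using pos by (simp add: field_simps power2_eq_square)
  ultimately show "expectation (\<lambda>\<omega>. box_grad (f t j) (x t j \<omega>) \<bullet> (z - x t j \<omega>))
      \<le> expectation (\<lambda>\<omega>. real k / \<delta> * (ob t j \<omega> * (v t j \<omega> \<bullet> (z - x t j \<omega>))))
        + 2 * real k * L\<^sub>2 * R * \<delta>"
    unfolding G_def[symmetric] W_def[symmetric] by simp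
qed

text \<open>The comparator \<open>u\<close> is first replaced by a point \<open>z\<close> of the shrunk set (error \<open>e3\<close>), the point played by
agent \<open>i\<close> by the iterate of the agent \<open>j\<close> that owns the objective (error \<open>e2\<close>), and the gradient by its
estimate (error \<open>e1\<close>).  This leaves the linear regret of the path.\<close>

lemma expected_gap_bound:
  assumes u: "u \<in> \<K>"
  defines "\<Delta> \<equiv> gossip_run.\<Delta> k A B\<^sub>0"
  shows "\<gamma>\<^sup>2 / (1 + c * \<gamma>\<^sup>2) * (\<Sum>t = 1..T. \<Sum>j\<in>UNIV. f t j u)
      - (\<Sum>t = 1..T. \<Sum>j\<in>UNIV. expectation (\<lambda>\<omega>. f t j (p t i \<omega>)))
    \<le> real CARD('n) * (2 * R\<^sup>2 / \<eta>
        + \<eta> * real T * real K / \<delta>\<^sup>2 * (real k * B\<^sub>0 * (2 * \<Delta> + sqrt 3 + real k * B\<^sub>0 / 2))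
        + real T * (2 * real k * L\<^sub>2 * R * \<delta> + L\<^sub>1 * (\<delta> + (2 * sqrt 3 + 2 * \<Delta>) * (real K * \<eta> / \<delta>))
            + L\<^sub>1 * (2 * R * \<delta> / r)))"
proof -
  define \<alpha> where "\<alpha> = \<gamma>\<^sup>2 / (1 + c * \<gamma>\<^sup>2)"
  define \<beta> where "\<beta> = \<gamma> / (1 + c * \<gamma>\<^sup>2)"
  define D where "D = 1 + c * \<gamma>\<^sup>2"
  have "1 \<le> D" using \<gamma>c by (simp add: D_def)
  moreover have "\<gamma>\<^sup>2 \<le> 1" using \<gamma>c by (simp add: power_le_one)
  ultimately have \<alpha>: "0 \<le> \<alpha>" "\<alpha> \<le> 1" and \<beta>: "0 \<le> \<beta>" "\<beta> \<le> 1"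
    using \<gamma>c by (simp_all add: \<alpha>_def \<beta>_def D_def[symmetric] divide_le_eq_1)
  obtain z where z: "z \<in> \<K>\<^sub>\<delta>" "norm (u - z) \<le> 2 * R * \<delta> / r"
    using shrunk_set_near[OF feas pos(5,6) u] by blast
  have z': "z \<in> \<K>" using z(1) shrunk_set_subset[OF feas pos(5,6)] by blast
  define lin where "lin t j \<omega> = real k / \<delta> * (ob t j \<omega> * (v t j \<omega> \<bullet> (z - x t j \<omega>)))" for t j \<omega>
  define e1 where "e1 = 2 * real k * L\<^sub>2 * R * \<delta>"
  define e2 where "e2 = L\<^sub>1 * (\<delta> + (2 * sqrt 3 + 2 * \<Delta>) * (real K * \<eta> / \<delta>))"
  define e3 where "e3 = L\<^sub>1 * (2 * R * \<delta> / r)"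
  define b where "b = 2 * R\<^sup>2 / \<eta>
        + \<eta> * real T * real K / \<delta>\<^sup>2 * (real k * B\<^sub>0 * (2 * \<Delta> + sqrt 3 + real k * B\<^sub>0 / 2))"
  obtain \<omega>0 where \<omega>0: "\<omega>0 \<in> space M" using not_empty by auto
  have \<Delta>: "0 \<le> \<Delta>" unfolding \<Delta>_def by (rule gossip_run.\<Delta>_nonneg[OF run[OF \<omega>0]])
  have R: "0 \<le> R" by (rule feasible_radius_nonneg[OF feas])
  have e1: "0 \<le> e1" and b: "0 \<le> b"
    using L_nonneg R pos \<Delta> B\<^sub>0_nonneg by (auto simp: e1_def b_def)
  have near: "\<alpha> * f t j u \<le> \<alpha> * f t j z + e3" if t: "t \<in> {1..T}" for t j
  proof -
    have "f t j u - f t j z \<le> L\<^sub>1 * norm (u - z)"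
      using lipschitz_onD[OF objective(3)[OF t] feasible_in_box[OF u] feasible_in_box[OF z'], of j]
      by (simp add: dist_norm)
    also have "\<dots> \<le> e3" unfolding e3_def using z(2) L_nonneg by (intro mult_left_mono)
    finally have "\<alpha> * (f t j u - f t j z) \<le> \<alpha> * e3" using \<alpha> by (intro mult_left_mono)
    moreover have "0 \<le> e3" using L_nonneg R pos by (simp add: e3_def)
    then have "\<alpha> * e3 \<le> e3" using \<alpha> by (simp add: mult_left_le_one_le)
    ultimately show ?thesis by (simp add: right_diff_distrib)
  qed
  have consensus: "f t j (x t j \<omega>) - e2 \<le> f t j (p t i \<omega>)" if t: "t \<in> {1..T}" and \<omega>: "\<omega> \<in> space M" for t j \<omega>
  proof -
    have "(t - 1) div K \<le> T div K" using t by (intro div_le_mono) auto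
    from gossip_run.X_X_close[OF run[OF \<omega>] this, of i j]
    have "norm (x t i \<omega> - x t j \<omega>) \<le> (2 * sqrt 3 + 2 * \<Delta>) * (real K * \<eta> / \<delta>)"
      unfolding x_def by (simp add: gossip_run.X_def[OF run[OF \<omega>]] st_def \<Delta>_def gossip_run.h_def[OF run[OF \<omega>]])
    then have "norm (x t j \<omega> - p t i \<omega>) \<le> \<delta> + (2 * sqrt 3 + 2 * \<Delta>) * (real K * \<eta> / \<delta>)"
      using norm_triangle_ineq4[of "x t j \<omega> - x t i \<omega>" "\<delta> *\<^sub>R v t i \<omega>"] directions(3)[OF t \<omega>, of i] pos
      by (simp add: p_eq norm_minus_commute diff_diff_eq)
    then have "L\<^sub>1 * norm (x t j \<omega> - p t i \<omega>) \<le> e2"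
      unfolding e2_def using L_nonneg by (intro mult_left_mono)
    then show ?thesis
      using lipschitz_onD[OF objective(3)[OF t] feasible_in_box[OF x_feasible[OF \<omega>]]
          feasible_in_box[OF p_feasible[OF t \<omega>]], of j t j i] by (simp add: dist_norm)
  qed
  have round: "\<alpha> * f t j u - expectation (\<lambda>\<omega>. f t j (p t i \<omega>)) \<le> \<beta> * expectation (lin t j) + (e1 + e2 + e3)"
    if t: "t \<in> {1..T}" for t j
  proof -
    note gint = gradient_estimate[OF t z(1), of j]
    have "expectation (\<lambda>\<omega>. \<alpha> * f t j z - \<beta> * (box_grad (f t j) (x t j \<omega>) \<bullet> (z - x t j \<omega>)) - e2)
        \<le> expectation (\<lambda>\<omega>. f t j (p t i \<omega>))"
    proof (rule integral_mono)
      fix \<omega> assume \<omega>: "\<omega> \<in> space M"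
      have "\<alpha> * f t j z - f t j (x t j \<omega>) \<le> \<beta> * (box_grad (f t j) (x t j \<omega>) \<bullet> (z - x t j \<omega>))"
        unfolding \<alpha>_def \<beta>_def using adm t x_feasible[OF \<omega>] z'
        by (intro up_concave_linearization[OF \<gamma>c] feasible_in_box) auto
      then show "\<alpha> * f t j z - \<beta> * (box_grad (f t j) (x t j \<omega>) \<bullet> (z - x t j \<omega>)) - e2 \<le> f t j (p t i \<omega>)"
        using consensus[OF t \<omega>, of j] by linarith
    qed (use gint(2) objective_at_play_integrable[OF t] in auto)
    moreover have "expectation (\<lambda>\<omega>. \<alpha> * f t j z - \<beta> * (box_grad (f t j) (x t j \<omega>) \<bullet> (z - x t j \<omega>)) - e2)
        = \<alpha> * f t j z - \<beta> * expectation (\<lambda>\<omega>. box_grad (f t j) (x t j \<omega>) \<bullet> (z - x t j \<omega>)) - e2"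
      using gint(2) by (simp add: prob_space)
    moreover have "\<beta> * expectation (\<lambda>\<omega>. box_grad (f t j) (x t j \<omega>) \<bullet> (z - x t j \<omega>))
        \<le> \<beta> * (expectation (lin t j) + e1)"
      using gint(3) \<beta> unfolding lin_def e1_def by (intro mult_left_mono)
    moreover have "\<beta> * e1 \<le> e1" using \<beta> e1 by (simp add: mult_left_le_one_le)
    ultimately show ?thesis using near[OF t, of j] by (simp add: distrib_left)
  qed
  have lin_sum: "(\<Sum>t = 1..T. \<Sum>j\<in>UNIV. expectation (lin t j)) \<le> real CARD('n) * b"
  proof -
    have "(\<Sum>t = 1..T. \<Sum>j\<in>UNIV. expectation (lin t j)) = expectation (\<lambda>\<omega>. \<Sum>t = 1..T. \<Sum>j\<in>UNIV. lin t j \<omega>)"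
      using gradient_estimate(1)[OF _ z(1)] unfolding lin_def
      by (simp add: Bochner_Integration.integral_sum)
    also have "\<dots> \<le> expectation (\<lambda>\<omega>. real CARD('n) * b)"
    proof (rule integral_mono)
      show "integrable M (\<lambda>\<omega>. \<Sum>t = 1..T. \<Sum>j\<in>UNIV. lin t j \<omega>)"
        using gradient_estimate(1)[OF _ z(1)] unfolding lin_def
        by (intro Bochner_Integration.integrable_sum) auto
      fix \<omega> assume \<omega>: "\<omega> \<in> space M"
      show "(\<Sum>t = 1..T. \<Sum>j\<in>UNIV. lin t j \<omega>) \<le> real CARD('n) * b"
        using gossip_run.linear_regret_bound[OF run[OF \<omega>] z(1)]
        unfolding lin_def b_def \<Delta>_def T_eq x_def by (simp add: st_def)
    qed auto
    finally show ?thesis by (simp add: prob_space)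
  qed
  have "\<alpha> * (\<Sum>t = 1..T. \<Sum>j\<in>UNIV. f t j u)
      - (\<Sum>t = 1..T. \<Sum>j\<in>UNIV. expectation (\<lambda>\<omega>. f t j (p t i \<omega>)))
    = (\<Sum>t = 1..T. \<Sum>j\<in>UNIV. \<alpha> * f t j u - expectation (\<lambda>\<omega>. f t j (p t i \<omega>)))"
    by (simp add: sum_subtractf sum_distrib_left)
  also have "\<dots> \<le> (\<Sum>t = 1..T. \<Sum>j\<in>(UNIV :: 'n set). \<beta> * expectation (lin t j) + (e1 + e2 + e3))"
    using round by (intro sum_mono) auto
  also have "\<dots> = \<beta> * (\<Sum>t = 1..T. \<Sum>j\<in>UNIV. expectation (lin t j)) + real CARD('n) * (real T * (e1 + e2 + e3))"
    by (simp add: sum.distrib sum_distrib_left)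
  also have "\<beta> * (\<Sum>t = 1..T. \<Sum>j\<in>UNIV. expectation (lin t j)) \<le> \<beta> * (real CARD('n) * b)"
    using lin_sum \<beta> by (intro mult_left_mono)
  also have "\<beta> * (real CARD('n) * b) \<le> real CARD('n) * b"
    using b \<beta> by (intro mult_left_le_one_le) auto
  finally show ?thesis
    unfolding \<alpha>_def b_def e1_def e2_def e3_def by (simp add: algebra_simps)
qed

lemma regret_integrable: "integrable M (\<lambda>\<omega>. regret \<alpha> \<K> T f (\<lambda>t. p t i \<omega>))"
  unfolding regret_def using objective_at_play_integrable
  by (intro Bochner_Integration.integrable_diff integrable_mult_right
      Bochner_Integration.integrable_sum) auto

text \<open>The objectives are fixed in advance, so the best feasible point is not random, and the bound for each
\<open>u\<close> passes to the supremum.\<close>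

lemma expected_regret_bound:
  defines "\<Delta> \<equiv> gossip_run.\<Delta> k A B\<^sub>0"
  shows "expectation (\<lambda>\<omega>. regret (\<gamma>\<^sup>2 / (1 + c * \<gamma>\<^sup>2)) \<K> T f (\<lambda>t. p t i \<omega>))
    \<le> (2 * R\<^sup>2 + real k * B\<^sub>0 * (2 * \<Delta> + sqrt 3 + real k * B\<^sub>0 / 2)
        + 2 * real k * L\<^sub>2 * R + L\<^sub>1 + L\<^sub>1 * (2 * sqrt 3 + 2 * \<Delta>) * r + 2 * L\<^sub>1 * R / r)
      * (1 / \<eta> + \<eta> * real T * real K / \<delta>\<^sup>2 + \<delta> * real T)"
proof -
  define \<alpha> where "\<alpha> = \<gamma>\<^sup>2 / (1 + c * \<gamma>\<^sup>2)"
  define N where "N = real CARD('n)"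
  define Q where "Q = \<eta> * real T * real K / \<delta>\<^sup>2"
  define a1 where "a1 = 2 * R\<^sup>2"
  define a2 where "a2 = real k * B\<^sub>0 * (2 * \<Delta> + sqrt 3 + real k * B\<^sub>0 / 2)"
  define a3 where "a3 = 2 * real k * L\<^sub>2 * R + L\<^sub>1 + 2 * L\<^sub>1 * R / r"
  define a4 where "a4 = L\<^sub>1 * (2 * sqrt 3 + 2 * \<Delta>)"
  define P where "P = (\<Sum>t = 1..T. \<Sum>j\<in>UNIV. expectation (\<lambda>\<omega>. f t j (p t i \<omega>)))"
  define bnd where "bnd = a1 * (1 / \<eta>) + a2 * Q + a3 * (\<delta> * real T) + a4 * (\<delta> * Q)"
  have "0 < N" by (simp add: N_def)
  have "0 < 1 + c * \<gamma>\<^sup>2" using \<gamma>c by (simp add: add_pos_nonneg)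
  then have "0 < \<alpha>" using \<gamma>c by (simp add: \<alpha>_def)
  obtain \<omega>0 where \<omega>0: "\<omega>0 \<in> space M" using not_empty by auto
  have nonneg: "0 \<le> \<Delta>" "0 \<le> R" "0 \<le> L\<^sub>1" "0 \<le> L\<^sub>2" "0 \<le> B\<^sub>0" "0 < r" "0 < \<eta>" "0 < \<delta>" "0 \<le> Q"
    using gossip_run.\<Delta>_nonneg[OF run[OF \<omega>0]] feasible_radius_nonneg[OF feas] L_nonneg
      B\<^sub>0_nonneg pos feasible_facts(5)[OF feas] by (auto simp: \<Delta>_def Q_def)
  then have a: "0 \<le> a1" "0 \<le> a2" "0 \<le> a3" "0 \<le> a4"
    by (auto simp: a1_def a2_def a3_def a4_def)
  have gap_bound: "\<alpha> * (\<Sum>t = 1..T. \<Sum>j\<in>UNIV. f t j u) - P \<le> N * bnd" if "u \<in> \<K>" for u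
  proof -
    have "real T * (2 * real k * L\<^sub>2 * R * \<delta> + L\<^sub>1 * (\<delta> + (2 * sqrt 3 + 2 * \<Delta>) * (real K * \<eta> / \<delta>))
            + L\<^sub>1 * (2 * R * \<delta> / r)) = a3 * (\<delta> * real T) + a4 * (\<delta> * Q)"
      using nonneg by (simp add: a3_def a4_def Q_def field_simps power2_eq_square)
    then show ?thesis
      using expected_gap_bound[OF that, of i]
      unfolding \<alpha>_def[symmetric] P_def[symmetric] N_def[symmetric] \<Delta>_def[symmetric] Q_def[symmetric]
        a2_def[symmetric] bnd_def a1_def
      by (simp add: algebra_simps)
  qed
  have "\<alpha> * (SUP u\<in>\<K>. 1 / N * (\<Sum>t = 1..T. \<Sum>j\<in>UNIV. f t j u)) \<le> bnd + P / N"
  proof -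
    have "(SUP u\<in>\<K>. 1 / N * (\<Sum>t = 1..T. \<Sum>j\<in>UNIV. f t j u)) \<le> (bnd + P / N) / \<alpha>"
    proof (rule cSUP_least)
      show "\<K> \<noteq> {}" using feasible_facts(4)[OF feas] by auto
      fix u assume "u \<in> \<K>"
      from gap_bound[OF this]
      show "1 / N * (\<Sum>t = 1..T. \<Sum>j\<in>UNIV. f t j u) \<le> (bnd + P / N) / \<alpha>"
        using \<open>0 < N\<close> \<open>0 < \<alpha>\<close> by (simp add: field_simps)
    qed
    then show ?thesis using \<open>0 < \<alpha>\<close> by (simp add: field_simps)
  qed
  moreover have "expectation (\<lambda>\<omega>. regret \<alpha> \<K> T f (\<lambda>t. p t i \<omega>))
      = \<alpha> * (SUP u\<in>\<K>. 1 / N * (\<Sum>t = 1..T. \<Sum>j\<in>UNIV. f t j u)) - P / N"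
  proof -
    have "integrable M (\<lambda>\<omega>. \<Sum>t = 1..T. \<Sum>j\<in>UNIV. f t j (p t i \<omega>))"
      using objective_at_play_integrable by (intro Bochner_Integration.integrable_sum) auto
    moreover have "expectation (\<lambda>\<omega>. \<Sum>t = 1..T. \<Sum>j\<in>UNIV. f t j (p t i \<omega>)) = P"
      unfolding P_def using objective_at_play_integrable
      by (simp add: Bochner_Integration.integral_sum)
    ultimately show ?thesis
      unfolding regret_def N_def by (simp add: prob_space)
  qed
  ultimately have "expectation (\<lambda>\<omega>. regret \<alpha> \<K> T f (\<lambda>t. p t i \<omega>)) \<le> bnd"
    by linarith
  also have "bnd \<le> (a1 + a2 + a3 + a4 * r) * (1 / \<eta> + Q + \<delta> * real T)"
  proof -
    \<comment> \<open>the consensus error, absorbed into \<open>Q\<close> because \<open>\<delta> < r\<close>\<close>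
    have "a4 * (\<delta> * Q) \<le> a4 * (r * Q)"
      using a nonneg pos by (intro mult_left_mono mult_right_mono) auto
    moreover have "0 \<le> (a1 + a2 + a3 + a4 * r - a1) * (1 / \<eta>)"
      "0 \<le> (a1 + a3) * Q" "0 \<le> (a1 + a2 + a4 * r) * (\<delta> * real T)"
      using a nonneg by auto
    ultimately show ?thesis unfolding bnd_def by (simp add: algebra_simps)
  qed
  also have "a1 + a2 + a3 + a4 * r = 2 * R\<^sup>2 + real k * B\<^sub>0 * (2 * \<Delta> + sqrt 3 + real k * B\<^sub>0 / 2)
        + 2 * real k * L\<^sub>2 * R + L\<^sub>1 + L\<^sub>1 * (2 * sqrt 3 + 2 * \<Delta>) * r + 2 * L\<^sub>1 * R / r"
    by (simp add: a1_def a2_def a3_def a4_def)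
  finally show ?thesis
    unfolding \<alpha>_def Q_def .
qed

lemma calls_bound:
  assumes "\<omega> \<in> space M"
  shows "real (loo_calls (st \<omega> (T div K) i))
    \<le> 27 * R\<^sup>2 * (1 + (sqrt 3 + real k * B\<^sub>0) ^ 4 / 4) * (real T / (\<epsilon> * real K))"
proof -
  have "real (T div K) = real T / real K"
    using pos(3) by (rule real_of_nat_div)
  then show ?thesis
    using gossip_run.loo_calls_le[OF run[OF assms] order_refl, of i]
    by (simp add: st_def gossip_run.q_def[OF run[OF assms]] mult_ac)
qed

lemma comms_total:
  assumes "\<omega> \<in> space M"
  shows "real (\<Sum>i\<in>UNIV. comms (st \<omega> (T div K) i)) = real CARD('n) * (real T / real K)"
  using gossip_run.comms_eq[OF run[OF assms]] pos(3) by (simp add: st_def real_of_nat_div)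

end

theorem theorem3:
  fixes \<gamma> c \<alpha> R r lam2 L\<^sub>1 L\<^sub>2 B\<^sub>0 :: real and k :: nat
  assumes "0 < \<gamma>" "\<gamma> \<le> 1" "0 \<le> c" "c \<le> 1" "lam2 < 1"
    and "\<alpha> = \<gamma>\<^sup>2 / (1 + c * \<gamma>\<^sup>2)"
  shows "\<exists>C::real.
    \<forall>(\<K> :: (real ^ 'd) set) ctr (E :: ('n::finite \<times> 'n) set) A f T K \<eta> \<delta> \<epsilon> loo ip
      (M :: 'w measure) v ob st p.
      feasible_set \<K> ctr r R k \<longrightarrow>
      network E A \<longrightarrow> second_eigenvalue A = lam2 \<longrightarrow>
      (\<forall>t\<in>{1..T}. \<forall>i. admissible_objective \<gamma> c L\<^sub>1 L\<^sub>2 (f t i)) \<longrightarrow>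
      0 < T \<longrightarrow> 0 < K \<longrightarrow> K dvd T \<longrightarrow> 0 < \<eta> \<longrightarrow> 0 < \<delta> \<longrightarrow> \<delta> < r \<longrightarrow>
      \<epsilon> = (real K)\<^sup>2 * \<eta>\<^sup>2 / \<delta>\<^sup>2 \<longrightarrow>
      is_LOO (shrunk_set \<K> ctr r \<delta>) loo \<longrightarrow>
      implements_infeasible_projection R (shrunk_set \<K> ctr r \<delta>) \<epsilon> loo ip \<longrightarrow>
      prob_space M \<longrightarrow>
      st = (\<lambda>\<omega>. agent_states \<K> ctr r E A K \<eta> \<delta> \<epsilon> loo ip
                  (\<lambda>t j. v t j \<omega>) (\<lambda>t j. ob t j \<omega>)) \<longrightarrow>
      p = (\<lambda>t j \<omega>. played_point \<K> ctr r E A K \<eta> \<delta> \<epsilon> loo ip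
                  (\<lambda>t j. v t j \<omega>) (\<lambda>t j. ob t j \<omega>) t j) \<longrightarrow>
      uniform_sampling M (direction_space \<K> ctr) T v ob \<longrightarrow>
      bounded_zeroth_order_oracle M B\<^sub>0 T f p v ob \<longrightarrow>
      (\<forall>i. integrable M (\<lambda>\<omega>. regret \<alpha> \<K> T f (\<lambda>t. p t i \<omega>)) \<and>
           prob_space.expectation M (\<lambda>\<omega>. regret \<alpha> \<K> T f (\<lambda>t. p t i \<omega>))
             \<le> C * (1 / \<eta> + \<eta> * real T * real K / \<delta>\<^sup>2 + \<delta> * real T)) \<and>
      (\<forall>\<omega>\<in>space M.
         (\<forall>i. real (loo_calls (st \<omega> (T div K) i)) \<le> C * (real T / (\<epsilon> * real K))) \<and>
         real (\<Sum>i\<in>UNIV. comms (st \<omega> (T div K) i)) \<le> C * (real T / real K)) \<and>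
      (\<forall>\<theta>. 0 \<le> \<theta> \<longrightarrow> \<theta> \<le> 1 \<longrightarrow>
         real K = real T powr (1 - \<theta>) \<longrightarrow>
         \<delta> = real T powr (- \<theta> / 4) \<longrightarrow>
         \<eta> = \<delta> / sqrt (real K * real T) \<longrightarrow>
         (\<forall>i. prob_space.expectation M (\<lambda>\<omega>. regret \<alpha> \<K> T f (\<lambda>t. p t i \<omega>))
                \<le> C * real T powr (1 - \<theta> / 4)) \<and>
         (\<forall>\<omega>\<in>space M.
            (\<forall>i. real (loo_calls (st \<omega> (T div K) i)) \<le> C * real T powr (2 * \<theta>)) \<and>
            real (\<Sum>i\<in>UNIV. comms (st \<omega> (T div K) i)) \<le> C * real T powr \<theta>))"
proof -
  define N where "N = real CARD('n)"
  define q where "q = sqrt 3 + real k * B\<^sub>0"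
  define \<Delta> where "\<Delta> = 2 * sqrt N * q / (1 - lam2)"
  define C1 where "C1 = 2 * R\<^sup>2 + real k * B\<^sub>0 * (2 * \<Delta> + sqrt 3 + real k * B\<^sub>0 / 2)
        + 2 * real k * L\<^sub>2 * R + L\<^sub>1 + L\<^sub>1 * (2 * sqrt 3 + 2 * \<Delta>) * r + 2 * L\<^sub>1 * R / r"
  define C2 where "C2 = 27 * R\<^sup>2 * (1 + q ^ 4 / 4)"
  \<comment> \<open>the factor 3 serves the special choice of parameters, where the three terms of the rate are equal\<close>
  define C where "C = 3 * (max 0 C1 + C2 + N)"
  have C2: "0 \<le> C2" and N: "0 \<le> N" by (auto simp: C2_def N_def)
  then have C: "C1 \<le> C" "3 * C1 \<le> C" "C2 \<le> C" "N \<le> C" by (auto simp: C_def)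
  show ?thesis
  proof (intro exI[of _ C] allI impI)
    fix \<K> :: "(real ^ 'd) set" and ctr and E :: "('n \<times> 'n) set" and A f T K \<eta> \<delta> \<epsilon> loo ip
      and M :: "'w measure" and v ob st p
    assume feas: "feasible_set \<K> ctr r R k" and net: "network E A" and lam: "second_eigenvalue A = lam2"
      and adm: "\<forall>t\<in>{1..T}. \<forall>i. admissible_objective \<gamma> c L\<^sub>1 L\<^sub>2 (f t i)"
      and pos: "0 < T" "0 < K" "K dvd T" "0 < \<eta>" "0 < \<delta>" "\<delta> < r"
      and tol: "\<epsilon> = (real K)\<^sup>2 * \<eta>\<^sup>2 / \<delta>\<^sup>2"
      and "is_LOO (shrunk_set \<K> ctr r \<delta>) loo"
      and proj: "implements_infeasible_projection R (shrunk_set \<K> ctr r \<delta>) \<epsilon> loo ip"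
      and prob: "prob_space M"
      and st: "st = (\<lambda>\<omega>. agent_states \<K> ctr r E A K \<eta> \<delta> \<epsilon> loo ip
                  (\<lambda>t j. v t j \<omega>) (\<lambda>t j. ob t j \<omega>))"
      and p: "p = (\<lambda>t j \<omega>. played_point \<K> ctr r E A K \<eta> \<delta> \<epsilon> loo ip
                  (\<lambda>t j. v t j \<omega>) (\<lambda>t j. ob t j \<omega>) t j)"
      and sampling: "uniform_sampling M (direction_space \<K> ctr) T v ob"
      and queries: "bounded_zeroth_order_oracle M B\<^sub>0 T f p v ob"
    interpret bandit_run M \<gamma> c r R L\<^sub>1 L\<^sub>2 B\<^sub>0 k \<K> ctr E A f T K \<eta> \<delta> \<epsilon> loo ip v ob st p
      using assms prob feas net lam adm pos tol proj st p sampling queries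
      by (intro bandit_run.intro bandit_run_axioms.intro) auto
    obtain \<omega>0 where \<omega>0: "\<omega>0 \<in> space M" using not_empty by auto
    have \<Delta>: "gossip_run.\<Delta> k A B\<^sub>0 = \<Delta>"
      unfolding gossip_run.\<Delta>_def[OF run[OF \<omega>0]] gossip_run.q_def[OF run[OF \<omega>0]]
        \<Delta>_def q_def N_def lam ..
    define rate where "rate = 1 / \<eta> + \<eta> * real T * real K / \<delta>\<^sup>2 + \<delta> * real T"
    have rate: "0 \<le> rate" using pos by (simp add: rate_def)
    have regret: "expectation (\<lambda>\<omega>. regret \<alpha> \<K> T f (\<lambda>t. p t i \<omega>)) \<le> C1 * rate" for i
      using expected_regret_bound[of i] unfolding \<Delta> C1_def rate_def assms(6) .
    have calls: "real (loo_calls (st \<omega> (T div K) i)) \<le> C * (real T / (\<epsilon> * real K))"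
      if "\<omega> \<in> space M" for \<omega> i
    proof -
      have "C2 * (real T / (\<epsilon> * real K)) \<le> C * (real T / (\<epsilon> * real K))"
        using C(3) by (intro mult_right_mono) (auto simp: tol)
      then show ?thesis
        using calls_bound[OF that, of i] unfolding C2_def q_def by linarith
    qed
    have comms: "real (\<Sum>i\<in>UNIV. comms (st \<omega> (T div K) i)) \<le> C * (real T / real K)"
      if "\<omega> \<in> space M" for \<omega>
      unfolding comms_total[OF that] N_def[symmetric] using C(4) by (intro mult_right_mono) auto
    have general: "(\<forall>i. integrable M (\<lambda>\<omega>. regret \<alpha> \<K> T f (\<lambda>t. p t i \<omega>)) \<and>
           expectation (\<lambda>\<omega>. regret \<alpha> \<K> T f (\<lambda>t. p t i \<omega>)) \<le> C * rate)"
      using regret_integrable regret C(1) mult_right_mono[OF C(1) rate] order_trans by blast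
    have special: "(\<forall>i. expectation (\<lambda>\<omega>. regret \<alpha> \<K> T f (\<lambda>t. p t i \<omega>)) \<le> C * real T powr (1 - \<theta> / 4)) \<and>
         (\<forall>\<omega>\<in>space M.
            (\<forall>i. real (loo_calls (st \<omega> (T div K) i)) \<le> C * real T powr (2 * \<theta>)) \<and>
            real (\<Sum>i\<in>UNIV. comms (st \<omega> (T div K) i)) \<le> C * real T powr \<theta>)"
      if K: "real K = real T powr (1 - \<theta>)" and \<delta>: "\<delta> = real T powr (- \<theta> / 4)"
        and \<eta>: "\<eta> = \<delta> / sqrt (real K * real T)" for \<theta>
    proof -
      have T: "0 < real T" using pos by simp
      have mul: "real T powr a * real T = real T powr (a + 1)"
        and quot: "real T / real T powr a = real T powr (1 - a)" for a
        using T by (simp_all add: powr_add powr_diff)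
      have KT: "real K * real T = real T powr (2 - \<theta>)"
        unfolding K mul by simp
      have root: "sqrt (real K * real T) = real T powr (1 - \<theta> / 2)"
        unfolding KT using T by (simp add: powr_half_sqrt[symmetric] powr_powr diff_divide_distrib)
      have \<eta>': "\<eta> = real T powr (\<theta> / 4 - 1)"
        unfolding \<eta> root \<delta> by (simp add: powr_diff[symmetric])
      have t1: "1 / \<eta> = real T powr (1 - \<theta> / 4)"
        unfolding \<eta>' by (simp add: powr_minus_divide[symmetric])
      have t2: "\<eta> * real T * real K / \<delta>\<^sup>2 = real T powr (1 - \<theta> / 4)"
      proof -
        have "\<delta>\<^sup>2 = real T powr (- \<theta> / 2)"
          unfolding \<delta> by (simp add: power2_eq_square powr_add[symmetric])
        then have "\<eta> * real T * real K / \<delta>\<^sup>2 = \<eta> * (real K * real T) / real T powr (- \<theta> / 2)"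
          by simp
        also have "\<dots> = real T powr (1 - \<theta> / 4)"
          unfolding \<eta>' KT by (simp add: powr_add[symmetric] powr_diff[symmetric])
        finally show ?thesis .
      qed
      have t3: "\<delta> * real T = real T powr (1 - \<theta> / 4)"
        unfolding \<delta> mul by simp
      have rate_eq: "rate = 3 * real T powr (1 - \<theta> / 4)"
        unfolding rate_def t1 t2 t3 by simp
      have TK: "real T / real K = real T powr \<theta>"
        unfolding K quot by simp
      have \<epsilon>: "\<epsilon> = real K / real T"
        unfolding tol \<eta> using pos by (simp add: power_divide power2_eq_square)
      have "real T / (\<epsilon> * real K) = (real T / real K) * (real T / real K)"
        unfolding \<epsilon> using pos by simp
      then have TeK: "real T / (\<epsilon> * real K) = real T powr (2 * \<theta>)"
        unfolding TK by (simp add: powr_add[symmetric])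
      have "C1 * rate \<le> C * real T powr (1 - \<theta> / 4)"
        unfolding rate_eq using mult_right_mono[OF C(2), of "real T powr (1 - \<theta> / 4)"] by simp
      then show ?thesis
        using regret calls comms order_trans unfolding TeK TK by blast
    qed
    show "(\<forall>i. integrable M (\<lambda>\<omega>. regret \<alpha> \<K> T f (\<lambda>t. p t i \<omega>)) \<and>
           expectation (\<lambda>\<omega>. regret \<alpha> \<K> T f (\<lambda>t. p t i \<omega>))
             \<le> C * (1 / \<eta> + \<eta> * real T * real K / \<delta>\<^sup>2 + \<delta> * real T)) \<and>
      (\<forall>\<omega>\<in>space M.
         (\<forall>i. real (loo_calls (st \<omega> (T div K) i)) \<le> C * (real T / (\<epsilon> * real K))) \<and>
         real (\<Sum>i\<in>UNIV. comms (st \<omega> (T div K) i)) \<le> C * (real T / real K)) \<and>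
      (\<forall>\<theta>. 0 \<le> \<theta> \<longrightarrow> \<theta> \<le> 1 \<longrightarrow>
         real K = real T powr (1 - \<theta>) \<longrightarrow>
         \<delta> = real T powr (- \<theta> / 4) \<longrightarrow>
         \<eta> = \<delta> / sqrt (real K * real T) \<longrightarrow>
         (\<forall>i. expectation (\<lambda>\<omega>. regret \<alpha> \<K> T f (\<lambda>t. p t i \<omega>))
                \<le> C * real T powr (1 - \<theta> / 4)) \<and>
         (\<forall>\<omega>\<in>space M.
            (\<forall>i. real (loo_calls (st \<omega> (T div K) i)) \<le> C * real T powr (2 * \<theta>)) \<and>
            real (\<Sum>i\<in>UNIV. comms (st \<omega> (T div K) i)) \<le> C * real T powr \<theta>))"
      using general[unfolded rate_def] calls comms special by auto
  qed
qed

end
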